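(* Let $X$ and $Y$ be complex infinite-dimensional Banach spaces, and let $A\in B(X)$ and $B\in B(Y)$ be given. For $C\in B(Y,X)$ let $M_C=\begin{pmatrix}A&C\\0&B\end{pmatrix}\in B(X\oplus Y)$. Then the following two statements are equivalent: (i) $M_C$ is a Browder operator for some $C\in B(Y,X)$; (ii) $A$ and $B$ satisfy all of the following conditions: (a) $A$ is a left semi-Browder operator; (b) $B$ is a right semi-Browder operator; (c) $N(A)\times N(B)\cong X/R(A)\times Y/R(B)$.
   Context: $B(Y,X)$ is the set of bounded linear operators from $Y$ to $X$, and $B(X)=B(X,X)$. For an operator $T$, $N(T)$ is its kernel and $R(T)$ its range. For $T\in B(Z)$ with $Z$ a Banach space, $\alpha(T)=\dim N(T)$ and $\beta(T)=\dim Z/R(T)$; $asc(T)=\inf\{k\ge 0:N(T^k)=N(T^{k+1})\}$ and $des(T)=\inf\{k\ge 0:R(T^k)=R(T^{k+1})\}$ (equal to $\infty$ if no such $k$ exists). $T$ is Fredholm if $\alpha(T)<\infty$ and $\beta(T)<\infty$. $T$ is Browder if it is Fredholm and $asc(T)=des(T)<\infty$. $T$ is left semi-Fredholm if $R(T)$ is a closed and complemented subspace of $Z$ and $\alpha(T)<\infty$; $T$ is right semi-Fredholm if $N(T)$ is a closed and complemented subspace of $Z$ and $\beta(T)<\infty$. $T$ is left semi-Browder if it is left semi-Fredholm and $asc(T)<\infty$; $T$ is right semi-Browder if it is right semi-Fredholm and $des(T)<\infty$. The symbol $\cong$ denotes isomorphism (linear homeomorphism) of Banach spaces. Under (a) and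 (b), both $R(A)$ and $R(B)$ are closed, so the quotients are Banach spaces. *)

theory Defs
  imports "HOL-Analysis.Analysis" "HOL-Library.Extended_Nat" "HOL-Library.Set_Algebras"
begin

section \<open>Complex Banach spaces\<close>

class complex_normed_vector = real_normed_vector +
  fixes scaleC :: "complex \<Rightarrow> 'a \<Rightarrow> 'a" (infixr "*\<^sub>C" 75)
  assumes scaleR_scaleC: "r *\<^sub>R x = complex_of_real r *\<^sub>C x"
    and scaleC_add_right: "a *\<^sub>C (x + y) = a *\<^sub>C x + a *\<^sub>C y"
    and scaleC_add_left: "(a + b) *\<^sub>C x = a *\<^sub>C x + b *\<^sub>C x"
    and scaleC_scaleC: "a *\<^sub>C (b *\<^sub>C x) = (a * b) *\<^sub>C x"
    and scaleC_one: "1 *\<^sub>C x = x"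
    and norm_scaleC: "norm (a *\<^sub>C x) = cmod a * norm x"

class complex_banach = complex_normed_vector + complete_space

subclass (in complex_banach) banach ..

lemma vector_space_scaleC:
  "vector_space (scaleC :: complex \<Rightarrow> 'a \<Rightarrow> 'a::complex_normed_vector)"
  by unfold_locales
    (simp_all add: scaleC_add_right scaleC_add_left scaleC_scaleC scaleC_one)

instantiation prod :: (complex_normed_vector, complex_normed_vector) complex_normed_vector
begin

definition scaleC_prod_def: "c *\<^sub>C p = (c *\<^sub>C fst p, c *\<^sub>C snd p)"

instance
proof
  fix a :: complex and x :: "'a \<times> 'b"
  show "norm (a *\<^sub>C x) = cmod a * norm x"
    by (simp add: scaleC_prod_def norm_prod_def norm_scaleC power_mult_distrib
        distrib_left [symmetric] real_sqrt_mult)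
qed (simp_all add: scaleC_prod_def scaleR_prod_def scaleR_scaleC
    scaleC_add_right scaleC_add_left scaleC_scaleC scaleC_one)

end

instance prod :: (complex_banach, complex_banach) complex_banach ..

abbreviation csubspace :: "'a::complex_normed_vector set \<Rightarrow> bool"
  where "csubspace \<equiv> module.subspace scaleC"

definition bounded_clinear ::
    "('a::complex_normed_vector \<Rightarrow> 'b::complex_normed_vector) \<Rightarrow> bool"
  where "bounded_clinear T \<longleftrightarrow> bounded_linear T \<and> (\<forall>c x. T (c *\<^sub>C x) = c *\<^sub>C T x)"


section \<open>Subspaces, quotients and products as complex normed spaces\<close>

text \<open>
  Kernels and quotients by ranges depend on an operator, so they cannot be types; they are
  represented by an explicit carrier with explicit operations.
\<close>

record 'v cnspace =
  vcarrier :: "'v set"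
  vzero :: 'v
  vadd :: "'v \<Rightarrow> 'v \<Rightarrow> 'v"
  vscale :: "complex \<Rightarrow> 'v \<Rightarrow> 'v"
  vnorm :: "'v \<Rightarrow> real"

definition sub_space :: "'a::complex_normed_vector set \<Rightarrow> 'a cnspace"
  where "sub_space S =
    \<lparr>vcarrier = S, vzero = 0, vadd = (+), vscale = scaleC, vnorm = norm\<rparr>"

text \<open>
  The elements of \<open>Z/M\<close> are the cosets \<open>z +o M\<close>, added as sets.  In the scalar multiplication
  the summand \<open>M\<close> matters only for the scalar 0, where the product must be \<open>M\<close>
  and not \<open>{0}\<close>.  The norm is the quotient norm, that is, the infimum of the norm over the coset.
\<close>

definition quotient_space :: "'a::complex_normed_vector set \<Rightarrow> 'a set cnspace"
  where "quotient_space M =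
    \<lparr>vcarrier = range (\<lambda>z. z +o M),
     vzero = M,
     vadd = (\<lambda>S T. S + T),
     vscale = (\<lambda>c S. scaleC c ` S + M),
     vnorm = (\<lambda>S. Inf (norm ` S))\<rparr>"

definition prod_space :: "'v cnspace \<Rightarrow> 'w cnspace \<Rightarrow> ('v \<times> 'w) cnspace" (infixr "\<times>\<^sub>s" 80)
  where "V \<times>\<^sub>s W =
    \<lparr>vcarrier = vcarrier V \<times> vcarrier W,
     vzero = (vzero V, vzero W),
     vadd = (\<lambda>(v, w) (v', w'). (vadd V v v', vadd W w w')),
     vscale = (\<lambda>c (v, w). (vscale V c v, vscale W c w)),
     vnorm = (\<lambda>(v, w). sqrt ((vnorm V v)\<^sup>2 + (vnorm W w)\<^sup>2))\<rparr>"

definition vdist :: "'v cnspace \<Rightarrow> 'v \<Rightarrow> 'v \<Rightarrow> real"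
  where "vdist V u v = vnorm V (vadd V u (vscale V (-1) v))"

definition vtopology :: "'v cnspace \<Rightarrow> 'v topology"
  where "vtopology V = Metric_space.mtopology (vcarrier V) (vdist V)"

definition vlinear :: "'v cnspace \<Rightarrow> 'w cnspace \<Rightarrow> ('v \<Rightarrow> 'w) \<Rightarrow> bool"
  where "vlinear V W f \<longleftrightarrow>
    f \<in> vcarrier V \<rightarrow> vcarrier W \<and>
    (\<forall>u\<in>vcarrier V. \<forall>v\<in>vcarrier V. f (vadd V u v) = vadd W (f u) (f v)) \<and>
    (\<forall>c. \<forall>v\<in>vcarrier V. f (vscale V c v) = vscale W c (f v))"

definition isomorphic_spaces :: "'v cnspace \<Rightarrow> 'w cnspace \<Rightarrow> bool" (infix "\<cong>\<^sub>s" 50)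
  where "V \<cong>\<^sub>s W \<longleftrightarrow>
    (\<exists>f. vlinear V W f \<and> homeomorphic_map (vtopology V) (vtopology W) f)"


subsection \<open>Dimension\<close>

definition vsubspace :: "'v cnspace \<Rightarrow> 'v set \<Rightarrow> bool"
  where "vsubspace V S \<longleftrightarrow>
    S \<subseteq> vcarrier V \<and> vzero V \<in> S \<and>
    (\<forall>u\<in>S. \<forall>v\<in>S. vadd V u v \<in> S) \<and> (\<forall>c. \<forall>v\<in>S. vscale V c v \<in> S)"

definition vspan :: "'v cnspace \<Rightarrow> 'v set \<Rightarrow> 'v set"
  where "vspan V B = vsubspace V hull B"

definition vbasis :: "'v cnspace \<Rightarrow> 'v set \<Rightarrow> bool"
  where "vbasis V B \<longleftrightarrow>
    B \<subseteq> vcarrier V \<and> vspan V B = vcarrier V \<and> (\<forall>b\<in>B. b \<notin> vspan V (B - {b}))"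

text \<open>Here and for ascent and descent below, the infimum of the empty set is \<open>\<infinity>\<close>.\<close>

definition vdim :: "'v cnspace \<Rightarrow> enat"
  where "vdim V = Inf {enat (card B) | B. finite B \<and> vbasis V B}"


section \<open>Fredholm and Browder operators\<close>

definition nullspace :: "('a \<Rightarrow> 'b::zero) \<Rightarrow> 'a set"
  where "nullspace T = {x. T x = 0}"

definition alpha :: "('a::complex_normed_vector \<Rightarrow> 'a) \<Rightarrow> enat"
  where "alpha T = vdim (sub_space (nullspace T))"

definition beta :: "('a::complex_normed_vector \<Rightarrow> 'a) \<Rightarrow> enat"
  where "beta T = vdim (quotient_space (range T))"

definition asc :: "('a::complex_normed_vector \<Rightarrow> 'a) \<Rightarrow> enat"
  where "asc T = Inf {enat k | k. nullspace (T ^^ k) = nullspace (T ^^ (k + 1))}"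

definition des :: "('a::complex_normed_vector \<Rightarrow> 'a) \<Rightarrow> enat"
  where "des T = Inf {enat k | k. range (T ^^ k) = range (T ^^ (k + 1))}"

definition complemented :: "'a::complex_normed_vector set \<Rightarrow> bool"
  where "complemented M \<longleftrightarrow>
    (\<exists>W. csubspace W \<and> closed W \<and> M \<inter> W = {0} \<and> M + W = UNIV)"

definition fredholm :: "('a::complex_normed_vector \<Rightarrow> 'a) \<Rightarrow> bool"
  where "fredholm T \<longleftrightarrow> alpha T < \<infinity> \<and> beta T < \<infinity>"

definition browder :: "('a::complex_normed_vector \<Rightarrow> 'a) \<Rightarrow> bool"
  where "browder T \<longleftrightarrow> fredholm T \<and> asc T = des T \<and> asc T < \<infinity>"

definition left_semi_fredholm :: "('a::complex_normed_vector \<Rightarrow> 'a) \<Rightarrow> bool"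
  where "left_semi_fredholm T \<longleftrightarrow>
    closed (range T) \<and> complemented (range T) \<and> alpha T < \<infinity>"

definition right_semi_fredholm :: "('a::complex_normed_vector \<Rightarrow> 'a) \<Rightarrow> bool"
  where "right_semi_fredholm T \<longleftrightarrow>
    closed (nullspace T) \<and> complemented (nullspace T) \<and> beta T < \<infinity>"

definition left_semi_browder :: "('a::complex_normed_vector \<Rightarrow> 'a) \<Rightarrow> bool"
  where "left_semi_browder T \<longleftrightarrow> left_semi_fredholm T \<and> asc T < \<infinity>"

definition right_semi_browder :: "('a::complex_normed_vector \<Rightarrow> 'a) \<Rightarrow> bool"
  where "right_semi_browder T \<longleftrightarrow> right_semi_fredholm T \<and> des T < \<infinity>"

definition upper_triangular ::
    "('a \<Rightarrow> 'a) \<Rightarrow> ('b \<Rightarrow> 'a) \<Rightarrow> ('b \<Rightarrow> 'b) \<Rightarrow> 'a \<times> 'b \<Rightarrow> 'a::complex_normed_vector \<times> 'b::complex_normed_vector"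
  where "upper_triangular A C B = (\<lambda>(x, y). (A x + C y, B y))"

end

theory Submission
  imports Defs
begin

text \<open>
  If \<open>M\<^sub>C\<close> is Browder it has index 0, which means that \<open>y \<mapsto> (C y, 0)\<close>, viewed as a map
  \<open>N(A) \<times> N(B) \<rightarrow> X/R(A) \<times> Y/R(B)\<close>, has index 0; a finite-rank perturbation, available by
  Hahn--Banach, makes it bijective.  A parametrix of \<open>M\<^sub>C\<close> inverts \<open>A\<close> from the left and \<open>B\<close> from the
  right modulo finite rank, hence both have generalized inverses.

  Conversely, let \<open>N = N(A\<^sup>p)\<close> and \<open>V = R(B\<^sup>q)\<close> be stable.  Then \<open>R(A)\<close> has codimension \<open>\<alpha>(A)\<close> in
  \<open>R(A) + N\<close>, and \<open>V \<inter> N(B)\<close> has codimension \<open>\<beta>(B)\<close> in \<open>N(B)\<close>, so the given isomorphism induces an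
  operator \<open>V \<inter> N(B) \<rightarrow> X/(R(A) + N)\<close> of index 0.  Made bijective by a finite-rank perturbation, it is
  the required \<open>C\<close>: now \<open>M\<^sub>C\<close> is nilpotent on \<open>N \<times> 0\<close>, bijective on \<open>(X \<times> V)/(N \<times> 0)\<close> and nilpotent on
  the finite-dimensional quotient by \<open>X \<times> V\<close>.
\<close>

section \<open>Finite codimension\<close>

text \<open>The isomorphism in (c) may mix the two factors, whereas \<open>C\<close> acts only from
  \<open>N(B)\<close> to \<open>X/R(A)\<close>. Under (a) and (b) the other two spaces,
  \<open>N(A)\<close> and \<open>Y/R(B)\<close>, are finite-dimensional, so what survives the
  passage between isomorphism and operator is an index, and finite-rank corrections absorb the rest.
  Fitting \<open>C\<close> to \<open>N(B)\<close> and \<open>X/R(A)\<close> themselves would control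
  kernel and range of the matrix, but not by itself its ascent and descent; hence the stable spaces
  \<open>N\<close> and \<open>V\<close>. They leave the index alone: \<alpha>(A) and \<beta>(B)
  enter once on the side of the domain and once on that of the codomain.

  Dimensions are never subtracted. Index 0 says that a kernel and a cokernel have the same number n,
  with \<open>codim n {0} S\<close> measuring a subspace and \<open>codim n R UNIV\<close> a
  quotient. Kernels and ranges are sets and not types, so the analytic theorems are stated relative
  to a subspace \<open>E\<close>, and maps into quotients are replaced by operators considered
  modulo \<open>R\<close>.\<close>

lemma csubspace_iff:
  "csubspace S \<longleftrightarrow> 0 \<in> S \<and> (\<forall>x\<in>S. \<forall>y\<in>S. x + y \<in> S) \<and> (\<forall>c. \<forall>x\<in>S. c *\<^sub>C x \<in> S)"
proof -
  interpret vector_space "scaleC :: complex \<Rightarrow> 'a \<Rightarrow> 'a"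
    by (rule vector_space_scaleC)
  show ?thesis by (auto simp: subspace_def)
qed

lemma scaleC_zero_left [simp]: "0 *\<^sub>C (x::'a::complex_normed_vector) = 0"
  by (metis add_cancel_right_left scaleC_add_left)

lemma scaleC_zero_right [simp]: "c *\<^sub>C (0::'a::complex_normed_vector) = 0"
  by (metis add_cancel_right_left scaleC_add_right)

lemma scaleC_minus_left: "(-c) *\<^sub>C (x::'a::complex_normed_vector) = - (c *\<^sub>C x)"
  by (metis add.right_inverse add_eq_0_iff scaleC_add_left scaleC_zero_left)

lemma scaleC_minus_right: "c *\<^sub>C (- x::'a::complex_normed_vector) = - (c *\<^sub>C x)"
  by (metis add.right_inverse add_eq_0_iff scaleC_add_right scaleC_zero_right)

lemma scaleC_diff_right: "c *\<^sub>C (x - y::'a::complex_normed_vector) = c *\<^sub>C x - c *\<^sub>C y"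
  by (metis scaleC_add_right scaleC_minus_right diff_conv_add_uminus)

lemma scaleC_minus_one [simp]: "(-1) *\<^sub>C (x::'a::complex_normed_vector) = - x"
  by (simp add: scaleC_minus_left scaleC_one)

lemma csubspace_0: "csubspace S \<Longrightarrow> 0 \<in> S"
  and csubspace_add: "csubspace S \<Longrightarrow> x \<in> S \<Longrightarrow> y \<in> S \<Longrightarrow> x + y \<in> S"
  and csubspace_scale: "csubspace S \<Longrightarrow> x \<in> S \<Longrightarrow> c *\<^sub>C x \<in> S"
  by (auto simp: csubspace_iff)

lemma csubspace_minus: "csubspace S \<Longrightarrow> x \<in> S \<Longrightarrow> - x \<in> S"
  by (metis csubspace_scale scaleC_minus_one)

lemma csubspace_diff: "csubspace S \<Longrightarrow> x \<in> S \<Longrightarrow> y \<in> S \<Longrightarrow> x - y \<in> S"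
  by (metis csubspace_add csubspace_minus diff_conv_add_uminus)

lemma csubspace_add_cancel: "csubspace S \<Longrightarrow> x \<in> S \<Longrightarrow> x + y \<in> S \<longleftrightarrow> y \<in> S"
  by (metis csubspace_add csubspace_diff add_diff_cancel_left')

lemma csubspace_scale_cancel: "csubspace S \<Longrightarrow> c \<noteq> 0 \<Longrightarrow> c *\<^sub>C x \<in> S \<longleftrightarrow> x \<in> S"
  by (metis csubspace_scale scaleC_one scaleC_scaleC field_class.field_inverse)

lemma csubspace_zero [simp]: "csubspace {0}"
  by (simp add: csubspace_iff)

lemma csubspace_UNIV [simp]: "csubspace UNIV"
  by (simp add: csubspace_iff)

lemma csubspace_Int: "csubspace S \<Longrightarrow> csubspace T \<Longrightarrow> csubspace (S \<inter> T)"
  by (auto simp: csubspace_iff)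

lemma csubspace_Times: "csubspace S \<Longrightarrow> csubspace T \<Longrightarrow> csubspace (S \<times> T)"
  by (auto simp: csubspace_iff scaleC_prod_def zero_prod_def)

lemma csubspace_plus:
  assumes "csubspace S" "csubspace T"
  shows "csubspace (S + T)"
  unfolding csubspace_iff
proof (intro conjI ballI allI)
  show "0 \<in> S + T"
    using assms by (metis add.right_neutral csubspace_0 set_plus_intro)
  fix x y c assume "x \<in> S + T" "y \<in> S + T"
  then obtain a b a' b' where "x = a + b" "y = a' + b'" "a \<in> S" "a' \<in> S" "b \<in> T" "b' \<in> T"
    by (auto simp: set_plus_def)
  moreover from this have "x + y = (a + a') + (b + b')" "c *\<^sub>C x = c *\<^sub>C a + c *\<^sub>C b"
    by (auto simp: scaleC_add_right)
  ultimately show "x + y \<in> S + T" "c *\<^sub>C x \<in> S + T"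
    using assms by (metis csubspace_add csubspace_scale set_plus_intro)+
qed

lemma csubspace_plus_absorb: "csubspace S \<Longrightarrow> csubspace T \<Longrightarrow> T \<subseteq> S \<Longrightarrow> S + T = S"
  by (auto simp: set_plus_def csubspace_add) (metis add.right_neutral csubspace_0)

lemma subset_plus_left: "csubspace T \<Longrightarrow> S \<subseteq> S + T"
  by (metis add.right_neutral csubspace_0 set_plus_intro subsetI)

lemma subset_plus_right: "csubspace S \<Longrightarrow> T \<subseteq> S + T"
  by (metis add.left_neutral csubspace_0 set_plus_intro subsetI)

lemma mem_plus_right: "csubspace S \<Longrightarrow> y \<in> T \<Longrightarrow> y \<in> S + T"
  using subset_plus_right by blast

lemma plus_subset: "csubspace U \<Longrightarrow> S \<subseteq> U \<Longrightarrow> T \<subseteq> U \<Longrightarrow> S + T \<subseteq> U"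
  by (auto simp: set_plus_def intro: csubspace_add)

text \<open>Counting codimensions is purely algebraic, so linearity is kept apart from
  boundedness.\<close>

definition clin :: "('a::complex_normed_vector \<Rightarrow> 'b::complex_normed_vector) \<Rightarrow> bool"
  where "clin T \<longleftrightarrow> (\<forall>x y. T (x + y) = T x + T y) \<and> (\<forall>c x. T (c *\<^sub>C x) = c *\<^sub>C T x)"

lemma clin_add: "clin T \<Longrightarrow> T (x + y) = T x + T y"
  and clin_scale: "clin T \<Longrightarrow> T (c *\<^sub>C x) = c *\<^sub>C T x"
  by (auto simp: clin_def)

lemma clin_0: "clin T \<Longrightarrow> T 0 = 0"
  by (metis clin_scale scaleC_zero_left)

lemma clin_minus: "clin T \<Longrightarrow> T (- x) = - T x"
  by (metis clin_scale scaleC_minus_one)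

lemma clin_diff: "clin T \<Longrightarrow> T (x - y) = T x - T y"
  using clin_add [of T x "- y"] by (simp add: clin_minus)

lemma csubspace_image: "clin T \<Longrightarrow> csubspace S \<Longrightarrow> csubspace (T ` S)"
  by (auto simp: csubspace_iff clin_0 image_iff)
     (metis clin_0 clin_add clin_scale)+

lemma csubspace_vimage: "clin T \<Longrightarrow> csubspace S \<Longrightarrow> csubspace {x. T x \<in> S}"
  unfolding csubspace_iff by (simp add: clin_0 clin_add clin_scale)

lemma csubspace_nullspace: "clin T \<Longrightarrow> csubspace (nullspace T)"
  using csubspace_vimage [of T "{0}"] by (simp add: nullspace_def)

lemma csubspace_range: "clin T \<Longrightarrow> csubspace (range T)"
  by (simp add: csubspace_image)

lemma clin_id: "clin (\<lambda>x. x)"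
  and clin_compose: "clin S \<Longrightarrow> clin T \<Longrightarrow> clin (\<lambda>x. S (T x))"
  and clin_fst: "clin fst"
  and clin_snd: "clin snd"
  by (auto simp: clin_def scaleC_prod_def)

lemma clin_funpow: "clin T \<Longrightarrow> clin (T ^^ n)" for T :: "'a::complex_normed_vector \<Rightarrow> 'a"
  by (induction n) (auto simp: clin_def)

section \<open>Exchange of vectors and uniqueness of codimension\<close>

definition line :: "'a::complex_normed_vector \<Rightarrow> 'a set" where
  "line x = range (\<lambda>c. c *\<^sub>C x)"

lemma csubspace_line: "csubspace (line x)"
  by (auto simp: csubspace_iff line_def image_iff intro: exI [of _ 0])
     (metis scaleC_add_left, metis scaleC_scaleC)

lemma mem_line: "x \<in> line x"
  by (auto simp: line_def image_iff intro: exI [of _ 1] simp: scaleC_one)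

lemma line_subset: "csubspace S \<Longrightarrow> x \<in> S \<Longrightarrow> line x \<subseteq> S"
  by (auto simp: line_def csubspace_scale)

lemma mem_plus_line: "y \<in> S + line x \<longleftrightarrow> (\<exists>s\<in>S. \<exists>c. y = s + c *\<^sub>C x)"
  by (auto simp: set_plus_def line_def)

text \<open>Since \<open>x\<close> lies outside \<open>S\<close>, its coefficient along
  \<open>y\<close> is nonzero and \<open>y\<close> can be expressed through \<open>x\<close>: the
  Steinitz exchange for one vector.\<close>

lemma plus_line_exchange:
  assumes "csubspace S" "x \<in> S + line y" "x \<notin> S"
  shows "S + line x = S + line y"
proof -
  obtain s c where x: "x = s + c *\<^sub>C y" and s: "s \<in> S"
    using assms(2) by (auto simp: mem_plus_line)
  with assms(3) have "c \<noteq> 0" by auto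
  then have y: "y = - (1/c) *\<^sub>C s + (1/c) *\<^sub>C x"
    by (simp add: x scaleC_add_right scaleC_scaleC scaleC_one scaleC_minus_left)
  have "y \<in> S + line x"
    unfolding mem_plus_line using y csubspace_scale [OF assms(1) s] by blast
  with assms show ?thesis
    by (intro subset_antisym plus_subset csubspace_plus csubspace_line subset_plus_left line_subset)
qed

text \<open>\<open>codim n K G\<close>: the subspace \<open>K\<close> has codimension \<open>n\<close> in \<open>G\<close>.\<close>

inductive codim :: "nat \<Rightarrow> 'a::complex_normed_vector set \<Rightarrow> 'a set \<Rightarrow> bool" where
  codim_0: "csubspace G \<Longrightarrow> codim 0 G G"
| codim_Suc: "csubspace K \<Longrightarrow> x \<in> G \<Longrightarrow> x \<notin> K \<Longrightarrow> codim n (K + line x) G \<Longrightarrow> codim (Suc n) K G"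

inductive_cases codim_0E: "codim 0 K G"
inductive_cases codim_SucE: "codim (Suc n) K G"

lemma codim_0_iff: "codim 0 K G \<longleftrightarrow> csubspace G \<and> K = G"
  by (auto elim: codim_0E intro: codim_0)

lemma codim_csubspace: "codim n K G \<Longrightarrow> csubspace K \<and> csubspace G \<and> K \<subseteq> G"
proof (induction rule: codim.induct)
  case (codim_Suc K x G n)
  then show ?case
    using subset_plus_left [OF csubspace_line, of K x] by blast
qed simp

lemma codim_line:
  assumes "csubspace K" "x \<notin> K" shows "codim 1 K (K + line x)"
proof -
  have "x \<in> K + line x"
    by (rule mem_plus_right [OF assms(1) mem_line])
  then show ?thesis
    using assms codim_Suc [of K x "K + line x" 0]
    by (simp add: codim_0_iff csubspace_plus csubspace_line)
qed

lemma codim_trans: "codim m K H \<Longrightarrow> codim n H G \<Longrightarrow> codim (m + n) K G"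
proof (induction rule: codim.induct)
  case (codim_Suc K x H m)
  then show ?case
    using codim_csubspace codim.codim_Suc by (metis add_Suc subsetD)
qed simp

text \<open>The inductive definition exhibits just one chain of vectors leading from
  \<open>K\<close> up to \<open>G\<close>. Here every vector of \<open>G\<close> outside
  \<open>K\<close> becomes a possible first link, and this makes the length of the chain an
  invariant.\<close>

lemma codim_exchange: "codim (Suc n) K G \<Longrightarrow> x \<in> G \<Longrightarrow> x \<notin> K \<Longrightarrow> codim n (K + line x) G"
proof (induction n arbitrary: K)
  case 0
  then obtain y where "csubspace K" "y \<in> G" "y \<notin> K" "codim 0 (K + line y) G"
    by (auto elim: codim_SucE)
  with 0 show ?case by (metis codim_0_iff plus_line_exchange)
next
  case (Suc n)
  then obtain y where y: "csubspace K" "y \<in> G" "y \<notin> K" "codim (Suc n) (K + line y) G"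
    by (auto elim: codim_SucE)
  show ?case
  proof (cases "x \<in> K + line y")
    case True
    then show ?thesis using Suc.prems y plus_line_exchange by metis
  next
    case False
    have "y \<notin> K + line x"
    proof
      assume "y \<in> K + line x"
      then have "K + line y = K + line x"
        using plus_line_exchange y by metis
      with False show False
        using mem_plus_right [OF y(1) mem_line] by simp
    qed
    moreover have "codim n (K + line x + line y) G"
      using Suc.IH [OF y(4) Suc.prems(2) False] by (simp add: ac_simps)
    ultimately show ?thesis
      using y by (intro codim_Suc csubspace_plus csubspace_line)
  qed
qed

lemma codim_unique: "codim m K G \<Longrightarrow> codim n K G \<Longrightarrow> m = n"
proof (induction arbitrary: n rule: codim.induct)
  case (codim_0 G)
  then show ?case by (cases n) (auto elim: codim_SucE)
next
  case (codim_Suc K x G m)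
  then obtain n' where "n = Suc n'"
    by (metis codim_0_iff not0_implies_Suc)
  with codim_Suc show ?case
    by (metis codim_exchange)
qed

text \<open>\<open>T\<close> induces a surjection from G/K onto (R + T G)/(R + T K). The last
  assumption puts everything in \<open>G\<close> that is sent into \<open>R\<close> already into
  \<open>K\<close>, which makes the surjection injective. Taking \<open>R\<close> to be zero, or
  \<open>T\<close> the identity, gives the two forms used later.\<close>

lemma codim_mod_image:
  assumes "clin T" "csubspace R" "csubspace K" "csubspace G" "K \<subseteq> G"
    and "{x\<in>G. T x \<in> R} \<subseteq> K"
  shows "codim n (R + T ` K) (R + T ` G) \<longleftrightarrow> codim n K G"
  using assms(3,5,6)
proof (induction n arbitrary: K)
  case 0
  have "G \<subseteq> K" if *: "R + T ` K = R + T ` G"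
  proof
    fix g assume g: "g \<in> G"
    then have "T g \<in> R + T ` K"
      unfolding * by (intro mem_plus_right assms imageI)
    then obtain r k where "r \<in> R" "k \<in> K" "T g = r + T k"
      by (auto simp: set_plus_def)
    then have "T (g - k) \<in> R" "g - k \<in> G"
      using assms(1,4) 0 g by (auto simp: clin_diff csubspace_diff)
    then have "g - k \<in> K" using 0 by blast
    then show "g \<in> K" using csubspace_add_cancel [OF 0(1) \<open>k \<in> K\<close>, of "g - k"] by simp
  qed
  then show ?case
    using assms 0 by (auto simp: codim_0_iff csubspace_plus csubspace_image)
next
  case (Suc n)
  \<comment> \<open>Modulo \<open>R\<close> the vectors \<open>r + T g\<close> and
    \<open>T g\<close> agree, so enlarging the image by a line amounts to enlarging \<open>K\<close>
    by a line. This carries chains over in both directions.\<close>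
  have line: "R + T ` K + line (r + T g) = R + T ` (K + line g)" if "r \<in> R" for r g
  proof (intro subset_antisym subsetI)
    fix z assume "z \<in> R + T ` K + line (r + T g)"
    then obtain r' k c where "z = (r' + T k) + c *\<^sub>C (r + T g)" "r' \<in> R" "k \<in> K"
      unfolding mem_plus_line by (auto simp: set_plus_def)
    then have "z = (r' + c *\<^sub>C r) + T (k + c *\<^sub>C g)"
      using assms(1) by (simp add: clin_add clin_scale scaleC_add_right)
    then show "z \<in> R + T ` (K + line g)"
      using \<open>r' \<in> R\<close> \<open>k \<in> K\<close> that assms(2)
      by (metis csubspace_add csubspace_scale imageI mem_plus_line set_plus_intro)
  next
    fix z assume "z \<in> R + T ` (K + line g)"
    then obtain r' h where "z = r' + T h" "r' \<in> R" "h \<in> K + line g"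
      by (auto elim: set_plus_elim)
    then obtain k c where "z = r' + T (k + c *\<^sub>C g)" "r' \<in> R" "k \<in> K"
      by (auto simp: mem_plus_line)
    then have "z = ((r' - c *\<^sub>C r) + T k) + c *\<^sub>C (r + T g)"
      using assms(1) by (simp add: clin_add clin_scale scaleC_add_right)
    then show "z \<in> R + T ` K + line (r + T g)"
      using \<open>r' \<in> R\<close> \<open>k \<in> K\<close> that assms(2)
      by (metis csubspace_diff csubspace_scale imageI mem_plus_line set_plus_intro)
  qed
  have line0: "R + T ` K + line (T g) = R + T ` (K + line g)" for g
    using line [OF csubspace_0 [OF assms(2)]] by simp
  have IH: "codim n (R + T ` (K + line g)) (R + T ` G) \<longleftrightarrow> codim n (K + line g) G" if "g \<in> G" for g
  proof (rule Suc.IH)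
    show "csubspace (K + line g)"
      by (simp add: Suc.prems csubspace_plus csubspace_line)
    show "K + line g \<subseteq> G"
      by (simp add: Suc.prems assms plus_subset line_subset that)
    show "{x \<in> G. T x \<in> R} \<subseteq> K + line g"
      using Suc.prems subset_plus_left [OF csubspace_line, of K g] by blast
  qed
  have RK: "csubspace (R + T ` K)"
    by (simp add: assms Suc.prems csubspace_plus csubspace_image)
  show ?case
  proof
    assume "codim (Suc n) (R + T ` K) (R + T ` G)"
    then obtain z where z: "z \<in> R + T ` G" "z \<notin> R + T ` K" "codim n (R + T ` K + line z) (R + T ` G)"
      by (auto elim: codim_SucE)
    then obtain r g where rg: "z = r + T g" "r \<in> R" "g \<in> G" by (auto simp: set_plus_def)
    have "g \<notin> K" using rg z by blast
    moreover have "codim n (K + line g) G"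
      using z rg line IH by simp
    ultimately show "codim (Suc n) K G"
      using rg Suc.prems by (intro codim_Suc)
  next
    assume "codim (Suc n) K G"
    then obtain g where g: "g \<in> G" "g \<notin> K" "codim n (K + line g) G" by (auto elim: codim_SucE)
    have "T g \<notin> R + T ` K"
    proof
      assume "T g \<in> R + T ` K"
      then obtain r k where rk: "r \<in> R" "k \<in> K" "T g = r + T k"
        by (auto simp: set_plus_def)
      then have "T (g - k) \<in> R" "g - k \<in> G"
        using assms(1,4) g Suc.prems by (auto simp: clin_diff csubspace_diff)
      then have "g - k \<in> K" using Suc.prems by blast
      then show False
        using csubspace_add_cancel [OF \<open>csubspace K\<close> \<open>k \<in> K\<close>, of "g - k"] g by simp
    qed
    moreover have "T g \<in> R + T ` G"
      using g by (intro mem_plus_right assms imageI)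
    ultimately show "codim (Suc n) (R + T ` K) (R + T ` G)"
      using g IH line0 RK by (intro codim_Suc [where x = "T g"]) auto
  qed
qed

lemma codim_image:
  assumes "clin T" "csubspace K" "csubspace G" "K \<subseteq> G" "{x\<in>G. T x = 0} \<subseteq> K"
  shows "codim n (T ` K) (T ` G) \<longleftrightarrow> codim n K G"
  using codim_mod_image [of T "{0}" K G n] assms by (simp add: set_plus_def)

text \<open>The second isomorphism theorem, obtained from the identity map taken modulo
  \<open>R\<close>.\<close>

lemma codim_diamond:
  assumes "csubspace R" "csubspace H"
  shows "codim n R (R + H) \<longleftrightarrow> codim n (R \<inter> H) H"
proof -
  have "R + R \<inter> H = R"
    by (simp add: assms csubspace_Int csubspace_plus_absorb)
  then show ?thesis
    using codim_mod_image [OF clin_id, of R "R \<inter> H" H n] assms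
    by (auto simp: csubspace_Int)
qed

text \<open>Each vector of the chain from \<open>K\<close> to \<open>G\<close> is charged to the
  lower part if it lies in the current \<open>H\<close> and to the upper part otherwise. In this way
  finite codimension passes to all intermediate subspaces.\<close>

lemma codim_split:
  "codim n K G \<Longrightarrow> csubspace H \<Longrightarrow> K \<subseteq> H \<Longrightarrow> H \<subseteq> G \<Longrightarrow> \<exists>a b. codim a K H \<and> codim b H G \<and> a + b = n"
proof (induction arbitrary: H rule: codim.induct)
  case (codim_0 G)
  then show ?case using codim.codim_0 by (metis add.right_neutral subset_antisym)
next
  case (codim_Suc K x G n)
  have sub: "csubspace (H + line x)" "csubspace (K + line x)"
    by (simp_all add: codim_Suc csubspace_plus csubspace_line)
  have "csubspace G" using codim_Suc codim_csubspace by blast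
  with codim_Suc have "K + line x \<subseteq> H + line x" "H + line x \<subseteq> G"
    by (simp_all add: plus_subset line_subset set_plus_mono2)
  then obtain a b where ab: "codim a (K + line x) (H + line x)" "codim b (H + line x) G" "a + b = n"
    using codim_Suc.IH [OF sub(1)] by blast
  show ?case
  proof (cases "x \<in> H")
    case True
    then have "H + line x = H"
      by (simp add: codim_Suc csubspace_line csubspace_plus_absorb line_subset)
    with ab True show ?thesis
      using codim_Suc codim.codim_Suc by (metis add_Suc)
  next
    case False
    \<comment> \<open>The line meets \<open>H\<close> only in 0, so removing it from both
      \<open>K + line x\<close> and \<open>H + line x\<close> does not change their
      codimension.\<close>
    have "{h \<in> H. h \<in> line x} \<subseteq> K"
    proof safe
      fix h assume "h \<in> H" "h \<in> line x"
      then obtain c where "h = c *\<^sub>C x" by (auto simp: line_def)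
      with False \<open>h \<in> H\<close> have "c = 0"
        using csubspace_scale_cancel codim_Suc.prems(1) by blast
      then show "h \<in> K" using \<open>h = c *\<^sub>C x\<close> codim_Suc csubspace_0 by simp
    qed
    then have "codim a K H"
      using ab codim_mod_image [OF clin_id csubspace_line, of K H x a] codim_Suc
      by (simp add: add.commute)
    moreover have "codim (Suc b) H G"
      using ab codim_Suc False codim.codim_Suc by metis
    ultimately show ?thesis using ab by (metis add_Suc_right)
  qed
qed

text \<open>The vectors of the chain span a complement. The construction is algebraic; that such a
  \<open>D\<close> is closed follows later from a bounded projection onto it.\<close>

lemma codim_complement:
  "codim n K G \<Longrightarrow> \<exists>D. codim n {0} D \<and> K \<inter> D = {0} \<and> K + D = G"
proof (induction rule: codim.induct)
  case (codim_0 G)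
  then show ?case
    by (intro exI [of _ "{0}"]) (auto simp: codim_0_iff set_plus_def csubspace_0)
next
  case (codim_Suc K x G n)
  then obtain D where D: "codim n {0} D" "(K + line x) \<inter> D = {0}" "K + line x + D = G"
    by blast
  have csD: "csubspace D" using D codim_csubspace by blast
  have x: "x \<in> K + line x" by (rule mem_plus_right [OF \<open>csubspace K\<close> mem_line])
  have "x \<notin> D"
  proof
    assume "x \<in> D"
    with x D have "x = 0" by blast
    with codim_Suc show False by (simp add: csubspace_0)
  qed
  then have "codim (n + 1) {0} (D + line x)"
    using codim_trans [OF D(1) codim_line] csD by blast
  moreover have "K \<inter> (D + line x) = {0}"
  proof (intro subset_antisym subsetI)
    fix z assume z: "z \<in> K \<inter> (D + line x)"
    then obtain d c where dc: "z = d + c *\<^sub>C x" "d \<in> D" by (auto simp: mem_plus_line)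
    then have "d = z + (-c) *\<^sub>C x" by (simp add: scaleC_minus_left)
    then have "d \<in> K + line x" using z mem_plus_line by blast
    with D dc have "d = 0" by blast
    with dc z have "c *\<^sub>C x \<in> K" by simp
    then have "c = 0" using csubspace_scale_cancel codim_Suc by blast
    then show "z \<in> {0}" using dc \<open>d = 0\<close> by simp
  qed (auto simp: codim_Suc csD csubspace_0 csubspace_plus csubspace_line)
  moreover have "K + (D + line x) = G" using D(3) by (simp add: ac_simps)
  ultimately show ?case by auto
qed

text \<open>\<open>sum line F\<close> is the span of the finite set \<open>F\<close>. This lemma and
  the next connect chains, which carry the counting, with the finite spanning sets behind
  \<open>vdim\<close>.\<close>

lemma codim_finite_span: "csubspace K \<Longrightarrow> \<exists>n. codim n K (K + sum line F)" if "finite F" for F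
  using that
proof (induction arbitrary: K)
  case empty
  then show ?case by (auto simp: codim_0_iff intro!: exI [of _ 0])
next
  case (insert x F)
  then obtain n where n: "codim n (K + line x) (K + line x + sum line F)"
    using csubspace_plus csubspace_line by metis
  show ?case
  proof (cases "x \<in> K")
    case True
    then have "K + line x = K"
      by (simp add: insert.prems csubspace_line csubspace_plus_absorb line_subset)
    with n insert show ?thesis by (auto simp flip: add.assoc)
  next
    case False
    then have "codim (1 + n) K (K + line x + sum line F)"
      using codim_trans codim_line insert.prems n by blast
    with insert show ?thesis by (auto simp: ac_simps)
  qed
qed

lemma codim_span_finite: "codim n K G \<Longrightarrow> \<exists>F. finite F \<and> G = K + sum line F"
proof (induction rule: codim.induct)
  case (codim_0 G)
  then show ?case by (intro exI [of _ "{}"]) auto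
next
  case (codim_Suc K x G n)
  then obtain F where F: "finite F" "G = K + line x + sum line F" by blast
  show ?case
  proof (cases "x \<in> F")
    case True
    then have "sum line F = line x + sum line (F - {x})"
      using F by (simp add: sum.remove)
    moreover have "line x + line x = line x"
      by (simp add: csubspace_line csubspace_plus_absorb)
    ultimately have "line x + sum line F = sum line F"
      by (simp flip: add.assoc)
    with F show ?thesis by (intro exI [of _ F]) (simp add: add.assoc)
  next
    case False
    with F show ?thesis by (intro exI [of _ "insert x F"]) (simp add: ac_simps)
  qed
qed

text \<open>Used to solve for an unknown codimension: one pair is counted through two different
  intermediate subspaces and the two sums are compared.\<close>

lemma codim_unique_sum:
  "codim a K H \<Longrightarrow> codim b H G \<Longrightarrow> codim n K G \<Longrightarrow> n = a + b"
  by (metis codim_trans codim_unique)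

section \<open>Bounded operators\<close>

lemma bounded_clinear_clin: "bounded_clinear T \<Longrightarrow> clin T"
  by (simp add: bounded_clinear_def clin_def linear_simps(1))

lemma bounded_clinear_bounded_linear: "bounded_clinear T \<Longrightarrow> bounded_linear T"
  by (simp add: bounded_clinear_def)

lemma bounded_clinearI:
  assumes "clin T" "\<And>x. norm (T x) \<le> c * norm x"
  shows "bounded_clinear T"
proof -
  have "bounded_linear T"
    by (rule bounded_linear_intro [where K = c])
       (use assms in \<open>auto simp: clin_def scaleR_scaleC mult.commute\<close>)
  with assms show ?thesis by (simp add: bounded_clinear_def clin_def)
qed

lemma bounded_clinear_pos_bound:
  assumes "bounded_clinear T" obtains c where "c > 0" "\<And>x. norm (T x) \<le> c * norm x"
  using bounded_linear.pos_bounded [OF bounded_clinear_bounded_linear [OF assms]]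
  by (metis mult.commute)

lemma bounded_clinear_id: "bounded_clinear (\<lambda>x. x)"
  and bounded_clinear_zero: "bounded_clinear (\<lambda>x. 0)"
  and bounded_clinear_fst: "bounded_clinear fst"
  and bounded_clinear_snd: "bounded_clinear snd"
  by (auto simp: bounded_clinear_def scaleC_prod_def bounded_linear_fst bounded_linear_snd)

lemma bounded_clinear_compose:
  "bounded_clinear S \<Longrightarrow> bounded_clinear T \<Longrightarrow> bounded_clinear (\<lambda>x. S (T x))"
  by (auto simp: bounded_clinear_def bounded_linear_compose)

lemma bounded_clinear_add:
  "bounded_clinear S \<Longrightarrow> bounded_clinear T \<Longrightarrow> bounded_clinear (\<lambda>x. S x + T x)"
  by (auto simp: bounded_clinear_def bounded_linear_add scaleC_add_right)

lemma bounded_clinear_diff: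
  "bounded_clinear S \<Longrightarrow> bounded_clinear T \<Longrightarrow> bounded_clinear (\<lambda>x. S x - T x)"
  by (auto simp: bounded_clinear_def bounded_linear_sub scaleC_diff_right)

lemma bounded_clinear_Pair:
  "bounded_clinear S \<Longrightarrow> bounded_clinear T \<Longrightarrow> bounded_clinear (\<lambda>x. (S x, T x))"
  by (auto simp: bounded_clinear_def bounded_linear_Pair scaleC_prod_def)

lemmas bounded_clinear_intros =
  bounded_clinear_id bounded_clinear_zero bounded_clinear_add bounded_clinear_diff bounded_clinear_Pair
  bounded_clinear_compose [OF bounded_clinear_fst] bounded_clinear_compose [OF bounded_clinear_snd]

lemma closed_bounded_clinear_vimage: "bounded_clinear T \<Longrightarrow> closed S \<Longrightarrow> closed {x. T x \<in> S}"
  using continuous_closed_vimage [of S T] bounded_clinear_bounded_linear [of T]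
  by (simp add: vimage_def linear_continuous_at)

lemma closed_nullspace: "bounded_clinear T \<Longrightarrow> closed (nullspace T)"
  using closed_bounded_clinear_vimage [of T "{0}"] by (simp add: nullspace_def)

lemma idempotent_range_eq:
  assumes "\<And>x. P (P x) = P x" shows "range P = {x. P x = x}"
  using assms by auto (metis rangeI)

lemma closed_idempotent_range:
  assumes "bounded_clinear P" "\<And>x. P (P x) = P x" shows "closed (range P)"
proof -
  have "range P = {x. P x - x \<in> {0}}"
    using idempotent_range_eq [of P] assms by auto
  then show ?thesis
    using closed_bounded_clinear_vimage [of "\<lambda>x. P x - x" "{0}"] assms
    by (simp add: bounded_clinear_intros)
qed

section \<open>The Hahn--Banach theorem\<close>

text \<open>Homogeneity is required as an inequality only, which passes easily to infima; equality
  follows in \<open>sublin_scale\<close> by scaling back with 1/c.\<close>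

definition sublin :: "('a::real_vector \<Rightarrow> real) \<Rightarrow> bool" where
  "sublin p \<longleftrightarrow> (\<forall>x y. p (x + y) \<le> p x + p y) \<and> (\<forall>c\<ge>0. \<forall>x. p (c *\<^sub>R x) \<le> c * p x)"

lemma sublin_add: "sublin p \<Longrightarrow> p (x + y) \<le> p x + p y"
  and sublin_scale_le: "sublin p \<Longrightarrow> c \<ge> 0 \<Longrightarrow> p (c *\<^sub>R x) \<le> c * p x"
  by (auto simp: sublin_def)

lemma sublin_zero: assumes "sublin p" shows "p 0 = 0"
proof -
  have "p 0 \<le> 0" using sublin_scale_le [OF assms, of 0 0] by simp
  moreover have "p 0 \<le> p 0 + p 0" using sublin_add [OF assms, of 0 0] by simp
  ultimately show ?thesis by simp
qed

lemma sublin_scale: assumes "sublin p" "c \<ge> 0" shows "p (c *\<^sub>R x) = c * p x"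
proof (cases "c = 0")
  case True
  then show ?thesis by (simp add: sublin_zero [OF assms(1)])
next
  case False
  then have "c * p ((1/c) *\<^sub>R c *\<^sub>R x) \<le> c * ((1/c) * p (c *\<^sub>R x))"
    using sublin_scale_le [OF assms(1), of "1/c" "c *\<^sub>R x"] assms(2) by (intro mult_left_mono) auto
  with False have "c * p x \<le> p (c *\<^sub>R x)" by simp
  then show ?thesis using sublin_scale_le [OF assms] by (metis antisym)
qed

lemma sublin_lower: "sublin p \<Longrightarrow> - p (- x) \<le> p x"
  using sublin_add [of p x "-x"] by (simp add: sublin_zero)

text \<open>For sublinear \<open>p\<close> this is the greatest sublinear functional below
  \<open>p\<close> whose value at \<open>- y\<close> is at most \<open>- p y\<close>. Consequently
  every linear functional below it takes the value \<open>p y\<close> at \<open>y\<close>.\<close>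

definition sublin_along :: "('a::real_vector \<Rightarrow> real) \<Rightarrow> 'a \<Rightarrow> 'a \<Rightarrow> real" where
  "sublin_along p y x = (INF t\<in>{0..}. p (x + t *\<^sub>R y) - t * p y)"

context
  fixes p :: "'a::real_vector \<Rightarrow> real" and y :: 'a
  assumes p: "sublin p"
begin

lemma sublin_along_bdd: "bdd_below ((\<lambda>t. p (x + t *\<^sub>R y) - t * p y) ` {0..})"
proof (rule bdd_belowI2)
  fix t :: real assume "t \<in> {0..}"
  then have "t * p y = p (t *\<^sub>R y)" by (simp add: sublin_scale p)
  also have "\<dots> \<le> p (x + t *\<^sub>R y) + p (- x)"
    using sublin_add [OF p, of "x + t *\<^sub>R y" "- x"] by simp
  finally show "- p (- x) \<le> p (x + t *\<^sub>R y) - t * p y" by simp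
qed

lemma sublin_along_le: "t \<ge> 0 \<Longrightarrow> sublin_along p y x \<le> p (x + t *\<^sub>R y) - t * p y"
  unfolding sublin_along_def by (intro cINF_lower sublin_along_bdd) auto

lemma le_sublin_along: "(\<And>t. t \<ge> 0 \<Longrightarrow> c \<le> p (x + t *\<^sub>R y) - t * p y) \<Longrightarrow> c \<le> sublin_along p y x"
  unfolding sublin_along_def by (intro cINF_greatest) auto

text \<open>Nearly optimal parameters t for \<open>x\<close> and s for \<open>z\<close> combine to
  the parameter t + s for \<open>x + z\<close>; scaling by a positive c turns t into c * t.\<close>

lemma sublin_along_sublin: "sublin (sublin_along p y)"
proof -
  have "sublin_along p y (x + z) \<le> sublin_along p y x + sublin_along p y z" for x z
  proof -
    have "sublin_along p y (x + z) - (p (x + t *\<^sub>R y) - t * p y) \<le> sublin_along p y z" if "t \<ge> 0" for t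
    proof (rule le_sublin_along)
      fix s :: real assume "s \<ge> 0"
      have "sublin_along p y (x + z) \<le> p (x + z + (t + s) *\<^sub>R y) - (t + s) * p y"
        using that \<open>s \<ge> 0\<close> by (intro sublin_along_le) auto
      also have "x + z + (t + s) *\<^sub>R y = (x + t *\<^sub>R y) + (z + s *\<^sub>R y)"
        by (simp add: scaleR_add_left)
      finally show "sublin_along p y (x + z) - (p (x + t *\<^sub>R y) - t * p y) \<le> p (z + s *\<^sub>R y) - s * p y"
        using sublin_add [OF p, of "x + t *\<^sub>R y" "z + s *\<^sub>R y"] by (simp add: algebra_simps)
    qed
    then have "sublin_along p y (x + z) - sublin_along p y z \<le> sublin_along p y x"
      by (intro le_sublin_along) (simp add: algebra_simps)
    then show ?thesis by simp
  qed
  moreover have "sublin_along p y (c *\<^sub>R x) \<le> c * sublin_along p y x" if "c \<ge> 0" for c x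
  proof (cases "c = 0")
    case True
    then show ?thesis using sublin_along_le [of 0 0] by (simp add: sublin_zero p)
  next
    case False
    have "sublin_along p y (c *\<^sub>R x) / c \<le> sublin_along p y x"
    proof (rule le_sublin_along)
      fix t :: real assume "t \<ge> 0"
      then have "sublin_along p y (c *\<^sub>R x) \<le> p (c *\<^sub>R x + (c * t) *\<^sub>R y) - (c * t) * p y"
        using that by (intro sublin_along_le) auto
      also have "c *\<^sub>R x + (c * t) *\<^sub>R y = c *\<^sub>R (x + t *\<^sub>R y)"
        by (simp add: scaleR_add_right)
      also have "p \<dots> = c * p (x + t *\<^sub>R y)" by (rule sublin_scale [OF p that])
      finally show "sublin_along p y (c *\<^sub>R x) / c \<le> p (x + t *\<^sub>R y) - t * p y"
        using that False by (simp add: divide_simps algebra_simps)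
    qed
    then show ?thesis using that False by (simp add: divide_simps mult.commute)
  qed
  ultimately show ?thesis by (auto simp: sublin_def)
qed

end

text \<open>Zorn's lemma for the reversed order. The pointwise infimum of a chain is finite because
  \<open>- p0 (- x)\<close> is a common lower bound, and it is subadditive because the smaller of
  two members of the chain serves both arguments at once.\<close>

lemma minimal_sublin:
  assumes p0: "sublin p0"
  shows "\<exists>p. sublin p \<and> p \<le> p0 \<and> (\<forall>q. sublin q \<longrightarrow> q \<le> p \<longrightarrow> q = p)"
proof -
  define A where "A = {p. sublin p \<and> p \<le> p0}"
  define P where "P = (\<lambda>p q :: 'a \<Rightarrow> real. q \<le> p)"
  have "\<exists>m\<in>A. \<forall>a\<in>A. P m a \<longrightarrow> a = m"
  proof (rule predicate_Zorn)
    show "partial_order_on A (relation_of P A)"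
      by (rule partial_order_on_relation_ofI) (auto simp: P_def)
    fix C assume C: "C \<in> Chains (relation_of P A)"
    then have CA: "C \<subseteq> A" and ch: "\<And>p q. p \<in> C \<Longrightarrow> q \<in> C \<Longrightarrow> p \<le> q \<or> q \<le> p"
      by (auto simp: Chains_def relation_of_def P_def)
    show "\<exists>u\<in>A. \<forall>a\<in>C. P a u"
    proof (cases "C = {}")
      case True
      then show ?thesis using p0 by (auto simp: A_def)
    next
      case False
      define u where "u x = (INF p\<in>C. p x)" for x
      have bdd: "bdd_below ((\<lambda>p. p x) ` C)" for x
      proof (rule bdd_belowI2)
        fix p assume "p \<in> C"
        then have "sublin p" "p (-x) \<le> p0 (-x)" using CA by (auto simp: A_def le_fun_def)
        then show "- p0 (- x) \<le> p x" using sublin_lower [of p x] by linarith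
      qed
      have ule: "u x \<le> p x" if "p \<in> C" for p x
        unfolding u_def using that bdd by (intro cINF_lower)
      have leu: "c \<le> u x" if "\<And>p. p \<in> C \<Longrightarrow> c \<le> p x" for c x
        unfolding u_def using that False by (intro cINF_greatest)
      have "u (x + z) \<le> u x + u z" for x z
      proof -
        have "u (x + z) \<le> p x + q z" if pq: "p \<in> C" "q \<in> C" for p q
        proof -
          obtain r where r: "r \<in> C" "r \<le> p" "r \<le> q" using ch [OF pq] pq by auto
          have "u (x + z) \<le> r (x + z)" using r ule by simp
          also have "\<dots> \<le> r x + r z" using r CA by (auto simp: A_def intro: sublin_add)
          also have "\<dots> \<le> p x + q z" using r by (simp add: le_fun_def add_mono)
          finally show ?thesis .
        qed
        then have "u (x + z) - p x \<le> u z" if "p \<in> C" for p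
          using that by (intro leu) (metis add.commute diff_le_eq)
        then have "u (x + z) - u z \<le> u x" by (intro leu) (simp add: algebra_simps)
        then show ?thesis by simp
      qed
      moreover have "u (c *\<^sub>R x) \<le> c * u x" if "c \<ge> 0" for c x
      proof (cases "c = 0")
        case True
        obtain p where "p \<in> C" using False by blast
        then have "u 0 \<le> 0" using ule [of p 0] CA sublin_zero [of p] by (auto simp: A_def)
        with True show ?thesis by simp
      next
        case False
        have "u (c *\<^sub>R x) / c \<le> u x"
        proof (rule leu)
          fix p assume p: "p \<in> C"
          then have "p (c *\<^sub>R x) \<le> c * p x" using CA that by (auto simp: A_def intro: sublin_scale_le)
          then show "u (c *\<^sub>R x) / c \<le> p x"
            using ule [OF p, of "c *\<^sub>R x"] that False by (simp add: divide_simps mult.commute)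
        qed
        then show ?thesis using that False by (simp add: divide_simps mult.commute)
      qed
      ultimately have "sublin u" by (auto simp: sublin_def)
      moreover have "u \<le> p0"
      proof -
        obtain p where "p \<in> C" using False by blast
        then show ?thesis using ule CA by (force simp: A_def le_fun_def intro: order_trans)
      qed
      ultimately show ?thesis using ule by (auto simp: A_def P_def le_fun_def)
    qed
  qed
  then obtain p where "sublin p" "p \<le> p0" "\<And>q. q \<in> A \<Longrightarrow> q \<le> p \<Longrightarrow> q = p"
    by (auto simp: A_def P_def)
  then show ?thesis by (metis (mono_tags, lifting) A_def mem_Collect_eq order_trans)
qed

text \<open>A minimal sublinear functional \<open>p\<close> is linear, because \<open>sublin_along p y\<close> lies below it.\<close>

lemma dominated_linear:
  assumes "sublin p0" shows "\<exists>f. linear f \<and> f \<le> p0"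
proof -
  obtain p where p: "sublin p" "p \<le> p0" and min: "\<And>q. sublin q \<Longrightarrow> q \<le> p \<Longrightarrow> q = p"
    using minimal_sublin [OF assms] by blast
  have add: "p (x + y) = p x + p y" for x y
  proof -
    have "sublin_along p y \<le> p"
      using sublin_along_le [OF p(1), of 0] by (simp add: le_fun_def)
    then have "sublin_along p y = p" using min sublin_along_sublin p by blast
    \<comment> \<open>The parameter 1 in the infimum; together with subadditivity it gives
      additivity.\<close>
    then have "p x \<le> p (x + y) - p y"
      using sublin_along_le [OF p(1), of 1 y x] by simp
    with sublin_add [OF p(1), of x y] show ?thesis by simp
  qed
  have neg: "p (- x) = - p x" for x
    using add [of x "- x"] by (simp add: sublin_zero p)
  have "p (c *\<^sub>R x) = c *\<^sub>R p x" for c x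
  proof (cases "c \<ge> 0")
    case True then show ?thesis by (simp add: sublin_scale p)
  next
    case False
    then have "p (c *\<^sub>R x) = - p ((- c) *\<^sub>R x)" by (simp flip: neg)
    also have "\<dots> = c * p x" using False by (subst sublin_scale) (auto simp: p)
    finally show ?thesis by simp
  qed
  with add have "linear p" by (intro linearI) auto
  with p show ?thesis by blast
qed

definition cfunctional :: "('a::complex_normed_vector \<Rightarrow> complex) \<Rightarrow> bool" where
  "cfunctional f \<longleftrightarrow> bounded_linear f \<and> (\<forall>c x. f (c *\<^sub>C x) = c * f x)"

lemma cfunctional_add: "cfunctional f \<Longrightarrow> f (x + y) = f x + f y"
  and cfunctional_diff: "cfunctional f \<Longrightarrow> f (x - y) = f x - f y"
  and cfunctional_scale: "cfunctional f \<Longrightarrow> f (c *\<^sub>C x) = c * f x"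
  and cfunctional_0: "cfunctional f \<Longrightarrow> f 0 = 0"
  by (auto simp: cfunctional_def linear_simps)

lemma cfunctional_compose: "cfunctional f \<Longrightarrow> bounded_clinear T \<Longrightarrow> cfunctional (\<lambda>x. f (T x))"
  by (auto simp: cfunctional_def bounded_clinear_def bounded_linear_compose)

lemma bounded_clinear_rank_one:
  assumes "cfunctional f" shows "bounded_clinear (\<lambda>x. f x *\<^sub>C v)"
proof -
  obtain K where K: "\<And>x. norm (f x) \<le> norm x * K"
    using assms bounded_linear.bounded unfolding cfunctional_def by blast
  have "norm (f x *\<^sub>C v) \<le> (K * norm v) * norm x" for x
    using mult_right_mono [OF K [of x], of "norm v"] by (simp add: norm_scaleC ac_simps)
  moreover have "clin (\<lambda>x. f x *\<^sub>C v)"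
    using assms by (auto simp: clin_def cfunctional_add cfunctional_scale scaleC_add_left scaleC_scaleC)
  ultimately show ?thesis by (intro bounded_clinearI)
qed

text \<open>Domination by \<open>sublin_along norm e\<close> rather than by \<open>norm\<close>
  forces \<open>g e\<close> to be at least \<open>norm e\<close>, so no functional has to be
  extended from a subspace. The complex functional with real part g is h x = g x - i g (i
  x).\<close>

theorem hahn_banach:
  fixes e :: "'a::complex_normed_vector"
  assumes "e \<noteq> 0" obtains f where "cfunctional f" "f e = 1"
proof -
  have n: "sublin (norm :: 'a \<Rightarrow> real)" by (auto simp: sublin_def norm_triangle_ineq)
  obtain g where g: "linear g" "g \<le> sublin_along norm e"
    using dominated_linear [OF sublin_along_sublin [OF n]] by blast
  have gle: "g x \<le> norm x" for x
    using g(2) sublin_along_le [OF n, of 0 e x] by (auto simp: le_fun_def intro: order_trans)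
  have gabs: "\<bar>g x\<bar> \<le> norm x" for x
    using gle [of x] gle [of "- x"] g(1) by (simp add: linear_neg)
  have "g (- e) \<le> sublin_along norm e (- e)" using g(2) by (simp add: le_fun_def)
  also have "\<dots> \<le> - norm e" using sublin_along_le [OF n, of 1 e "- e"] by simp
  finally have "g e > 0" using g(1) assms by (simp add: linear_neg) (metis less_le_trans zero_less_norm_iff)
  define h where "h x = Complex (g x) (- g (\<i> *\<^sub>C x))" for x
  have hadd: "h (x + y) = h x + h y" for x y
    using g(1) by (simp add: h_def complex_eq_iff linear_add scaleC_add_right)
  have hscale: "h (c *\<^sub>C x) = c * h x" for c x
  proof -
    have dec: "c *\<^sub>C z = Re c *\<^sub>R z + Im c *\<^sub>R (\<i> *\<^sub>C z)" for z :: 'a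
    proof -
      have "c *\<^sub>C z = (complex_of_real (Re c) + complex_of_real (Im c) * \<i>) *\<^sub>C z"
        by (metis complex_eq mult.commute)
      then show ?thesis by (simp add: scaleC_add_left scaleR_scaleC scaleC_scaleC)
    qed
    have ii: "\<i> *\<^sub>C \<i> *\<^sub>C x = - x" by (simp add: scaleC_scaleC)
    have "g (c *\<^sub>C x) = Re c * g x + Im c * g (\<i> *\<^sub>C x)"
      using g(1) by (subst dec) (simp add: linear_add linear_scale)
    moreover have "\<i> *\<^sub>C c *\<^sub>C x = c *\<^sub>C \<i> *\<^sub>C x" by (simp add: scaleC_scaleC mult.commute)
    then have "g (\<i> *\<^sub>C c *\<^sub>C x) = Re c * g (\<i> *\<^sub>C x) - Im c * g x"
      using g(1) by (simp add: dec [of "\<i> *\<^sub>C x"] ii linear_add linear_diff linear_scale)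
    ultimately show ?thesis by (simp add: h_def complex_eq_iff algebra_simps)
  qed
  have hn: "norm (h x) \<le> norm x * 2" for x
  proof -
    have "norm (h x) \<le> \<bar>g x\<bar> + \<bar>g (\<i> *\<^sub>C x)\<bar>"
      using cmod_le [of "h x"] by (simp add: h_def)
    also have "\<dots> \<le> norm x + norm (\<i> *\<^sub>C x)" by (intro add_mono gabs)
    finally show ?thesis by (simp add: norm_scaleC)
  qed
  have "bounded_linear h"
    by (rule bounded_linear_intro [OF hadd _ hn]) (simp add: scaleR_scaleC hscale scaleR_conv_of_real)
  moreover have "h e \<noteq> 0" using \<open>g e > 0\<close> by (auto simp: h_def complex_eq_iff)
  ultimately have "cfunctional (\<lambda>x. h x / h e)" "h e / h e = 1"
    by (auto simp: cfunctional_def hscale bounded_linear_divide [THEN bounded_linear_compose])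
  then show ?thesis using that by metis
qed

section \<open>The open mapping theorem\<close>

text \<open>Baire's theorem: the closures of the images of the balls in \<open>E\<close> cover the
  codomain, so one of them contains a ball. Because closures were taken, equations are solved only
  approximately.\<close>

lemma open_mapping_approx:
  fixes f :: "'a::complex_normed_vector \<Rightarrow> 'b::complex_banach"
  assumes f: "bounded_clinear f" and E: "csubspace E" and onto: "f ` E = UNIV"
  shows "\<exists>c>0. \<forall>y. \<forall>\<epsilon>>0. \<exists>x\<in>E. norm x \<le> c * norm y \<and> norm (y - f x) < \<epsilon>"
proof -
  have lin: "clin f" by (rule bounded_clinear_clin [OF f])
  define B where "B n = closure (f ` (E \<inter> cball 0 (real n)))" for n
  have "\<Union>(range B) = UNIV"
  proof (rule sym, rule UNIV_eq_I)
    fix y obtain x where "x \<in> E" "y = f x" using onto by blast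
    moreover obtain n where "norm x \<le> real n" using real_arch_simple by blast
    ultimately have "y \<in> B n" unfolding B_def by (intro subsetD [OF closure_subset]) auto
    then show "y \<in> \<Union>(range B)" by blast
  qed
  moreover have "Met_TC.mtopology interior_of \<Union>(range B) = {}" if "\<And>n. interior (B n) = {}"
  proof (rule Met_TC.metric_Baire_category_alt)
    show "Met_TC.mcomplete TYPE('b)" by (simp add: complete_UNIV)
    show "closedin Met_TC.mtopology T \<and> Met_TC.mtopology interior_of T = {}" if "T \<in> range B" for T
      using that \<open>\<And>n. interior (B n) = {}\<close> by (auto simp: B_def)
  qed auto
  ultimately obtain n where "interior (B n) \<noteq> {}" by auto
  then obtain y0 r where r: "r > 0" "ball y0 r \<subseteq> B n"
    by (meson ex_in_conv mem_interior)
  \<comment> \<open>Differences of approximate preimages of \<open>y0 + z\<close> and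
    \<open>y0\<close> move the ball to the origin, at the price of doubling the norm bound.\<close>
  have half: "\<exists>x\<in>E. norm x \<le> 2 * real n \<and> norm (z - f x) < \<epsilon>" if z: "norm z < r" and "\<epsilon> > 0" for z \<epsilon>
  proof -
    have "y0 \<in> B n" "y0 + z \<in> B n" using r z by (auto simp: subset_iff dist_norm)
    with \<open>\<epsilon> > 0\<close> obtain a b where
      ab: "a \<in> E" "norm a \<le> n" "dist (f a) y0 < \<epsilon>/2" "b \<in> E" "norm b \<le> n" "dist (f b) (y0 + z) < \<epsilon>/2"
      unfolding B_def closure_approachable by (force dest: spec [of _ "\<epsilon>/2"])
    have "norm (b - a) \<le> 2 * real n" using ab norm_triangle_ineq4 [of b a] by simp
    moreover have eq: "z - f (b - a) = (f a - y0) - (f b - (y0 + z))"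
      using lin by (simp add: clin_diff)
    have "norm (z - f (b - a)) \<le> norm (f a - y0) + norm (f b - (y0 + z))"
      unfolding eq by (rule norm_triangle_ineq4)
    then have "norm (z - f (b - a)) < \<epsilon>"
      using ab unfolding dist_norm by linarith
    ultimately show ?thesis using ab E csubspace_diff by blast
  qed
  \<comment> \<open>Rescaling \<open>y\<close> to norm r/2 multiplies the bound \<open>2 * n\<close>
    by \<open>2 * norm y / r\<close>; the summand 1 keeps \<open>c\<close> positive when n =
    0.\<close>
  define c where "c = 4 * real n / r + 1"
  have "\<exists>x\<in>E. norm x \<le> c * norm y \<and> norm (y - f x) < \<epsilon>" if \<epsilon>: "\<epsilon> > 0" for y \<epsilon>
  proof (cases "y = 0")
    case True
    then show ?thesis using that E lin by (intro bexI [of _ 0]) (auto simp: clin_0 csubspace_0)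
  next
    case False
    define t where "t = r / (2 * norm y)"
    have t: "t > 0" using False r by (simp add: t_def)
    have "norm (t *\<^sub>R y) < r" using False r by (simp add: t_def)
    then obtain x where x: "x \<in> E" "norm x \<le> 2 * real n" "norm (t *\<^sub>R y - f x) < t * \<epsilon>"
      using half [of "t *\<^sub>R y" "t * \<epsilon>"] \<epsilon> t by auto
    define x' where "x' = (1/t) *\<^sub>R x"
    have "x' \<in> E" using x E by (simp add: x'_def scaleR_scaleC csubspace_scale)
    moreover have "norm x' \<le> c * norm y"
    proof -
      have "norm x' = norm x * (2 * norm y) / r"
        using t r by (simp add: x'_def t_def)
      also have "\<dots> \<le> (2 * real n) * (2 * norm y) / r"
        using x r by (intro divide_right_mono mult_right_mono) auto
      also have "\<dots> \<le> c * norm y" by (simp add: c_def algebra_simps)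
      finally show ?thesis .
    qed
    moreover have "norm (y - f x') < \<epsilon>"
    proof -
      have "t *\<^sub>R (y - f x') = t *\<^sub>R y - f x"
        using lin t by (simp add: x'_def scaleR_scaleC clin_scale scaleC_diff_right scaleC_scaleC scaleC_one)
      then have "t * norm (y - f x') < t * \<epsilon>"
        using x t by (metis abs_of_pos norm_scaleR)
      then show ?thesis using t by simp
    qed
    ultimately show ?thesis by blast
  qed
  moreover have "c > 0" using r by (simp add: c_def add_nonneg_pos)
  ultimately show ?thesis by blast
qed

text \<open>Successive approximation: every correction at least halves the error, so the norms of
  the corrections sum to at most twice \<open>c * norm y\<close>, and their sum stays in
  \<open>E\<close> because \<open>E\<close> is closed.\<close>

theorem open_mapping:
  fixes f :: "'a::complex_banach \<Rightarrow> 'b::complex_banach"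
  assumes f: "bounded_clinear f" and E: "csubspace E" "closed E" and onto: "f ` E = UNIV"
  shows "\<exists>c>0. \<forall>y. \<exists>x\<in>E. f x = y \<and> norm x \<le> c * norm y"
proof -
  have lin: "clin f" by (rule bounded_clinear_clin [OF f])
  obtain c where c: "c > 0"
    "\<And>y \<epsilon>. \<epsilon> > 0 \<Longrightarrow> \<exists>x\<in>E. norm x \<le> c * norm y \<and> norm (y - f x) < \<epsilon>"
    using open_mapping_approx [OF f E(1) onto] by metis
  have "\<exists>x\<in>E. norm x \<le> c * norm y \<and> norm (y - f x) \<le> norm y / 2" for y
  proof (cases "y = 0")
    case True
    then show ?thesis using E lin by (intro bexI [of _ 0]) (auto simp: clin_0 csubspace_0)
  next
    case False
    then show ?thesis using c(2) [of "norm y / 2" y] by (auto intro: less_imp_le)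
  qed
  then obtain G where G: "\<And>y. G y \<in> E" "\<And>y. norm (G y) \<le> c * norm y" "\<And>y. norm (y - f (G y)) \<le> norm y / 2"
    by metis
  have "\<exists>x\<in>E. f x = y \<and> norm x \<le> (2 * c) * norm y" for y
  proof -
    define u where "u k = ((\<lambda>y. y - f (G y)) ^^ k) y" for k
    have u0: "u 0 = y" and uS: "u (Suc k) = u k - f (G (u k))" for k by (auto simp: u_def)
    have nu: "norm (u k) \<le> norm y * (1/2)^k" for k
    proof (induction k)
      case (Suc k)
      have "norm (u (Suc k)) \<le> norm (u k) / 2" using G(3) uS by metis
      with Suc show ?case by simp
    qed (simp add: u0)
    have nG: "norm (G (u k)) \<le> (c * norm y) * (1/2)^k" for k
      using order_trans [OF G(2) mult_left_mono [OF nu]] c(1) by (simp add: mult.assoc)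
    have sg: "(\<lambda>k. (c * norm y) * (1/2)^k) sums (2 * c * norm y)"
      using sums_mult [OF geometric_sums [of "1/2 :: real"], of "c * norm y"] by (simp add: ac_simps)
    have sumG: "summable (\<lambda>k. norm (G (u k)))"
      using nG by (intro summable_comparison_test' [OF sums_summable [OF sg], of 0]) simp
    then have sG: "(\<lambda>k. G (u k)) sums (\<Sum>k. G (u k))" by (simp add: summable_norm_cancel summable_sums)
    define x where "x = (\<Sum>k. G (u k))"
    have partial: "(\<Sum>k<n. G (u k)) \<in> E" for n
      by (induction n) (auto simp: E G csubspace_0 csubspace_add)
    have "x \<in> E"
      using sG closed_sequentially [OF E(2) partial] by (auto simp: sums_def x_def)
    moreover have "norm x \<le> 2 * c * norm y"
      unfolding x_def using summable_norm [OF sumG] suminf_le [OF nG sumG sums_summable [OF sg]] sums_unique [OF sg]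
      by linarith
    moreover have "f x = y"
    proof -
      have "(\<lambda>k. f (G (u k))) sums f x"
        using bounded_linear.sums [OF bounded_clinear_bounded_linear [OF f] sG] by (simp add: x_def)
      moreover have "u \<longlonglongrightarrow> 0"
      proof (rule tendsto_norm_zero_cancel, rule Lim_null_comparison)
        show "(\<lambda>k. norm y * (1/2)^k) \<longlonglongrightarrow> 0"
          by (rule tendsto_mult_right_zero) (simp add: LIMSEQ_power_zero)
      qed (use nu in auto)
      then have "(\<lambda>k. u k - u (Suc k)) sums (u 0 - 0)" by (rule telescope_sums')
      ultimately show ?thesis using sums_unique2 by (force simp: uS u0)
    qed
    ultimately show ?thesis by blast
  qed
  then show ?thesis using c(1) by (intro exI [of _ "2 * c"]) auto
qed

lemma bounded_inverse:
  fixes f :: "'a::complex_banach \<Rightarrow> 'b::complex_banach"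
  assumes f: "bounded_clinear f" and E: "csubspace E" "closed E" and bij: "bij_betw f E UNIV"
  obtains g where "bounded_clinear g" "\<And>y. g y \<in> E" "\<And>y. f (g y) = y" "\<And>x. x \<in> E \<Longrightarrow> g (f x) = x"
proof -
  have lin: "clin f" by (rule bounded_clinear_clin [OF f])
  obtain c where c: "\<And>y. \<exists>x\<in>E. f x = y \<and> norm x \<le> c * norm y"
    using open_mapping [OF f E] bij by (auto simp: bij_betw_def)
  then obtain g where g: "\<And>y. g y \<in> E" "\<And>y. f (g y) = y" "\<And>y. norm (g y) \<le> c * norm y" by metis
  have inj: "x = z" if "x \<in> E" "z \<in> E" "f x = f z" for x z
    using bij that by (auto simp: bij_betw_def inj_on_def)
  have gf: "g (f x) = x" if "x \<in> E" for x
    using inj g that by metis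
  have "clin g"
    unfolding clin_def
  proof (intro conjI allI)
    show "g (x + y) = g x + g y" for x y
      using E g lin by (intro inj) (auto simp: csubspace_add clin_add)
    show "g (a *\<^sub>C x) = a *\<^sub>C g x" for a x
      using E g lin by (intro inj) (auto simp: csubspace_scale clin_scale)
  qed
  then have "bounded_clinear g" using g by (intro bounded_clinearI)
  with g gf that show ?thesis by blast
qed

text \<open>Addition is a bijection from the product of \<open>M\<close> and \<open>W\<close> onto
  the whole space. Its bounded inverse splits vectors, and the first component is the
  projection.\<close>

lemma complemented_projection:
  fixes M :: "'a::complex_banach set"
  assumes M: "csubspace M" "closed M" and "complemented M"
  obtains P where "bounded_clinear P" "range P = M" "\<And>x. P (P x) = P x"
proof -
  obtain W where W: "csubspace W" "closed W" "M \<inter> W = {0}" "M + W = UNIV"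
    using assms by (auto simp: complemented_def)
  define f where "f p = fst p + snd p" for p :: "'a \<times> 'a"
  have f: "bounded_clinear f"
    unfolding f_def by (intro bounded_clinear_add bounded_clinear_fst bounded_clinear_snd)
  have bij: "bij_betw f (M \<times> W) UNIV"
  proof (rule bij_betw_imageI)
    show "inj_on f (M \<times> W)"
    proof (rule inj_onI, clarsimp simp: f_def)
      fix a b c d assume h: "a \<in> M" "b \<in> W" "c \<in> M" "d \<in> W" "a + b = c + d"
      then have "a - c = d - b" by (simp add: algebra_simps)
      with h M W have "a - c \<in> M \<inter> W" by (metis IntI csubspace_diff)
      with W h show "a = c \<and> b = d" by auto
    qed
    show "f ` (M \<times> W) = UNIV" using W(4) by (force simp: f_def set_plus_def)
  qed
  obtain g where g: "bounded_clinear g" "\<And>y. g y \<in> M \<times> W" "\<And>y. f (g y) = y" "\<And>x. x \<in> M \<times> W \<Longrightarrow> g (f x) = x"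
    using bounded_inverse [OF f csubspace_Times [OF M(1) W(1)] closed_Times [OF M(2) W(2)] bij] by metis
  have P: "fst (g x) = x" if "x \<in> M" for x
    using g(4) [of "(x, 0)"] that W(1) by (simp add: f_def csubspace_0)
  have in_M: "fst (g y) \<in> M" for y using g(2) [of y] by auto
  have "range (\<lambda>x. fst (g x)) = M"
  proof (intro subset_antisym subsetI)
    fix x assume "x \<in> M"
    from P [OF this, symmetric] show "x \<in> range (\<lambda>x. fst (g x))" by (rule range_eqI)
  qed (use in_M in auto)
  moreover have "fst (g (fst (g y))) = fst (g y)" for y
    by (rule P [OF in_M])
  ultimately show ?thesis
    using that [of "\<lambda>x. fst (g x)"] bounded_clinear_compose [OF bounded_clinear_fst g(1)] by blast
qed

section \<open>Finite-rank corrections and generalized inverses\<close>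

text \<open>A bounded right inverse of \<open>H\<close> over a finite-dimensional \<open>T\<close>,
  built one vector at a time so that \<open>H\<close> after \<open>H'\<close> stays a projection.
  With the identity for \<open>H\<close> it yields projections onto finite-dimensional subspaces;
  for \<open>H\<close> of finite rank it inverts \<open>H\<close> on its own range.\<close>

lemma finite_section:
  assumes H: "bounded_clinear H" and "codim n {0} T" "T \<subseteq> range H"
  obtains H' where "bounded_clinear H'" "\<And>t. t \<in> T \<Longrightarrow> H (H' t) = t" "range (\<lambda>x. H (H' x)) \<subseteq> T"
proof -
  have "\<exists>H'. bounded_clinear H' \<and> (\<forall>t\<in>T. H (H' t) = t) \<and> (\<forall>x. H (H' x) \<in> T)"
    if "codim n K T" "\<exists>H'. bounded_clinear H' \<and> (\<forall>t\<in>K. H (H' t) = t) \<and> (\<forall>x. H (H' x) \<in> K)"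
    for K using that \<open>T \<subseteq> range H\<close>
  proof (induction rule: codim.induct)
    case (codim_Suc K t T n)
    then obtain H' where H': "bounded_clinear H'" "\<And>t. t \<in> K \<Longrightarrow> H (H' t) = t" "\<And>x. H (H' x) \<in> K"
      by blast
    obtain u where u: "t = H u" using codim_Suc by blast
    have "t - H (H' t) \<noteq> 0" using H'(3) [of t] codim_Suc by auto
    then obtain \<phi> where \<phi>: "cfunctional \<phi>" "\<phi> (t - H (H' t)) = 1" using hahn_banach by blast
    \<comment> \<open>\<open>H\<close> after \<open>H'\<close> projects onto \<open>K\<close>, so
      composing with the complementary projection makes the functional vanish on \<open>K\<close>,
      while its value at \<open>t\<close> is 1.\<close>
    define \<psi> where "\<psi> x = \<phi> (x - H (H' x))" for x
    have \<psi>: "cfunctional \<psi>"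
      unfolding \<psi>_def
      by (rule cfunctional_compose [OF \<phi>(1)
          bounded_clinear_diff [OF bounded_clinear_id bounded_clinear_compose [OF H H'(1)]]])
    have \<psi>t: "\<psi> t = 1" by (simp add: \<psi>_def \<phi>)
    have \<psi>K: "\<psi> k = 0" if "k \<in> K" for k using that H' \<phi> by (simp add: \<psi>_def cfunctional_0)
    define H'' where "H'' x = H' x + \<psi> x *\<^sub>C (u - H' t)" for x
    have lH: "clin H" by (rule bounded_clinear_clin [OF H])
    have HH: "H (H'' x) = H (H' x) + \<psi> x *\<^sub>C (t - H (H' t))" for x
      using lH by (simp add: H''_def clin_add clin_scale clin_diff u)
    have "bounded_clinear H''"
      unfolding H''_def by (intro bounded_clinear_add bounded_clinear_rank_one H' \<psi>)
    moreover have "H (H'' x) = x" if xK: "x \<in> K + line t" for x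
    proof -
      obtain k c where x: "x = k + c *\<^sub>C t" "k \<in> K" using xK by (auto simp: mem_plus_line)
      then have "\<psi> x = c" by (simp add: cfunctional_add [OF \<psi>] cfunctional_scale [OF \<psi>] \<psi>t \<psi>K)
      moreover have "H (H' x) = k + c *\<^sub>C H (H' t)"
        using lH bounded_clinear_clin [OF H'(1)] x H'(2) by (simp add: clin_add clin_scale)
      ultimately show ?thesis by (simp add: HH x scaleC_diff_right)
    qed
    moreover have "H (H'' x) \<in> K + line t" for x
    proof -
      have "H (H'' x) = (H (H' x) - \<psi> x *\<^sub>C H (H' t)) + \<psi> x *\<^sub>C t"
        by (simp add: HH scaleC_diff_right)
      then show ?thesis
        unfolding mem_plus_line using codim_Suc H'(3) by (metis csubspace_diff csubspace_scale)
    qed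
    ultimately show ?case using codim_Suc by blast
  qed
  moreover have "\<exists>H'. bounded_clinear H' \<and> (\<forall>t\<in>{0}. H (H' t) = t) \<and> (\<forall>x. H (H' x) \<in> {0})"
    using clin_0 [OF bounded_clinear_clin [OF H]] bounded_clinear_zero by (intro exI [of _ "\<lambda>x. 0"]) auto
  ultimately show ?thesis using assms(2) that by blast
qed

lemma finite_projection:
  assumes "codim n {0} T"
  obtains P where "bounded_clinear P" "range P = T" "\<And>x. P (P x) = P x"
proof -
  obtain P where "bounded_clinear P" "\<And>t. t \<in> T \<Longrightarrow> P t = t" "range P \<subseteq> T"
    using finite_section [OF bounded_clinear_id assms] by auto
  moreover from this have "range P = T" by (auto simp: image_iff) metis
  ultimately show ?thesis using that by (metis rangeI)
qed

text \<open>\<open>S\<close> inverts \<open>A\<close> up to the finite-rank defect H = A - A S A.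
  The correction added to \<open>S\<close> is (1 - S A) H' (1 - A S): between two factors
  \<open>A\<close> it becomes H H' H = H, exactly the defect.\<close>

lemma generalized_inverse:
  assumes A: "bounded_clinear A" and S: "bounded_clinear S"
    and "codim n {0} (range (\<lambda>x. A x - A (S (A x))))"
  obtains A' where "bounded_clinear A'" "\<And>x. A (A' (A x)) = A x"
proof -
  define H where "H x = A x - A (S (A x))" for x
  have H: "bounded_clinear H"
    unfolding H_def
    by (intro bounded_clinear_diff A bounded_clinear_compose [OF A] bounded_clinear_compose [OF S])
  obtain H' where H': "bounded_clinear H'" "\<And>t. t \<in> range H \<Longrightarrow> H (H' t) = t"
    using finite_section [OF H _ order_refl] assms(3) unfolding H_def [abs_def, symmetric] by blast
  define V where "V x = x - A (S x)" for x
  define A' where "A' x = S x + (H' (V x) - S (A (H' (V x))))" for x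
  have V: "bounded_clinear V"
    unfolding V_def
    by (intro bounded_clinear_diff bounded_clinear_id bounded_clinear_compose [OF A] S)
  have "bounded_clinear A'"
    unfolding A'_def
    by (intro bounded_clinear_add bounded_clinear_diff bounded_clinear_compose [OF S]
        bounded_clinear_compose [OF A] bounded_clinear_compose [OF H'(1)] S V)
  moreover have "A (A' (A x)) = A x" for x
  proof -
    have "V (A x) = H x" by (simp add: V_def H_def)
    then have "A (A' (A x)) = A (S (A x)) + H (H' (H x))"
      using bounded_clinear_clin [OF A] by (simp add: A'_def clin_add clin_diff H_def)
    then show ?thesis using H'(2) by (simp add: H_def)
  qed
  ultimately show ?thesis using that by blast
qed

lemma closed_complemented_idempotent:
  assumes P: "bounded_clinear P" "\<And>x. P (P x) = P x"
  shows "closed (range P) \<and> complemented (range P)"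
proof (intro conjI)
  show "closed (range P)" by (rule closed_idempotent_range [OF assms])
  have lin: "clin P" by (rule bounded_clinear_clin [OF P(1)])
  have "range P \<inter> nullspace P = {0}"
    using P(2) clin_0 [OF lin] by (auto simp: nullspace_def)
  moreover have "range P + nullspace P = UNIV"
  proof (rule sym, rule UNIV_eq_I)
    fix x
    have "x = P x + (x - P x)" "x - P x \<in> nullspace P"
      using lin P(2) by (auto simp: nullspace_def clin_diff)
    then show "x \<in> range P + nullspace P" by (metis rangeI set_plus_intro)
  qed
  ultimately show "complemented (range P)"
    unfolding complemented_def
    by (intro exI [of _ "nullspace P"]) (simp add: csubspace_nullspace lin closed_nullspace P)
qed

text \<open>A A' is idempotent and has the same range as \<open>A\<close>.\<close>

lemma generalized_inverse_range:
  assumes "bounded_clinear A" "bounded_clinear A'" "\<And>x. A (A' (A x)) = A x"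
  shows "closed (range A) \<and> complemented (range A)"
proof -
  have "range A = range (\<lambda>x. A (A' x))" using assms(3) by (auto simp: image_iff) metis
  then show ?thesis
    using closed_complemented_idempotent [of "\<lambda>x. A (A' x)"] assms
    by (simp add: bounded_clinear_compose)
qed

text \<open>1 - A' A is idempotent and its range is the kernel of \<open>A\<close>.\<close>

lemma generalized_inverse_nullspace:
  assumes "bounded_clinear A" "bounded_clinear A'" "\<And>x. A (A' (A x)) = A x"
  shows "closed (nullspace A) \<and> complemented (nullspace A)"
proof -
  have lin: "clin A" "clin A'" using assms bounded_clinear_clin by auto
  have "nullspace A = range (\<lambda>x. x - A' (A x))"
  proof (intro subset_antisym subsetI)
    fix x assume "x \<in> nullspace A"
    then have "x = x - A' (A x)" using lin by (simp add: nullspace_def clin_0)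
    then show "x \<in> range (\<lambda>x. x - A' (A x))" by (rule range_eqI)
  qed (use lin assms in \<open>auto simp: nullspace_def clin_diff\<close>)
  moreover have "bounded_clinear (\<lambda>x. x - A' (A x))"
    by (intro bounded_clinear_diff bounded_clinear_id bounded_clinear_compose [OF assms(2,1)])
  ultimately show ?thesis
    using closed_complemented_idempotent [of "\<lambda>x. x - A' (A x)"] assms(3) lin
    by (simp add: clin_diff clin_0)
qed

text \<open>Adding a finite-dimensional complement \<open>D\<close> of the range to the domain, and
  cutting the domain down to the kernel of \<open>P\<close>, makes (x, d) -> T x + d a bijection;
  \<open>S\<close> and \<open>Q\<close> are the two components of its bounded inverse. The kernel of
  \<open>T\<close> may be infinite-dimensional, which is the situation of the operator
  \<open>B\<close>.\<close>

lemma parametrix: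
  fixes T :: "'a::complex_banach \<Rightarrow> 'b::complex_banach"
  assumes T: "bounded_clinear T" and P: "bounded_clinear P" "range P = nullspace T" "\<And>x. P (P x) = P x"
    and "codim n (range T) UNIV"
  obtains S Q where "bounded_clinear S" "bounded_clinear Q" "\<And>x. S (T x) = x - P x"
    "\<And>y. T (S y) = y - Q y" "codim n {0} (range Q)" "\<And>x. Q (T x) = 0"
proof -
  have lin: "clin T" "clin P" using T P bounded_clinear_clin by auto
  obtain D where D: "codim n {0} D" "range T \<inter> D = {0}" "range T + D = UNIV"
    using codim_complement [OF assms(5)] by blast
  then have csD: "csubspace D" using codim_csubspace by blast
  have "closed D"
    using finite_projection [OF D(1)] closed_idempotent_range by metis
  define f where "f p = T (fst p) + snd p" for p :: "'a \<times> 'b"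
  define E where "E = nullspace P \<times> D"
  have f: "bounded_clinear f"
    unfolding f_def by (intro bounded_clinear_add bounded_clinear_compose [OF T] bounded_clinear_fst bounded_clinear_snd)
  have TP: "T (P x) = 0" for x using P(2) by (auto simp: nullspace_def)
  have bij: "bij_betw f E UNIV"
  proof (rule bij_betw_imageI)
    show "inj_on f E"
    proof (rule inj_onI, clarsimp simp: f_def E_def)
      fix a b c d assume h: "a \<in> nullspace P" "b \<in> D" "c \<in> nullspace P" "d \<in> D" "T a + b = T c + d"
      then have eq: "T (a - c) = d - b" using lin by (simp add: clin_diff algebra_simps)
      then have "T (a - c) \<in> range T \<inter> D" by (metis IntI csubspace_diff eq h(2,4) csD rangeI)
      then have z: "T (a - c) = 0" using D by blast
      then have "a - c \<in> range P" using P by (simp add: nullspace_def)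
      then have "a - c = P (a - c)" using P(3) by (metis rangeE)
      also have "\<dots> = 0" using h lin by (simp add: nullspace_def clin_diff)
      finally show "a = c \<and> b = d" using eq z by simp
    qed
    have "y \<in> f ` E" for y
    proof -
      have "y \<in> range T + D" by (simp add: D)
      then obtain x d where xd: "y = T x + d" "d \<in> D" by (auto elim: set_plus_elim)
      have "y = f (x - P x, d)" "(x - P x, d) \<in> E"
        using xd lin P(3) TP by (auto simp: f_def E_def nullspace_def clin_diff)
      then show ?thesis by blast
    qed
    then show "f ` E = UNIV" by blast
  qed
  have E: "csubspace E" "closed E"
    using lin P csD \<open>closed D\<close> by (auto simp: E_def csubspace_Times csubspace_nullspace closed_Times closed_nullspace)
  obtain g where g: "bounded_clinear g" "\<And>y. g y \<in> E" "\<And>y. f (g y) = y" "\<And>x. x \<in> E \<Longrightarrow> g (f x) = x"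
    using bounded_inverse [OF f E bij] by metis
  show ?thesis
  proof (rule that [of "\<lambda>y. fst (g y)" "\<lambda>y. snd (g y)"])
    have *: "g (T x) = (x - P x, 0)" for x
      using g(4) [of "(x - P x, 0)"] lin P(3) TP csD
      by (simp add: f_def E_def nullspace_def clin_diff csubspace_0)
    show "fst (g (T x)) = x - P x" "snd (g (T x)) = 0" for x by (simp_all add: *)
    show "T (fst (g y)) = y - snd (g y)" for y using g(3) [of y] by (simp add: f_def algebra_simps)
    have "snd (g d) = d" if "d \<in> D" for d
      using g(4) [of "(0, d)"] lin that by (simp add: f_def E_def nullspace_def clin_0)
    moreover have "snd (g y) \<in> D" for y using g(2) [of y] by (auto simp: E_def)
    ultimately have "range (\<lambda>y. snd (g y)) = D" by (auto simp: image_iff) metis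
    then show "codim n {0} (range (\<lambda>y. snd (g y)))" using D by simp
  qed (use g in \<open>auto intro: bounded_clinear_intros\<close>)
qed

section \<open>Operators of index zero modulo a subspace\<close>

text \<open>Each step adds a rank-one operator sending a kernel vector outside the current range.\<close>

lemma index_zero_perturbation:
  fixes J :: "'a::complex_normed_vector \<Rightarrow> 'b::complex_normed_vector"
  assumes "bounded_clinear J" "csubspace E" "csubspace R"
    and "codim n {0} {e\<in>E. J e \<in> R}" "codim n (R + J ` E) UNIV"
  shows "\<exists>J'. bounded_clinear J' \<and> {e\<in>E. J' e \<in> R} = {0} \<and> R + J' ` E = UNIV"
  using assms(1,4,5)
proof (induction n arbitrary: J)
  case 0
  then show ?case by (auto simp: codim_0_iff)
next
  case (Suc n)
  define S where "S = {e\<in>E. J e \<in> R}"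
  have lin: "clin J" using Suc by (simp add: bounded_clinear_clin)
  have S0: "codim (Suc n) {0} S" using Suc by (simp add: S_def)
  then obtain x where x: "x \<in> S" "x \<noteq> 0" by (auto elim: codim_SucE)
  obtain f where f: "f \<notin> R + J ` E" "codim n (R + J ` E + line f) UNIV"
    using Suc.prems(3) by (auto elim: codim_SucE)
  obtain \<phi> where \<phi>: "cfunctional \<phi>" "\<phi> x = 1" using hahn_banach x by blast
  define J' where "J' e = J e + \<phi> e *\<^sub>C f" for e
  have J': "bounded_clinear J'"
    unfolding J'_def by (intro bounded_clinear_add bounded_clinear_rank_one \<phi> Suc.prems)
  have csRE: "csubspace (R + J ` E)" by (intro csubspace_plus csubspace_image assms lin)
  \<comment> \<open>If \<open>J' e\<close> lies in \<open>R\<close>, then \<phi> e times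
    \<open>f\<close> lies in the old range; as \<open>f\<close> does not, \<phi> e = 0. The
    perturbation therefore only cuts the kernel down, by the dimension of
    \<open>line x\<close>.\<close>
  have eqS: "{e\<in>E. J' e \<in> R} = {s\<in>S. \<phi> s = 0}"
  proof (intro subset_antisym subsetI)
    fix e assume e: "e \<in> {e\<in>E. J' e \<in> R}"
    have "\<phi> e *\<^sub>C f = J' e + J (- e)" using lin by (simp add: J'_def clin_minus)
    then have "\<phi> e *\<^sub>C f \<in> R + J ` E"
      using e assms(2) by (metis (mono_tags, lifting) csubspace_minus imageI mem_Collect_eq set_plus_intro)
    then have "\<phi> e = 0" using f csubspace_scale_cancel [OF csRE] by blast
    then show "e \<in> {s\<in>S. \<phi> s = 0}" using e by (simp add: S_def J'_def)
  qed (auto simp: S_def J'_def)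
  have csS: "csubspace S" using codim_csubspace S0 by blast
  have csS': "csubspace {s\<in>S. \<phi> s = 0}"
    using csS \<phi> by (auto simp: csubspace_iff cfunctional_0 cfunctional_add cfunctional_scale)
  have S'x: "{s\<in>S. \<phi> s = 0} + line x = S"
  proof (intro subset_antisym plus_subset csS line_subset x subsetI)
    fix s assume s: "s \<in> S"
    have "s = (s - \<phi> s *\<^sub>C x) + \<phi> s *\<^sub>C x" by simp
    moreover have "s - \<phi> s *\<^sub>C x \<in> {s\<in>S. \<phi> s = 0}"
      using s x csS \<phi> by (simp add: csubspace_diff csubspace_scale cfunctional_diff cfunctional_scale)
    ultimately show "s \<in> {s\<in>S. \<phi> s = 0} + line x" using mem_plus_line by blast
  qed auto
  have "codim 1 {s\<in>S. \<phi> s = 0} S"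
    using codim_line [OF csS', of x] \<phi> by (simp add: S'x)
  moreover obtain a b where "codim a {0} {s\<in>S. \<phi> s = 0}" "codim b {s\<in>S. \<phi> s = 0} S" "a + b = Suc n"
    using codim_split [OF S0 csS'] csubspace_0 [OF csS'] by blast
  ultimately have "codim n {0} {e\<in>E. J' e \<in> R}"
    unfolding eqS using codim_unique by fastforce
  moreover have "R + J' ` E = R + J ` E + line f"
  proof (intro subset_antisym subsetI)
    fix z assume "z \<in> R + J' ` E"
    then obtain r e where "z = r + J' e" "r \<in> R" "e \<in> E" by (auto elim: set_plus_elim)
    then show "z \<in> R + J ` E + line f"
      unfolding mem_plus_line J'_def by (metis add.assoc imageI set_plus_intro)
  next
    fix z assume "z \<in> R + J ` E + line f"
    then obtain w c where w: "z = w + c *\<^sub>C f" "w \<in> R + J ` E" by (auto simp: mem_plus_line)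
    then obtain r e where re: "w = r + J e" "r \<in> R" "e \<in> E" by (auto elim: set_plus_elim)
    \<comment> \<open>\<open>J' x\<close> equals \<open>f\<close> modulo \<open>R\<close>, so adding
      \<open>d\<close> times \<open>x\<close> to \<open>e\<close> gives the coefficient of
      \<open>f\<close> the prescribed value \<open>c\<close>.\<close>
    define d where "d = c - \<phi> e"
    have "z = (r - d *\<^sub>C J x) + J' (e + d *\<^sub>C x)"
      using lin \<phi> by (simp add: w re J'_def clin_add clin_scale cfunctional_add cfunctional_scale d_def)
    moreover have "r - d *\<^sub>C J x \<in> R" "e + d *\<^sub>C x \<in> E"
      using re x assms by (auto simp: S_def csubspace_add csubspace_diff csubspace_scale)
    ultimately show "z \<in> R + J' ` E" by (metis imageI set_plus_intro)
  qed
  then have "codim n (R + J' ` E) UNIV" using f by simp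
  ultimately show ?case using Suc.IH J' by blast
qed

section \<open>Finite-dimensional subspaces and quotients\<close>

lemma hull_redundant: "b \<in> P hull (B - {b}) \<Longrightarrow> P hull (B - {b}) = P hull B"
  unfolding hull_def by blast

text \<open>A spanning set of least cardinality is independent, since a redundant vector could be
  dropped. Only the finiteness of \<open>vdim\<close> is ever used, and this reduces it to finite
  spanning sets.\<close>

lemma vdim_finite_iff:
  "vdim V < \<infinity> \<longleftrightarrow> (\<exists>B. finite B \<and> B \<subseteq> vcarrier V \<and> vspan V B = vcarrier V)"
proof
  assume "vdim V < \<infinity>"
  then have "{enat (card B) | B. finite B \<and> vbasis V B} \<noteq> {}"
    unfolding vdim_def by (metis Inf_enat_def less_irrefl)
  then show "\<exists>B. finite B \<and> B \<subseteq> vcarrier V \<and> vspan V B = vcarrier V"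
    by (auto simp: vbasis_def)
next
  let ?S = "\<lambda>B. finite B \<and> B \<subseteq> vcarrier V \<and> vspan V B = vcarrier V"
  assume "\<exists>B. ?S B"
  then obtain B where B: "?S B" and min: "\<And>B'. ?S B' \<Longrightarrow> card B \<le> card B'"
    by (metis (no_types, lifting) ex_has_least_nat [of ?S])
  have "b \<notin> vspan V (B - {b})" if "b \<in> B" for b
  proof
    assume "b \<in> vspan V (B - {b})"
    then have "vspan V (B - {b}) = vspan V B" unfolding vspan_def by (rule hull_redundant)
    then have "?S (B - {b})" using B by auto
    then have "card B \<le> card (B - {b})" by (rule min)
    then show False using card_Diff1_less [of B b] B that by simp
  qed
  with B have "vbasis V B" by (simp add: vbasis_def)
  then have "vdim V \<le> enat (card B)" using B unfolding vdim_def by (intro Inf_lower) auto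
  then show "vdim V < \<infinity>" by (rule le_less_trans) simp
qed

lemma csubspace_sum_line: "csubspace (sum line F)"
  by (induction F rule: infinite_finite_induct)
     (auto simp: csubspace_plus csubspace_line csubspace_zero [unfolded set_zero [symmetric]])

lemma mem_sum_line: "finite F \<Longrightarrow> x \<in> F \<Longrightarrow> x \<in> sum line F"
proof (induction F rule: finite_induct)
  case (insert y F)
  then show ?case
    by (auto simp: mem_plus_right csubspace_line intro: subsetD [OF subset_plus_left [OF csubspace_sum_line] mem_line])
qed simp

lemma sum_line_subset: "finite F \<Longrightarrow> csubspace S \<Longrightarrow> F \<subseteq> S \<Longrightarrow> sum line F \<subseteq> S"
proof (induction F rule: finite_induct)
  case empty then show ?case by (auto simp: csubspace_0)
qed (simp add: plus_subset line_subset)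

lemma zero_plus_set [simp]: "{0} + S = (S :: 'a::comm_monoid_add set)"
  by (simp add: set_plus_def)

lemma sub_space_sel:
  "vcarrier (sub_space S) = S"
  "vadd (sub_space S) u v = u + v"
  "vscale (sub_space S) c u = c *\<^sub>C u"
  "vnorm (sub_space S) u = norm u"
  by (simp_all add: sub_space_def)

lemma sub_space_finite_iff:
  assumes S: "csubspace S"
  shows "vdim (sub_space S) < \<infinity> \<longleftrightarrow> (\<exists>n. codim n {0} S)"
proof -
  have sub: "vsubspace (sub_space S) U \<longleftrightarrow> U \<subseteq> S \<and> csubspace U" for U
    by (auto simp: vsubspace_def sub_space_def csubspace_iff)
  have span: "vspan (sub_space S) F = sum line F" if F: "finite F" "F \<subseteq> S" for F
    unfolding vspan_def
  proof (rule hull_unique)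
    show "F \<subseteq> sum line F" using mem_sum_line F by blast
    show "vsubspace (sub_space S) (sum line F)"
      using sum_line_subset [OF F(1) S F(2)] by (simp add: sub csubspace_sum_line)
    show "sum line F \<subseteq> T" if "F \<subseteq> T" "vsubspace (sub_space S) T" for T
      using that F by (simp add: sub sum_line_subset)
  qed
  have "vdim (sub_space S) < \<infinity> \<longleftrightarrow> (\<exists>F. finite F \<and> F \<subseteq> S \<and> sum line F = S)"
    unfolding vdim_finite_iff sub_space_sel by (intro ex_cong1 conj_cong refl) (simp add: span)
  also have "\<dots> \<longleftrightarrow> (\<exists>n. codim n {0} S)"
  proof
    assume "\<exists>F. finite F \<and> F \<subseteq> S \<and> sum line F = S"
    then obtain F where "finite F" "sum line F = S" by blast
    then show "\<exists>n. codim n {0} S" using codim_finite_span [of F "{0}"] by simp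
  next
    assume "\<exists>n. codim n {0} S"
    then obtain F where "finite F" "S = sum line F"
      using codim_span_finite [where K = "{0}" and G = S] by auto
    then show "\<exists>F. finite F \<and> F \<subseteq> S \<and> sum line F = S" using mem_sum_line by blast
  qed
  finally show ?thesis .
qed

section \<open>Cosets and their vector space operations\<close>

lemma coset_eq_iff:
  assumes "csubspace R" shows "x +o R = y +o R \<longleftrightarrow> x - y \<in> R"
proof
  assume "x +o R = y +o R"
  then have "x \<in> y +o R" using csubspace_0 [OF assms] by (metis add.right_neutral set_plus_intro2)
  then show "x - y \<in> R" by (simp add: set_minus_plus)
next
  assume *: "x - y \<in> R"
  show "x +o R = y +o R"
  proof (intro set_eqI)
    fix z
    have "z - y = (x - y) + (z - x)" by simp
    then show "z \<in> x +o R \<longleftrightarrow> z \<in> y +o R"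
      using csubspace_add_cancel [OF assms *, of "z - x"] by (simp flip: set_minus_plus)
  qed
qed

lemma coset_add: "csubspace R \<Longrightarrow> (x +o R) + (y +o R) = (x + y) +o R"
  by (simp add: set_plus_rearrange csubspace_plus_absorb)

lemma coset_scale:
  assumes R: "csubspace R" shows "scaleC c ` (x +o R) + R = (c *\<^sub>C x) +o R"
proof (intro subset_antisym subsetI)
  fix z assume "z \<in> scaleC c ` (x +o R) + R"
  then obtain r s where "z = c *\<^sub>C (x + r) + s" "r \<in> R" "s \<in> R"
    by (auto simp: elt_set_plus_def set_plus_def)
  then have "z = c *\<^sub>C x + (c *\<^sub>C r + s)" "c *\<^sub>C r + s \<in> R"
    using R by (auto simp: scaleC_add_right csubspace_add csubspace_scale)
  then show "z \<in> (c *\<^sub>C x) +o R" by auto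
next
  fix z assume "z \<in> (c *\<^sub>C x) +o R"
  then obtain r where "z = c *\<^sub>C x + r" "r \<in> R" by (auto simp: elt_set_plus_def)
  moreover have "x \<in> x +o R" using csubspace_0 [OF R] by (metis add.right_neutral set_plus_intro2)
  ultimately show "z \<in> scaleC c ` (x +o R) + R" by blast
qed

lemma quotient_space_sel:
  "vcarrier (quotient_space R) = range (\<lambda>z. z +o R)"
  "vzero (quotient_space R) = R"
  "vadd (quotient_space R) S T = S + T"
  "vscale (quotient_space R) c S = scaleC c ` S + R"
  "vnorm (quotient_space R) S = Inf (norm ` S)"
  by (simp_all add: quotient_space_def)

text \<open>Subspaces of the quotient correspond to subspaces of the whole space containing
  \<open>R\<close>. Spans are compared through images of the latter in one direction and through
  preimages in the other.\<close>

lemma quotient_space_finite_iff: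
  assumes R: "csubspace R"
  shows "vdim (quotient_space R) < \<infinity> \<longleftrightarrow> (\<exists>n. codim n R UNIV)"
proof
  let ?V = "quotient_space R"
  have sub: "vsubspace ?V ((\<lambda>z. z +o R) ` U)" if "csubspace U" for U
    unfolding vsubspace_def quotient_space_sel
  proof (intro conjI ballI allI)
    show "R \<in> (\<lambda>z. z +o R) ` U" using csubspace_0 [OF that] by (metis image_eqI set_zero_plus2 set_zero_plus)
  qed (use that R in \<open>auto simp: coset_add coset_scale csubspace_add csubspace_scale\<close>)
  {
    assume "vdim ?V < \<infinity>"
    then obtain \<B> where B: "finite \<B>" "\<B> \<subseteq> range (\<lambda>z. z +o R)" "vspan ?V \<B> = range (\<lambda>z. z +o R)"
      unfolding vdim_finite_iff quotient_space_sel by blast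
    then obtain F where F: "finite F" "\<B> = (\<lambda>z. z +o R) ` F" by (metis finite_subset_image)
    define U where "U = R + sum line F"
    have U: "csubspace U" by (simp add: U_def R csubspace_plus csubspace_sum_line)
    have "F \<subseteq> U" unfolding U_def using mem_plus_right [OF R] mem_sum_line [OF F(1)] by blast
    then have "vspan ?V \<B> \<subseteq> (\<lambda>z. z +o R) ` U"
      unfolding vspan_def using sub [OF U] F by (intro hull_minimal) auto
    then have *: "z +o R \<in> (\<lambda>z. z +o R) ` U" for z using B by blast
    have "z \<in> U" for z
    proof -
      obtain u where u: "z +o R = u +o R" "u \<in> U" using * [of z] by blast
      then have "z - u \<in> U"
        using coset_eq_iff [OF R] subset_plus_left [OF csubspace_sum_line, of R F] by (auto simp: U_def)
      then show ?thesis using csubspace_add [OF U _ u(2)] by fastforce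
    qed
    then have "U = UNIV" by blast
    then show "\<exists>n. codim n R UNIV" using codim_finite_span [OF F(1) R] by (simp add: U_def)
  }
  assume "\<exists>n. codim n R UNIV"
  then obtain F where F: "finite F" "UNIV = R + sum line F" using codim_span_finite by blast
  have "vspan ?V ((\<lambda>z. z +o R) ` F) = range (\<lambda>z. z +o R)"
    unfolding vspan_def
  proof (rule hull_unique)
    show "vsubspace ?V (range (\<lambda>z. z +o R))" by (rule sub) simp
    fix T assume T: "(\<lambda>z. z +o R) ` F \<subseteq> T" "vsubspace ?V T"
    have "R \<in> T" using T(2) by (simp add: vsubspace_def quotient_space_sel)
    have RT: "r +o R = R" if "r \<in> R" for r
      using coset_eq_iff [OF R, of r 0] that by (simp add: set_zero_plus2)
    have cs: "csubspace {z. z +o R \<in> T}"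
      unfolding csubspace_iff
    proof (intro conjI ballI allI; unfold mem_Collect_eq)
      show "0 +o R \<in> T" using RT csubspace_0 [OF R] \<open>R \<in> T\<close> by simp
      show "(x + y) +o R \<in> T" if "x +o R \<in> T" "y +o R \<in> T" for x y
        using that T(2) unfolding vsubspace_def quotient_space_sel by (metis coset_add [OF R])
      show "(c *\<^sub>C x) +o R \<in> T" if "x +o R \<in> T" for c x
        using that T(2) unfolding vsubspace_def quotient_space_sel by (metis coset_scale [OF R])
    qed
    have "R + sum line F \<subseteq> {z. z +o R \<in> T}"
    proof (intro plus_subset cs sum_line_subset F(1))
      show "R \<subseteq> {z. z +o R \<in> T}"
      proof
        fix r assume "r \<in> R"
        from RT [OF this] \<open>R \<in> T\<close> show "r \<in> {z. z +o R \<in> T}" by (metis mem_Collect_eq)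
      qed
      show "F \<subseteq> {z. z +o R \<in> T}" using T(1) by blast
    qed
    then have "{z. z +o R \<in> T} = UNIV" unfolding F(2) [symmetric] by (rule top.extremum_uniqueI)
    then show "range (\<lambda>z. z +o R) \<subseteq> T" by blast
  qed auto
  then show "vdim ?V < \<infinity>" using F(1) unfolding vdim_finite_iff quotient_space_sel
    by (intro exI [of _ "(\<lambda>z. z +o R) ` F"]) auto
qed

section \<open>Isomorphisms onto quotients\<close>

text \<open>A space \<open>V\<close> is presented by a seminorm \<open>p\<close> on a subspace \<open>S\<close>, whose Hausdorff quotient it is
  through \<open>\<kappa>\<close>.\<close>

definition presents ::
    "'v cnspace \<Rightarrow> 'z::complex_normed_vector set \<Rightarrow> ('z \<Rightarrow> 'v) \<Rightarrow> ('z \<Rightarrow> real) \<Rightarrow> bool" where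
  "presents V S \<kappa> p \<longleftrightarrow> csubspace S \<and> vcarrier V = \<kappa> ` S \<and>
    (\<forall>x\<in>S. \<forall>y\<in>S. vadd V (\<kappa> x) (\<kappa> y) = \<kappa> (x + y)) \<and>
    (\<forall>c. \<forall>x\<in>S. vscale V c (\<kappa> x) = \<kappa> (c *\<^sub>C x)) \<and>
    (\<forall>x\<in>S. vnorm V (\<kappa> x) = p x \<and> p x \<ge> 0) \<and>
    (\<forall>x\<in>S. \<forall>y\<in>S. p (x + y) \<le> p x + p y) \<and>
    (\<forall>c. \<forall>x\<in>S. p (c *\<^sub>C x) = cmod c * p x) \<and>
    (\<forall>x\<in>S. \<forall>y\<in>S. \<kappa> x = \<kappa> y \<longleftrightarrow> p (x - y) = 0)"

lemma presentsD:
  assumes "presents V S \<kappa> p"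
  shows "csubspace S" "vcarrier V = \<kappa> ` S"
    "\<And>x y. x \<in> S \<Longrightarrow> y \<in> S \<Longrightarrow> vadd V (\<kappa> x) (\<kappa> y) = \<kappa> (x + y)"
    "\<And>c x. x \<in> S \<Longrightarrow> vscale V c (\<kappa> x) = \<kappa> (c *\<^sub>C x)"
    "\<And>x. x \<in> S \<Longrightarrow> vnorm V (\<kappa> x) = p x"
    "\<And>x. x \<in> S \<Longrightarrow> p x \<ge> 0"
    "\<And>x y. x \<in> S \<Longrightarrow> y \<in> S \<Longrightarrow> p (x + y) \<le> p x + p y"
    "\<And>c x. x \<in> S \<Longrightarrow> p (c *\<^sub>C x) = cmod c * p x"
    "\<And>x y. x \<in> S \<Longrightarrow> y \<in> S \<Longrightarrow> \<kappa> x = \<kappa> y \<longleftrightarrow> p (x - y) = 0"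
  using assms by (auto simp: presents_def)

lemma presents_vdist:
  assumes V: "presents V S \<kappa> p" and "x \<in> S" "y \<in> S"
  shows "vdist V (\<kappa> x) (\<kappa> y) = p (x - y)"
proof -
  have "x - y = x + (-1) *\<^sub>C y" by simp
  moreover have "(-1) *\<^sub>C y \<in> S" "x + (-1) *\<^sub>C y \<in> S"
    using assms presentsD(1) [OF V] by (simp_all only: csubspace_scale csubspace_add)
  ultimately show ?thesis
    using assms by (simp only: vdist_def presentsD(3-5) [OF V])
qed

text \<open>\<open>Metric_space\<close> asks for nonnegativity and symmetry on the whole type, also
  outside the carrier. These two cannot be read off a presentation and are therefore
  premises.\<close>

lemma presents_metric:
  assumes V: "presents V S \<kappa> p"
    and nonneg: "\<And>u v. 0 \<le> vdist V u v" and commute: "\<And>u v. vdist V u v = vdist V v u"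
  shows "Metric_space (vcarrier V) (vdist V)"
proof (unfold_locales; (rule nonneg commute)?)
  fix u v w assume "u \<in> vcarrier V" "v \<in> vcarrier V"
  then obtain x y where xy: "x \<in> S" "y \<in> S" "u = \<kappa> x" "v = \<kappa> y" using presentsD(2) [OF V] by auto
  show "vdist V u v = 0 \<longleftrightarrow> u = v"
    using xy presentsD(9) [OF V] by (simp add: presents_vdist [OF V])
  assume "w \<in> vcarrier V"
  then obtain z where z: "z \<in> S" "w = \<kappa> z" using presentsD(2) [OF V] by auto
  show "vdist V u w \<le> vdist V u v + vdist V v w"
    using xy z presentsD(7) [OF V, of "x - y" "y - z"] presentsD(1) [OF V]
    by (simp add: presents_vdist [OF V] csubspace_diff)
qed

text \<open>The two estimates compare \<open>p\<close> with \<open>q\<close> after \<open>f\<close>,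
  so the induced map is injective and Lipschitz in both directions; with \<open>onto\<close> it is a
  homeomorphism. Only \<open>W\<close> consists of classes, whence the identity in the presentation
  of \<open>V\<close>.\<close>

lemma presents_iso:
  fixes f :: "'z::complex_normed_vector \<Rightarrow> 'w::complex_normed_vector"
  assumes V: "presents V S (\<lambda>x. x) p" "Metric_space (vcarrier V) (vdist V)"
    and W: "presents W UNIV \<eta> q" "Metric_space (vcarrier W) (vdist W)"
    and f: "clin f" and b: "\<And>x. x \<in> S \<Longrightarrow> q (f x) \<le> b * p x"
    and c: "\<And>x. x \<in> S \<Longrightarrow> p x \<le> c * q (f x)"
    and onto: "\<And>y. \<exists>x\<in>S. \<eta> (f x) = \<eta> y"
  shows "V \<cong>\<^sub>s W"
proof -
  define g where "g x = \<eta> (f x)" for x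
  have csS: "csubspace S" and carV: "vcarrier V = S" and carW: "vcarrier W = range \<eta>"
    using presentsD(1,2) [OF V(1)] presentsD(2) [OF W(1)] by auto
  have dV: "vdist V x y = p (x - y)" if "x \<in> S" "y \<in> S" for x y
    using presents_vdist [OF V(1)] that by simp
  have dW: "vdist W (g x) (g y) = q (f (x - y))" for x y
    using presents_vdist [OF W(1)] f by (simp add: g_def clin_diff)
  have p0: "p x = 0 \<longleftrightarrow> x = 0" if "x \<in> S" for x
    using presentsD(9) [OF V(1), of x 0] that csS by (auto simp: csubspace_0)
  have inj: "inj_on g S"
  proof (rule inj_onI)
    fix x y assume xy: "x \<in> S" "y \<in> S" "g x = g y"
    then have "q (f (x - y)) = 0" using presentsD(9) [OF W(1), of "f x" "f y"] f by (simp add: g_def clin_diff)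
    then have "p (x - y) \<le> 0" using c [of "x - y"] xy csS by (simp add: csubspace_diff)
    then have "p (x - y) = 0" using presentsD(6) [OF V(1), of "x - y"] xy csS by (simp add: csubspace_diff)
    then show "x = y" using p0 [of "x - y"] xy csS by (simp add: csubspace_diff)
  qed
  have gS: "g ` S = vcarrier W" 
  proof (intro subset_antisym subsetI)
    fix u assume "u \<in> vcarrier W"
    then obtain y where "u = \<eta> y" unfolding carW by blast
    then show "u \<in> g ` S" using onto [of y] by (metis g_def imageI)
  qed (auto simp: g_def carW)
  define h where "h = inv_into S g"
  have hg: "h (g x) = x" if "x \<in> S" for x using inj that by (simp add: h_def)
  interpret V: Metric_space S "vdist V" using V(2) by (simp add: carV)
  have "vlinear V W g"
    unfolding vlinear_def carV
  proof (intro conjI ballI allI)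
    show "g \<in> S \<rightarrow> vcarrier W" using gS by blast
    show "g (vadd V x y) = vadd W (g x) (g y)" if "x \<in> S" "y \<in> S" for x y
      using that f presentsD(3) [OF V(1)] presentsD(3) [OF W(1)] by (simp add: g_def clin_add)
    show "g (vscale V a x) = vscale W a (g x)" if "x \<in> S" for a x
      using that f presentsD(4) [OF V(1)] presentsD(4) [OF W(1)] by (simp add: g_def clin_scale)
  qed
  moreover have "homeomorphic_maps (vtopology V) (vtopology W) g h"
    unfolding homeomorphic_maps_def
  proof (intro conjI ballI)
    show "continuous_map (vtopology V) (vtopology W) g"
      unfolding vtopology_def carV V.metric_continuous_map [OF W(2)]
    proof (intro conjI ballI allI impI)
      show "g ` S \<subseteq> vcarrier W" using gS by simp
      fix a \<epsilon> :: real assume "\<epsilon> > 0"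
      fix x assume "x \<in> S"
      \<comment> \<open>The denominator \<open>\<bar>b\<bar> + 1\<close> is positive whatever the
        sign of \<open>b\<close>.\<close>
      have "vdist W (g x) (g y) < \<epsilon>" if "y \<in> S" "vdist V x y < \<epsilon> / (\<bar>b\<bar> + 1)" for y
      proof -
        have pos: "p (x - y) \<ge> 0" using presentsD(6) [OF V(1)] csS that \<open>x \<in> S\<close> by (simp add: csubspace_diff)
        have "vdist W (g x) (g y) \<le> b * p (x - y)"
          unfolding dW using b csS that \<open>x \<in> S\<close> by (simp add: csubspace_diff)
        also have "\<dots> \<le> (\<bar>b\<bar> + 1) * p (x - y)" using pos by (intro mult_right_mono) auto
        also have "\<dots> < \<epsilon>" using that \<open>x \<in> S\<close> by (simp add: dV pos_less_divide_eq mult.commute)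
        finally show ?thesis .
      qed
      then show "\<exists>\<delta>>0. \<forall>y. y \<in> S \<and> vdist V x y < \<delta> \<longrightarrow> vdist W (g x) (g y) < \<epsilon>"
        using \<open>\<epsilon> > 0\<close> by (intro exI [of _ "\<epsilon> / (\<bar>b\<bar> + 1)"]) auto
    qed
    show "continuous_map (vtopology W) (vtopology V) h"
      unfolding vtopology_def carV Metric_space.metric_continuous_map [OF W(2) V.Metric_space_axioms]
      unfolding gS [symmetric]
    proof (intro conjI ballI allI impI)
      show "h ` g ` S \<subseteq> S" using hg by auto
      fix u and \<epsilon> :: real assume "\<epsilon> > 0" and "u \<in> g ` S"
      then obtain x where x: "x \<in> S" "u = g x" by blast
      have "vdist V x y < \<epsilon>" if "y \<in> S" "vdist W (g x) (g y) < \<epsilon> / (\<bar>c\<bar> + 1)" for y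
      proof -
        have pos: "q (f (x - y)) \<ge> 0" using presentsD(6) [OF W(1)] by simp
        have "vdist V x y \<le> c * q (f (x - y))"
          using c csS that x by (simp add: csubspace_diff dV)
        also have "\<dots> \<le> (\<bar>c\<bar> + 1) * q (f (x - y))" using pos by (intro mult_right_mono) auto
        also have "\<dots> < \<epsilon>" using that by (simp add: dW pos_less_divide_eq mult.commute)
        finally show ?thesis .
      qed
      then have "\<forall>v. v \<in> g ` S \<and> vdist W u v < \<epsilon> / (\<bar>c\<bar> + 1) \<longrightarrow> vdist V (h u) (h v) < \<epsilon>"
        using x hg by auto
      then show "\<exists>\<delta>>0. \<forall>v. v \<in> g ` S \<and> vdist W u v < \<delta> \<longrightarrow> vdist V (h u) (h v) < \<epsilon>"
        using \<open>\<epsilon> > 0\<close> by (intro exI [of _ "\<epsilon> / (\<bar>c\<bar> + 1)"]) auto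
    qed
    show "h (g x) = x" if "x \<in> topspace (vtopology V)" for x
      using that hg by (simp add: vtopology_def carV)
    show "g (h u) = u" if "u \<in> topspace (vtopology W)" for u
    proof -
      have "u \<in> g ` S"
        using that unfolding vtopology_def Metric_space.topspace_mtopology [OF W(2)] gS .
      then show ?thesis by (simp add: h_def f_inv_into_f)
    qed
  qed
  ultimately show ?thesis
    unfolding isomorphic_spaces_def using homeomorphic_maps_map by blast
qed

text \<open>Continuity at 0 becomes a norm bound by rescaling. The function \<open>h\<close> merely
  picks representatives and is linear only modulo the kernel of \<eta>, so its linearity is stated
  through \<eta>.\<close>

lemma presents_iso_bounded:
  fixes q :: "'w::complex_normed_vector \<Rightarrow> real"
  assumes V: "presents V S (\<lambda>x. x) norm" "Metric_space (vcarrier V) (vdist V)"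
    and W: "presents W UNIV \<eta> q" "Metric_space (vcarrier W) (vdist W)"
    and "V \<cong>\<^sub>s W"
  obtains h c where "\<And>x. x \<in> S \<Longrightarrow> q (h x) \<le> c * norm x" "\<And>y. \<exists>x\<in>S. \<eta> (h x) = \<eta> y"
    "\<And>x y. x \<in> S \<Longrightarrow> y \<in> S \<Longrightarrow> \<eta> (h (x + y)) = \<eta> (h x + h y)"
    "\<And>a x. x \<in> S \<Longrightarrow> \<eta> (h (a *\<^sub>C x)) = \<eta> (a *\<^sub>C h x)"
    "\<And>x. x \<in> S \<Longrightarrow> \<eta> (h x) = \<eta> 0 \<Longrightarrow> x = 0"
proof -
  obtain f where f: "vlinear V W f" "homeomorphic_map (vtopology V) (vtopology W) f"
    using assms by (auto simp: isomorphic_spaces_def)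
  have csS: "csubspace S" and carV: "vcarrier V = S" and carW: "vcarrier W = range \<eta>"
    using presentsD(1,2) [OF V(1)] presentsD(2) [OF W(1)] by auto
  interpret V: Metric_space S "vdist V" using V(2) by (simp add: carV)
  have top: "topspace (vtopology V) = S" "topspace (vtopology W) = range \<eta>"
    using Metric_space.topspace_mtopology [OF W(2)] by (simp_all add: vtopology_def carV carW)
  have onto: "f ` S = range \<eta>" and inj: "inj_on f S"
    using homeomorphic_imp_surjective_map [OF f(2)] homeomorphic_imp_injective_map [OF f(2)] top by auto
  have "\<exists>z. f x = \<eta> z" if "x \<in> S" for x using onto that by blast
  then obtain h where h: "\<And>x. x \<in> S \<Longrightarrow> f x = \<eta> (h x)" by metis
  have add: "\<eta> (h (x + y)) = \<eta> (h x + h y)" if "x \<in> S" "y \<in> S" for x y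
  proof -
    have "\<eta> (h (x + y)) = f (vadd V x y)"
      using that csS by (simp add: presentsD(3) [OF V(1)] csubspace_add h)
    also have "\<dots> = vadd W (\<eta> (h x)) (\<eta> (h y))"
      using f(1) that by (simp add: vlinear_def carV h)
    finally show ?thesis by (simp add: presentsD(3) [OF W(1)])
  qed
  have scale: "\<eta> (h (a *\<^sub>C x)) = \<eta> (a *\<^sub>C h x)" if "x \<in> S" for a x
  proof -
    have "\<eta> (h (a *\<^sub>C x)) = f (vscale V a x)"
      using that csS by (simp add: presentsD(4) [OF V(1)] csubspace_scale h)
    also have "\<dots> = vscale W a (\<eta> (h x))"
      using f(1) that by (simp add: vlinear_def carV h)
    finally show ?thesis by (simp add: presentsD(4) [OF W(1)])
  qed
  have q_eq: "q x = q y" if "\<eta> x = \<eta> y" for x y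
    using presentsD(5) [OF W(1), of x] presentsD(5) [OF W(1), of y] that by simp
  have zero: "\<eta> (h 0) = \<eta> 0" using scale [of 0 0] csS by (simp add: csubspace_0)
  have "continuous_map (vtopology V) (vtopology W) f" by (rule homeomorphic_imp_continuous_map [OF f(2)])
  then have "\<forall>a\<in>S. \<forall>\<epsilon>>0. \<exists>\<delta>>0. \<forall>x. x \<in> S \<and> vdist V a x < \<delta> \<longrightarrow> vdist W (f a) (f x) < \<epsilon>"
    unfolding vtopology_def carV V.metric_continuous_map [OF W(2)] by blast
  then obtain \<delta> where \<delta>: "\<delta> > 0" "\<And>x. x \<in> S \<Longrightarrow> vdist V 0 x < \<delta> \<Longrightarrow> vdist W (f 0) (f x) < 1"
    using csubspace_0 [OF csS] zero_less_one by blast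
  have small: "q (h x) < 1" if "x \<in> S" "norm x < \<delta>" for x
  proof -
    have "vdist V 0 x < \<delta>" using presents_vdist [OF V(1), of 0 x] that csS by (simp add: csubspace_0)
    then have "vdist W (\<eta> 0) (\<eta> (h x)) < 1" using \<delta>(2) that csS by (simp add: h csubspace_0 flip: zero)
    then have "q (- h x) < 1" using presents_vdist [OF W(1), of 0 "h x"] by simp
    then show ?thesis using presentsD(8) [OF W(1), of "h x" "-1"] by simp
  qed
  have "q (h x) \<le> (2 / \<delta>) * norm x" if "x \<in> S" for x
  proof (cases "x = 0")
    case True
    then show ?thesis using q_eq [OF zero] presentsD(8) [OF W(1), of 0 0] by simp
  next
    case False
    \<comment> \<open>The factor 2 keeps the scaled vector strictly inside the ball of radius
      \<delta>; then q (h x) < 1/t = (2/\<delta>) * norm x.\<close>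
    define t where "t = \<delta> / (2 * norm x)"
    have t: "t > 0" using False \<delta> by (simp add: t_def)
    have "norm (complex_of_real t *\<^sub>C x) = t * norm x" using t by (simp add: norm_scaleC)
    also have "\<dots> < \<delta>" using False \<delta> by (simp add: t_def)
    finally have "norm (complex_of_real t *\<^sub>C x) < \<delta>" .
    then have "q (h (complex_of_real t *\<^sub>C x)) < 1" using small that csS by (simp add: csubspace_scale)
    then have "t * q (h x) < 1"
      using q_eq [OF scale [OF that, of "complex_of_real t"]] presentsD(8) [OF W(1), of "h x" "complex_of_real t"] t
      by simp
    then show ?thesis using False \<delta> by (simp add: t_def field_simps)
  qed
  moreover have "\<exists>x\<in>S. \<eta> (h x) = \<eta> y" for y
    using onto h by (metis (no_types, lifting) image_iff rangeI)
  moreover have "x = 0" if "x \<in> S" "\<eta> (h x) = \<eta> 0" for x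
    using inj that zero csubspace_0 [OF csS] by (metis h inj_onD)
  ultimately show ?thesis using that add scale by blast
qed

subsection \<open>The two sides of the isomorphism\<close>

lemma prod_space_sel:
  "vcarrier (V \<times>\<^sub>s W) = vcarrier V \<times> vcarrier W"
  "vadd (V \<times>\<^sub>s W) u v = (vadd V (fst u) (fst v), vadd W (snd u) (snd v))"
  "vscale (V \<times>\<^sub>s W) c u = (vscale V c (fst u), vscale W c (snd u))"
  "vnorm (V \<times>\<^sub>s W) u = sqrt ((vnorm V (fst u))\<^sup>2 + (vnorm W (snd u))\<^sup>2)"
  by (simp_all add: prod_space_def case_prod_beta)

lemma presents_sub_prod:
  assumes "csubspace S" "csubspace T"
  shows "presents (sub_space S \<times>\<^sub>s sub_space T) (S \<times> T) (\<lambda>x. x) norm"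
  unfolding presents_def prod_space_sel sub_space_sel norm_prod_def [symmetric]
    scaleC_prod_def [symmetric] plus_prod_def [symmetric]
  by (intro conjI ballI allI)
     (simp_all add: csubspace_Times assms norm_triangle_ineq norm_scaleC)

lemma metric_sub_prod:
  assumes "csubspace S" "csubspace T"
  shows "Metric_space (vcarrier (sub_space S \<times>\<^sub>s sub_space T)) (vdist (sub_space S \<times>\<^sub>s sub_space T))"
  by (rule presents_metric [OF presents_sub_prod [OF assms]])
     (simp_all add: vdist_def prod_space_sel sub_space_def norm_minus_commute)

text \<open>Since R = -R, the norms over a coset are the distances from \<open>z\<close> to points
  of \<open>R\<close>, and the quotient norm becomes \<open>infdist\<close>.\<close>

lemma norm_coset:
  fixes R :: "'a::complex_normed_vector set"
  assumes R: "csubspace R" shows "Inf (norm ` (z +o R)) = infdist z R"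
proof -
  have "norm ` (z +o R) = dist z ` R"
  proof (intro subset_antisym subsetI)
    fix t assume "t \<in> norm ` (z +o R)"
    then obtain r where "r \<in> R" "t = norm (z + r)" by (auto simp: elt_set_plus_def)
    then have "t = dist z (- r)" "- r \<in> R" using R by (simp_all add: dist_norm csubspace_minus)
    then show "t \<in> dist z ` R" by blast
  next
    fix t assume "t \<in> dist z ` R"
    then obtain r where "r \<in> R" "t = norm (z + - r)" by (auto simp: dist_norm)
    then show "t \<in> norm ` (z +o R)" using csubspace_minus [OF R] by blast
  qed
  then show ?thesis using csubspace_0 [OF R] by (auto simp: infdist_def)
qed

lemma infdist_approx:
  assumes "R \<noteq> {}" "e > 0" obtains r where "r \<in> R" "dist x r < infdist x R + e"
  using cInf_lessD [of "dist x ` R" "infdist x R + e"] assms by (auto simp: infdist_def)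

lemma infdist_subspace_add:
  assumes R: "csubspace R" shows "infdist (x + y) R \<le> infdist x R + infdist y R"
proof (rule field_le_epsilon)
  fix e :: real assume "e > 0"
  have ne: "R \<noteq> {}" using csubspace_0 [OF R] by blast
  obtain r where r: "r \<in> R" "dist x r < infdist x R + e/2" using infdist_approx [OF ne] \<open>e > 0\<close> half_gt_zero by metis
  obtain s where s: "s \<in> R" "dist y s < infdist y R + e/2" using infdist_approx [OF ne] \<open>e > 0\<close> half_gt_zero by metis
  have "infdist (x + y) R \<le> dist (x + y) (r + s)" using R r s by (intro infdist_le csubspace_add)
  also have "\<dots> \<le> dist x r + dist y s" by (rule dist_triangle_add)
  finally show "infdist (x + y) R \<le> infdist x R + infdist y R + e" using r s by linarith
qed

lemma infdist_subspace_scale: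
  assumes R: "csubspace R" shows "infdist (c *\<^sub>C x) R = cmod c * infdist x R"
proof -
  have ne: "R \<noteq> {}" using csubspace_0 [OF R] by blast
  have le: "infdist (c *\<^sub>C x) R \<le> cmod c * infdist x R" if "c \<noteq> 0" for c x
  proof -
    have "infdist (c *\<^sub>C x) R / cmod c \<le> dist x r" if "r \<in> R" for r
    proof -
      have "infdist (c *\<^sub>C x) R \<le> dist (c *\<^sub>C x) (c *\<^sub>C r)" using R that by (intro infdist_le csubspace_scale)
      also have "\<dots> = cmod c * dist x r" by (simp add: dist_norm norm_scaleC flip: scaleC_diff_right)
      finally show ?thesis using \<open>c \<noteq> 0\<close> by (simp add: divide_simps mult.commute)
    qed
    then have "infdist (c *\<^sub>C x) R / cmod c \<le> infdist x R"
      using ne by (auto simp: infdist_def intro!: cINF_greatest)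
    then show ?thesis using \<open>c \<noteq> 0\<close> by (simp add: divide_simps mult.commute)
  qed
  show ?thesis
  proof (cases "c = 0")
    case True then show ?thesis using csubspace_0 [OF R] by simp
  next
    case False
    have "infdist x R \<le> infdist (c *\<^sub>C x) R / cmod c"
      using le [of "1/c" "c *\<^sub>C x"] False by (simp add: scaleC_scaleC scaleC_one norm_divide)
    then show ?thesis using le [OF False, of x] False by (simp add: divide_simps mult.commute)
  qed
qed

lemma sqrt_sum_squares_mono:
  "0 \<le> a \<Longrightarrow> 0 \<le> b \<Longrightarrow> a \<le> c \<Longrightarrow> b \<le> d \<Longrightarrow> sqrt (a\<^sup>2 + b\<^sup>2) \<le> sqrt (c\<^sup>2 + d\<^sup>2)" for a b c d :: real
  by (simp add: add_mono power_mono)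

definition prod_coset where "prod_coset R T z = (fst z +o R, snd z +o T)"

definition prod_infdist where "prod_infdist R T z = sqrt ((infdist (fst z) R)\<^sup>2 + (infdist (snd z) T)\<^sup>2)"

lemma presents_quotient_prod:
  assumes R: "csubspace R" "closed R" and T: "csubspace T" "closed T"
  shows "presents (quotient_space R \<times>\<^sub>s quotient_space T) UNIV (prod_coset R T) (prod_infdist R T)"
proof -
  have ne: "R \<noteq> {}" "T \<noteq> {}" using csubspace_0 R T by blast+
  have tri: "prod_infdist R T (x + y) \<le> prod_infdist R T x + prod_infdist R T y" for x y
  proof -
    have "prod_infdist R T (x + y) \<le> sqrt ((infdist (fst x) R + infdist (fst y) R)\<^sup>2 + (infdist (snd x) T + infdist (snd y) T)\<^sup>2)"
      unfolding prod_infdist_def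
      by (intro sqrt_sum_squares_mono) (simp_all add: infdist_nonneg infdist_subspace_add R T)
    then show ?thesis unfolding prod_infdist_def by (meson order_trans real_sqrt_sum_squares_triangle_ineq)
  qed
  have scale: "prod_infdist R T (c *\<^sub>C x) = cmod c * prod_infdist R T x" for c x
    by (simp add: prod_infdist_def scaleC_prod_def infdist_subspace_scale R T power_mult_distrib
        real_sqrt_mult flip: distrib_left)
  have eq: "prod_coset R T x = prod_coset R T y \<longleftrightarrow> prod_infdist R T (x - y) = 0" for x y
    by (simp add: prod_coset_def prod_infdist_def coset_eq_iff R T in_closed_iff_infdist_zero ne
        sum_power2_eq_zero_iff)
  have car: "(range (\<lambda>z. z +o R) \<times> range (\<lambda>z. z +o T)) = range (prod_coset R T)"
    by (auto simp: prod_coset_def image_iff)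
  show ?thesis
    unfolding presents_def prod_space_sel quotient_space_sel car
    using tri scale eq
    by (simp add: prod_coset_def coset_add coset_scale R T norm_coset prod_infdist_def scaleC_prod_def)
qed

text \<open>\<open>u\<close> and \<open>v\<close> are arbitrary sets and not only cosets, because
  \<open>Metric_space\<close> wants symmetry on the whole type. Negating the elements of one
  difference set gives the other.\<close>

lemma quotient_vdist_commute:
  assumes R: "csubspace R"
  shows "vnorm (quotient_space R) (vadd (quotient_space R) u (vscale (quotient_space R) (-1) v))
    = vnorm (quotient_space R) (vadd (quotient_space R) v (vscale (quotient_space R) (-1) u))"
proof -
  have sub: "norm ` (u + (scaleC (-1) ` v + R)) \<subseteq> norm ` (v + (scaleC (-1) ` u + R))" for u v
  proof
    fix t assume "t \<in> norm ` (u + (scaleC (-1) ` v + R))"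
    then obtain x y r where "t = norm (x + (- y + r))" "x \<in> u" "y \<in> v" "r \<in> R"
      by (auto simp: set_plus_def)
    moreover have "norm (x + (- y + r)) = norm (y + (- x + - r))"
      by (metis (no_types, opaque_lifting) add.commute add.left_commute minus_add_distrib minus_minus norm_minus_cancel)
    moreover have "y + ((-1) *\<^sub>C x + - r) \<in> v + (scaleC (-1) ` u + R)"
      using \<open>x \<in> u\<close> \<open>y \<in> v\<close> \<open>r \<in> R\<close> csubspace_minus [OF R] by (intro set_plus_intro imageI)
    ultimately show "t \<in> norm ` (v + (scaleC (-1) ` u + R))" by force
  qed
  have "norm ` (u + (scaleC (-1) ` v + R)) = norm ` (v + (scaleC (-1) ` u + R))"
    by (intro subset_antisym sub)
  then show ?thesis by (simp only: quotient_space_sel)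
qed

lemma metric_quotient_prod:
  assumes R: "csubspace R" "closed R" and T: "csubspace T" "closed T"
  shows "Metric_space (vcarrier (quotient_space R \<times>\<^sub>s quotient_space T)) (vdist (quotient_space R \<times>\<^sub>s quotient_space T))"
  by (rule presents_metric [OF presents_quotient_prod [OF assms]])
     (simp_all add: vdist_def prod_space_sel quotient_vdist_commute R T)

lemma prod_coset_eq_iff:
  "csubspace R \<Longrightarrow> csubspace T \<Longrightarrow> prod_coset R T x = prod_coset R T y \<longleftrightarrow> x - y \<in> R \<times> T"
  by (simp add: prod_coset_def coset_eq_iff mem_Times_iff)

text \<open>\<open>P\<close> is constant on the cosets of \<open>R\<close>, so its bound can be
  taken over the best representative.\<close>

lemma norm_le_infdist:
  assumes P: "bounded_clinear P" and R: "csubspace R" "R \<subseteq> nullspace P"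
  obtains c where "c > 0" "\<And>z. norm (P z) \<le> c * infdist z R"
proof -
  obtain c where c: "c > 0" "\<And>x. norm (P x) \<le> c * norm x" using bounded_clinear_pos_bound [OF P] by blast
  have "norm (P z) \<le> c * infdist z R" for z
  proof -
    have "norm (P z) / c \<le> dist z r" if "r \<in> R" for r
    proof -
      have "P z = P (z - r)"
        using R that clin_diff [OF bounded_clinear_clin [OF P]] by (auto simp: nullspace_def)
      then show ?thesis using c(1) c(2) [of "z - r"] by (simp add: divide_simps mult.commute dist_norm)
    qed
    then have "norm (P z) / c \<le> infdist z R"
      using csubspace_0 [OF R(1)] by (auto simp: infdist_def intro!: cINF_greatest)
    then show ?thesis using c(1) by (simp add: divide_simps mult.commute)
  qed
  with c(1) that show ?thesis by blast
qed

context
  fixes A :: "'a::complex_banach \<Rightarrow> 'a" and B :: "'b::complex_banach \<Rightarrow> 'b"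
    and P :: "'a \<Rightarrow> 'a" and Q :: "'b \<Rightarrow> 'b" and E R
  assumes A: "bounded_clinear A" and B: "bounded_clinear B"
    and P: "bounded_clinear P" "\<And>x. P (A x) = 0" "\<And>x. x - P x \<in> range A"
    and Q: "bounded_clinear Q" "\<And>x. Q (B x) = 0" "\<And>x. x - Q x \<in> range B"
  defines "E \<equiv> nullspace A \<times> nullspace B" and "R \<equiv> range A \<times> range B"
begin

private lemma lin: "clin A" "clin B" "clin P" "clin Q"
  using A B P Q bounded_clinear_clin by auto

private lemma sub: "csubspace (range A)" "csubspace (range B)" "csubspace (nullspace A)" "csubspace (nullspace B)"
  "csubspace E" "csubspace R"
  using lin by (simp_all add: csubspace_range csubspace_nullspace E_def R_def csubspace_Times)

private lemma ranges: "range A = nullspace P" "range B = nullspace Q"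
  using P(2,3) Q(2,3) by (auto simp: nullspace_def) (metis diff_zero)+

private lemma closed_ranges: "closed (range A)" "closed (range B)"
  unfolding ranges by (rule closed_nullspace P Q)+

text \<open>A bounded linear choice of coset representatives: it vanishes exactly on
  \<open>R\<close> and moves \<open>z\<close> only within its coset. It replaces maps into the
  quotient by operators into the product space.\<close>

private definition "\<rho> z = (P (fst z), Q (snd z))"

private lemma \<rho>_bounded: "bounded_clinear \<rho>"
  unfolding \<rho>_def
  by (intro bounded_clinear_Pair bounded_clinear_compose [OF P(1)] bounded_clinear_compose [OF Q(1)]
      bounded_clinear_fst bounded_clinear_snd)

private lemma \<rho>_eq_0: "\<rho> z = 0 \<longleftrightarrow> z \<in> R"
  by (auto simp: \<rho>_def R_def ranges nullspace_def zero_prod_def mem_Times_iff)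

private lemma \<rho>_diff: "z - \<rho> z \<in> R"
  using P(3) Q(3) by (simp add: \<rho>_def R_def mem_Times_iff)

private lemma \<rho>_norm: obtains d where "d > 0" "\<And>z. norm (\<rho> z) \<le> d * prod_infdist (range A) (range B) z"
proof -
  obtain c where c: "c > 0" "\<And>z. norm (P z) \<le> c * infdist z (range A)"
    using norm_le_infdist [OF P(1) sub(1)] ranges by blast
  obtain d where d: "d > 0" "\<And>z. norm (Q z) \<le> d * infdist z (range B)"
    using norm_le_infdist [OF Q(1) sub(2)] ranges by blast
  have "norm (\<rho> z) \<le> (c + d) * prod_infdist (range A) (range B) z" for z
  proof -
    have "norm (\<rho> z) \<le> norm (P (fst z)) + norm (Q (snd z))"
      unfolding \<rho>_def by (rule norm_Pair_le)
    also have "\<dots> \<le> c * infdist (fst z) (range A) + d * infdist (snd z) (range B)"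
      by (intro add_mono c d)
    also have "\<dots> \<le> c * prod_infdist (range A) (range B) z + d * prod_infdist (range A) (range B) z"
      using c d unfolding prod_infdist_def
      by (intro add_mono mult_left_mono) (auto simp: infdist_nonneg intro: real_le_rsqrt)
    finally show ?thesis by (simp add: algebra_simps)
  qed
  then show ?thesis using that c d by (meson add_pos_pos)
qed

private lemmas quotient_facts =
  presents_quotient_prod [OF sub(1) closed_ranges(1) sub(2) closed_ranges(2)]
  metric_quotient_prod [OF sub(1) closed_ranges(1) sub(2) closed_ranges(2)]

private lemmas sub_facts =
  presents_sub_prod [OF sub(3,4), folded E_def] metric_sub_prod [OF sub(3,4)]

text \<open>The isomorphism is lifted to representatives \<open>h\<close>, made linear by \<rho>,
  which sees only cosets, and extended from \<open>E\<close> to the whole space by the projection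
  \<open>PE\<close>.\<close>

lemma isomorphic_operator:
  assumes PE: "bounded_clinear PE" "range PE = E" "\<And>x. PE (PE x) = PE x"
    and "sub_space (nullspace A) \<times>\<^sub>s sub_space (nullspace B)
      \<cong>\<^sub>s quotient_space (range A) \<times>\<^sub>s quotient_space (range B)"
  obtains \<Psi> where "bounded_clinear \<Psi>" "{e\<in>E. \<Psi> e \<in> R} = {0}" "R + \<Psi> ` E = UNIV"
proof -
  let ?\<kappa> = "prod_coset (range A) (range B)" and ?q = "prod_infdist (range A) (range B)"
  obtain h c where h: "\<And>x. x \<in> E \<Longrightarrow> ?q (h x) \<le> c * norm x" "\<And>y. \<exists>x\<in>E. ?\<kappa> (h x) = ?\<kappa> y"
    "\<And>x y. x \<in> E \<Longrightarrow> y \<in> E \<Longrightarrow> ?\<kappa> (h (x + y)) = ?\<kappa> (h x + h y)"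
    "\<And>a x. x \<in> E \<Longrightarrow> ?\<kappa> (h (a *\<^sub>C x)) = ?\<kappa> (a *\<^sub>C h x)"
    "\<And>x. x \<in> E \<Longrightarrow> ?\<kappa> (h x) = ?\<kappa> 0 \<Longrightarrow> x = 0"
    using presents_iso_bounded [OF sub_facts quotient_facts assms(4)] by blast
  have \<kappa>: "?\<kappa> x = ?\<kappa> y \<longleftrightarrow> x - y \<in> R" for x y
    using prod_coset_eq_iff sub by (simp add: R_def)
  have linP: "clin \<rho>" by (rule bounded_clinear_clin [OF \<rho>_bounded])
  have \<rho>: "\<rho> x = \<rho> y" if "?\<kappa> x = ?\<kappa> y" for x y
    using that clin_diff [OF linP, of x y] by (simp add: \<kappa> flip: \<rho>_eq_0)
  have PE_E: "PE x \<in> E" for x using PE(2) by blast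
  have PE_id: "PE x = x" if "x \<in> E" for x using PE(2,3) that by (metis imageE)
  have linPE: "clin PE" by (rule bounded_clinear_clin [OF PE(1)])
  define \<Psi> where "\<Psi> x = \<rho> (h (PE x))" for x
  have "clin \<Psi>"
    unfolding clin_def
  proof (intro conjI allI)
    fix x y a
    have "\<Psi> (x + y) = \<rho> (h (PE x) + h (PE y))"
      unfolding \<Psi>_def by (rule \<rho>) (simp add: clin_add [OF linPE] h(3) PE_E)
    then show "\<Psi> (x + y) = \<Psi> x + \<Psi> y" by (simp add: \<Psi>_def clin_add [OF linP])
    have "\<Psi> (a *\<^sub>C x) = \<rho> (a *\<^sub>C h (PE x))"
      unfolding \<Psi>_def by (rule \<rho>) (simp add: clin_scale [OF linPE] h(4) PE_E)
    then show "\<Psi> (a *\<^sub>C x) = a *\<^sub>C \<Psi> x" by (simp add: \<Psi>_def clin_scale [OF linP])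
  qed
  moreover
  obtain d where d: "d > 0" "\<And>z. norm (\<rho> z) \<le> d * ?q z" using \<rho>_norm by blast
  obtain k where k: "k > 0" "\<And>x. norm (PE x) \<le> k * norm x" using bounded_clinear_pos_bound [OF PE(1)] by blast
  have "norm (\<Psi> x) \<le> (d * (\<bar>c\<bar> * k)) * norm x" for x
  proof -
    have "norm (\<Psi> x) \<le> d * ?q (h (PE x))" unfolding \<Psi>_def by (rule d)
    also have "\<dots> \<le> d * (c * norm (PE x))" using d h(1) PE_E by (intro mult_left_mono) auto
    also have "\<dots> \<le> d * (\<bar>c\<bar> * (k * norm x))" using d k by (intro mult_left_mono mult_mono) auto
    finally show ?thesis by (simp add: ac_simps)
  qed
  ultimately have "bounded_clinear \<Psi>" by (rule bounded_clinearI)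
  moreover have "{e\<in>E. \<Psi> e \<in> R} = {0}"
  proof (intro subset_antisym subsetI)
    fix e assume e: "e \<in> {e\<in>E. \<Psi> e \<in> R}"
    then have "\<rho> (h e) \<in> R" using PE_id [of e] by (simp add: \<Psi>_def)
    then have "h e \<in> R"
      using csubspace_add [OF sub(6) \<rho>_diff [of "h e"]] by fastforce
    then have "?\<kappa> (h e) = ?\<kappa> 0" by (simp add: \<kappa>)
    then show "e \<in> {0}" using h(5) [of e] e by simp
  qed (simp add: csubspace_0 sub clin_0 [OF \<open>clin \<Psi>\<close>])
  moreover have "R + \<Psi> ` E = UNIV"
  proof (rule sym, rule UNIV_eq_I)
    fix y obtain e where e: "e \<in> E" "?\<kappa> (h e) = ?\<kappa> y" using h(2) by blast
    then have "\<Psi> e = \<rho> y" using \<rho> [OF e(2)] PE_id [OF e(1)] by (simp add: \<Psi>_def)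
    then have "(y - \<rho> y) + \<Psi> e = y" by simp
    then show "y \<in> R + \<Psi> ` E" using set_plus_intro [OF \<rho>_diff imageI [OF e(1)]] by metis
  qed
  ultimately show ?thesis by (rule that)
qed

text \<open>The induced map into the quotient has to be bounded below. The open mapping theorem is
  applied to F (e, (x, z)) = \<Psi> e + (A x, B z), which is onto the product space. A bounded
  solution of F w = \<rho> (\<Psi> x) has first component \<open>x\<close>, because \<Psi> is
  injective on \<open>E\<close> modulo \<open>R\<close>.\<close>

lemma operator_isomorphic:
  assumes \<Psi>: "bounded_clinear \<Psi>" "{e\<in>E. \<Psi> e \<in> R} = {0}" "R + \<Psi> ` E = UNIV"
  shows "sub_space (nullspace A) \<times>\<^sub>s sub_space (nullspace B)
      \<cong>\<^sub>s quotient_space (range A) \<times>\<^sub>s quotient_space (range B)"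
proof -
  let ?\<kappa> = "prod_coset (range A) (range B)" and ?q = "prod_infdist (range A) (range B)"
  have lin\<Psi>: "clin \<Psi>" by (rule bounded_clinear_clin [OF \<Psi>(1)])
  obtain b where b: "\<And>x. norm (\<Psi> x) \<le> b * norm x" using bounded_clinear_pos_bound [OF \<Psi>(1)] by blast
  have le: "infdist z S \<le> norm z" if "csubspace S" for S and z :: "'c::complex_normed_vector"
    using infdist_le [OF csubspace_0 [OF that], of z] by (simp add: dist_norm)
  have q: "?q z \<le> norm z" for z
    unfolding prod_infdist_def norm_prod_def
    by (intro sqrt_sum_squares_mono infdist_nonneg le sub)
  define F where "F w = \<Psi> (fst w) + (A (fst (snd w)), B (snd (snd w)))" for w :: "('a \<times> 'b) \<times> ('a \<times> 'b)"
  have F: "bounded_clinear F"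
    unfolding F_def
    by (intro bounded_clinear_add bounded_clinear_Pair bounded_clinear_compose [OF \<Psi>(1)]
        bounded_clinear_compose [OF A] bounded_clinear_compose [OF B]
        bounded_clinear_compose [OF bounded_clinear_fst] bounded_clinear_compose [OF bounded_clinear_snd]
        bounded_clinear_fst bounded_clinear_snd)
  have "closed E" unfolding E_def by (intro closed_Times closed_nullspace A B)
  have onto: "F ` (E \<times> UNIV) = UNIV"
  proof (rule sym, rule UNIV_eq_I)
    fix y
    have "y \<in> R + \<Psi> ` E" using \<Psi>(3) by simp
    then obtain r e where "y = r + \<Psi> e" "r \<in> R" "e \<in> E" by (auto elim: set_plus_elim)
    moreover from this obtain x z where "r = (A x, B z)" by (auto simp: R_def)
    ultimately have "y = F (e, (x, z))" by (simp add: F_def add.commute)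
    then show "y \<in> F ` (E \<times> UNIV)" using \<open>e \<in> E\<close> by blast
  qed
  obtain c where c: "c > 0" "\<And>y. \<exists>w\<in>E \<times> UNIV. F w = y \<and> norm w \<le> c * norm y"
    using open_mapping [OF F csubspace_Times [OF sub(5) csubspace_UNIV] closed_Times [OF \<open>closed E\<close> closed_UNIV] onto]
    by blast
  obtain d where d: "d > 0" "\<And>z. norm (\<rho> z) \<le> d * ?q z" using \<rho>_norm by blast
  have low: "norm x \<le> (c * d) * ?q (\<Psi> x)" if x: "x \<in> E" for x
  proof -
    obtain w where w: "w \<in> E \<times> UNIV" "F w = \<rho> (\<Psi> x)" "norm w \<le> c * norm (\<rho> (\<Psi> x))" using c(2) by blast
    define r where "r = (A (fst (snd w)), B (snd (snd w)))"
    have "r \<in> R" by (simp add: r_def R_def)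
    have "\<Psi> (x - fst w) = (\<Psi> x - \<rho> (\<Psi> x)) + r"
      using w(2) by (simp add: clin_diff [OF lin\<Psi>] F_def r_def [symmetric] algebra_simps)
    then have "\<Psi> (x - fst w) \<in> R" using csubspace_add [OF sub(6) \<rho>_diff \<open>r \<in> R\<close>] by metis
    moreover have "x - fst w \<in> E" using x w sub(5) by (auto simp: csubspace_diff)
    ultimately have "x - fst w \<in> {e\<in>E. \<Psi> e \<in> R}" by blast
    then have "x = fst w" unfolding \<Psi>(2) by simp
    then have "norm x \<le> norm w" using norm_fst_le [of "fst w" "snd w"] by simp
    also have "\<dots> \<le> c * (d * ?q (\<Psi> x))" 
      by (rule order_trans [OF w(3) mult_left_mono [OF d(2)]]) (use c in simp)
    finally show ?thesis by (simp add: mult.assoc)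
  qed
  show ?thesis
  proof (rule presents_iso [OF sub_facts quotient_facts lin\<Psi>])
    show "?q (\<Psi> x) \<le> b * norm x" for x using q b order_trans by blast
    show "norm x \<le> (c * d) * ?q (\<Psi> x)" if "x \<in> E" for x using low that .
    show "\<exists>x\<in>E. ?\<kappa> (\<Psi> x) = ?\<kappa> y" for y
    proof -
      have "y \<in> R + \<Psi> ` E" using \<Psi>(3) by simp
      then obtain r e where "y = r + \<Psi> e" "r \<in> R" "e \<in> E" by (auto elim: set_plus_elim)
      then have "\<Psi> e - y \<in> R" using csubspace_minus [OF sub(6)] by simp
      then have "?\<kappa> (\<Psi> e) = ?\<kappa> y"
        unfolding prod_coset_eq_iff [OF sub(1,2)] R_def .
      then show ?thesis using \<open>e \<in> E\<close> by blast
    qed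
  qed
qed

end

section \<open>Ascent, descent and index\<close>

lemma Inf_enat_finite:
  assumes "(Inf {enat k | k. P k}) < \<infinity>" obtains k where "Inf {enat k | k. P k} = enat k" "P k"
proof -
  have "{enat k | k. P k} \<noteq> {}" using assms by (metis Inf_enat_def less_irrefl)
  then have "Inf {enat k | k. P k} \<in> {enat k | k. P k}"
    unfolding Inf_enat_def by (simp only: if_False) (rule LeastI_ex, blast)
  then show ?thesis using that by blast
qed

lemma Inf_enat_less_infinity: "P k \<Longrightarrow> Inf {enat k | k. P k} < \<infinity>"
  by (rule le_less_trans [OF Inf_lower, of "enat k"]) auto

lemma asc_finite:
  assumes "asc T < \<infinity>"
  obtains k where "asc T = enat k" "nullspace (T ^^ k) = nullspace (T ^^ Suc k)"
  using Inf_enat_finite [OF assms [unfolded asc_def]] that unfolding asc_def Suc_eq_plus1 by blast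

lemma asc_finiteI: "nullspace (T ^^ k) = nullspace (T ^^ Suc k) \<Longrightarrow> asc T < \<infinity>"
  unfolding asc_def by (rule Inf_enat_less_infinity [of _ k]) simp

lemma des_finite:
  assumes "des T < \<infinity>"
  obtains k where "des T = enat k" "range (T ^^ k) = range (T ^^ Suc k)"
  using Inf_enat_finite [OF assms [unfolded des_def]] that unfolding des_def Suc_eq_plus1 by blast

lemma des_finiteI: "range (T ^^ k) = range (T ^^ Suc k) \<Longrightarrow> des T < \<infinity>"
  unfolding des_def by (rule Inf_enat_less_infinity [of _ k]) simp

lemma funpow_add_apply: "(T ^^ (m + n)) x = (T ^^ m) ((T ^^ n) x)"
  by (simp add: funpow_add)

lemma nullspace_funpow_stable:
  fixes T :: "'a::zero \<Rightarrow> 'a"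
  assumes "nullspace (T ^^ k) = nullspace (T ^^ Suc k)"
  shows "nullspace (T ^^ (k + j)) = nullspace (T ^^ k)"
proof (induction j)
  case (Suc j)
  have "x \<in> nullspace (T ^^ (k + Suc j)) \<longleftrightarrow> x \<in> nullspace (T ^^ k)" for x
  proof -
    have "x \<in> nullspace (T ^^ (k + Suc j)) \<longleftrightarrow> (T ^^ j) x \<in> nullspace (T ^^ Suc k)"
      using funpow_add_apply [of "Suc k" j T x] by (simp add: nullspace_def)
    also have "\<dots> \<longleftrightarrow> (T ^^ j) x \<in> nullspace (T ^^ k)" using assms by simp
    also have "\<dots> \<longleftrightarrow> x \<in> nullspace (T ^^ (k + j))"
      by (simp add: nullspace_def funpow_add_apply)
    finally show ?thesis using Suc by simp
  qed
  then show ?case by blast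
qed simp

lemma range_funpow_stable:
  fixes T :: "'a::type \<Rightarrow> 'a"
  assumes "range (T ^^ k) = range (T ^^ Suc k)"
  shows "range (T ^^ (k + j)) = range (T ^^ k)"
proof (induction j)
  case (Suc j)
  have "range (T ^^ (k + Suc j)) = T ` range (T ^^ (k + j))" by (simp add: image_image)
  also have "\<dots> = range (T ^^ Suc k)" by (simp only: Suc) (simp add: image_image)
  finally show ?case using assms by simp
qed simp

lemma asc_eq_des:
  fixes T :: "'a::complex_normed_vector \<Rightarrow> 'a"
  assumes T: "clin T" and "asc T < \<infinity>" "des T < \<infinity>"
  shows "asc T = des T"
proof -
  obtain a where a: "asc T = enat a" "nullspace (T ^^ a) = nullspace (T ^^ Suc a)"
    using asc_finite assms by blast
  obtain d where d: "des T = enat d" "range (T ^^ d) = range (T ^^ Suc d)"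
    using des_finite assms by blast
  have "nullspace (T ^^ Suc d) \<subseteq> nullspace (T ^^ d)"
  proof
    fix x assume x: "x \<in> nullspace (T ^^ Suc d)"
    \<comment> \<open>The ranges have stabilised at \<open>d\<close>, so \<open>(T ^^ d) x\<close>
      carries a further power \<open>a\<close>; stability of the kernels at \<open>a\<close> then
      removes one factor \<open>T\<close>.\<close>
    have "(T ^^ d) x \<in> range (T ^^ (d + a))" using range_funpow_stable [OF d(2)] by blast
    then obtain z where z: "(T ^^ d) x = (T ^^ a) ((T ^^ d) z)"
      by (metis add.commute funpow_add_apply imageE)
    then have "(T ^^ d) z \<in> nullspace (T ^^ Suc a)" using x by (simp add: nullspace_def)
    then have "(T ^^ d) z \<in> nullspace (T ^^ a)" using a by simp
    then have "(T ^^ a) ((T ^^ d) z) = 0" by (simp add: nullspace_def)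
    then show "x \<in> nullspace (T ^^ d)" using z by (simp add: nullspace_def)
  qed
  moreover have "nullspace (T ^^ d) \<subseteq> nullspace (T ^^ Suc d)"
    using clin_0 [OF T] by (auto simp: nullspace_def)
  ultimately have "asc T \<le> enat d"
    unfolding asc_def by (intro Inf_lower) auto
  moreover have "range (T ^^ a) \<subseteq> range (T ^^ Suc a)"
  proof
    fix y assume "y \<in> range (T ^^ a)"
    then obtain x where x: "y = (T ^^ a) x" by blast
    have "(T ^^ d) x \<in> range (T ^^ Suc d)" using d by blast
    then obtain w where w: "(T ^^ d) x = (T ^^ d) (T w)" by (auto simp: funpow_swap1)
    then have "(T ^^ d) (x - T w) = 0" by (simp add: clin_diff [OF clin_funpow [OF T]])
    then have "(T ^^ a) ((T ^^ d) (x - T w)) = 0" by (simp add: clin_0 [OF clin_funpow [OF T]])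
    then have "x - T w \<in> nullspace (T ^^ (a + d))" by (simp add: nullspace_def funpow_add_apply)
    then have "x - T w \<in> nullspace (T ^^ a)" using nullspace_funpow_stable [OF a(2)] by blast
    then have "(T ^^ a) (x - T w) = 0" by (simp add: nullspace_def)
    then have "y = (T ^^ a) (T w)" by (simp add: x clin_diff [OF clin_funpow [OF T]])
    then show "y \<in> range (T ^^ Suc a)" by (auto simp: funpow_swap1)
  qed
  moreover have "range (T ^^ Suc a) \<subseteq> range (T ^^ a)" by (auto simp: funpow_swap1)
  ultimately have "des T \<le> enat a"
    unfolding des_def by (intro Inf_lower) auto
  with \<open>asc T \<le> enat d\<close> a d show ?thesis by simp
qed

section \<open>Dimension counts for kernels and ranges of powers\<close>

lemma codim_image_finite:
  assumes T: "clin T" and n: "codim n K G" obtains m where "codim m (T ` K) (T ` G)"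
proof -
  have cs: "csubspace K" "csubspace G" "K \<subseteq> G" using codim_csubspace n by auto
  define Z where "Z = {g\<in>G. T g = 0}"
  have Z: "csubspace Z" "Z \<subseteq> G"
    using csubspace_Int [OF cs(2) csubspace_nullspace [OF T]] by (auto simp: Z_def nullspace_def Int_def)
  have KZ: "csubspace (K + Z)" "K + Z \<subseteq> G" "K \<subseteq> K + Z" "Z \<subseteq> K + Z"
    using cs Z by (simp_all add: csubspace_plus plus_subset subset_plus_left subset_plus_right)
  obtain b where "codim b (K + Z) G" using codim_split [OF n KZ(1,3,2)] by blast
  then have "codim b (T ` (K + Z)) (T ` G)"
    using KZ by (subst codim_image [OF T KZ(1) cs(2) KZ(2)]) (auto simp: Z_def)
  moreover have "T ` (K + Z) = T ` K"
  proof (rule subset_antisym)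
    show "T ` (K + Z) \<subseteq> T ` K"
      by (auto elim!: set_plus_elim simp: clin_add [OF T] Z_def)
    show "T ` K \<subseteq> T ` (K + Z)" by (rule image_mono [OF KZ(3)])
  qed
  ultimately show ?thesis using that by simp
qed

lemma codim_zero_subset:
  assumes T: "clin T" and "codim n {0} G" "csubspace H" "H \<subseteq> T ` G"
  obtains m where "codim m {0} H"
proof -
  obtain m where "codim m (T ` {0}) (T ` G)" using codim_image_finite [OF T assms(2)] .
  then have "codim m {0} (T ` G)" by (simp add: clin_0 [OF T])
  then show ?thesis
    using codim_split [of m "{0}" "T ` G" H] assms that by (auto simp: csubspace_0)
qed

text \<open>This is rank-nullity in terms of chains.\<close>

lemma codim_zero_preimage:
  assumes T: "clin T" and "csubspace G" "codim a {0} {g\<in>G. T g = 0}" "codim b {0} (T ` G)"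
  shows "codim (a + b) {0} G"
proof -
  have "csubspace {g\<in>G. T g = 0}" using codim_csubspace assms by blast
  moreover from this have "T ` {g\<in>G. T g = 0} = {0}" using csubspace_0 clin_0 [OF T] by force
  ultimately have "codim b {g\<in>G. T g = 0} G"
    using codim_image [OF T, of "{g\<in>G. T g = 0}" G b] assms by auto
  then show ?thesis using codim_trans assms(3) by blast
qed

text \<open>\<open>T\<close> maps each kernel of the chain into the previous one, and the kernel of
  this map is \<open>nullspace T\<close>; so every step adds only finitely many dimensions.\<close>

lemma codim_nullspace_funpow:
  fixes T :: "'a::complex_normed_vector \<Rightarrow> 'a"
  assumes T: "clin T" and "codim n {0} (nullspace T)"
  shows "\<exists>m. codim m {0} (nullspace (T ^^ k))"
proof (induction k)
  case 0
  then show ?case by (auto simp: nullspace_def codim_0_iff intro!: exI [of _ 0])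
next
  case (Suc k)
  then obtain m where m: "codim m {0} (nullspace (T ^^ k))" by blast
  let ?G = "nullspace (T ^^ Suc k)"
  have G: "csubspace ?G" by (intro csubspace_nullspace clin_funpow T)
  have "T ` ?G \<subseteq> (\<lambda>x. x) ` nullspace (T ^^ k)" by (auto simp: nullspace_def funpow_swap1)
  then obtain b where b: "codim b {0} (T ` ?G)"
    using codim_zero_subset [OF clin_id m csubspace_image [OF T G]] by blast
  have "{g\<in>?G. T g = 0} = nullspace T"
    using clin_0 [OF clin_funpow [OF T]] by (auto simp: nullspace_def funpow_swap1)
  then have "codim (n + b) {0} ?G"
    using assms(2) by (intro codim_zero_preimage [OF T G _ b]) simp
  then show ?case ..
qed

lemma codim_range_funpow:
  fixes T :: "'a::complex_normed_vector \<Rightarrow> 'a"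
  assumes T: "clin T" and n: "codim n (range T) UNIV"
  shows "\<exists>m. codim m (range (T ^^ k)) UNIV"
proof (induction k)
  case 0
  then show ?case by (auto simp: codim_0_iff intro!: exI [of _ 0])
next
  case (Suc k)
  then obtain m where m: "codim m (range (T ^^ k)) UNIV" by blast
  obtain b where "codim b ((T ^^ k) ` range T) (range (T ^^ k))"
    using codim_image_finite [OF clin_funpow [OF T] n] by blast
  moreover have "(T ^^ k) ` range T = range (T ^^ Suc k)" by (simp add: image_image funpow_swap1)
  ultimately show ?case using codim_trans m by metis
qed

text \<open>On the finite-dimensional N = \<open>nullspace (T ^^ p)\<close>, kernel and cokernel of
  \<open>T\<close> have equal dimension, namely n, as N contains the whole kernel of
  \<open>T\<close>. Stability at \<open>p\<close> gives T N = range T \<inter> N, and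
  \<open>codim_diamond\<close> transfers the count.\<close>

lemma codim_ascent:
  fixes T :: "'a::complex_normed_vector \<Rightarrow> 'a"
  assumes T: "clin T" and n: "codim n {0} (nullspace T)"
    and p: "nullspace (T ^^ p) = nullspace (T ^^ Suc p)"
  shows "codim n (range T) (range T + nullspace (T ^^ p))"
proof -
  let ?N = "nullspace (T ^^ p)"
  have cs: "csubspace (nullspace T)" "csubspace ?N" "csubspace (range T)" "csubspace (T ` ?N)"
    using T by (simp_all add: csubspace_nullspace csubspace_range csubspace_image clin_funpow)
  have sub: "nullspace T \<subseteq> ?N"
    unfolding p using clin_0 [OF clin_funpow [OF T]] by (auto simp: nullspace_def funpow_swap1)
  have TN: "T ` ?N \<subseteq> ?N"
    
  proof (rule image_subsetI)
    fix x assume "x \<in> ?N"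
    then have "x \<in> nullspace (T ^^ Suc p)" using p by simp
    then show "T x \<in> ?N" by (simp add: nullspace_def funpow_swap1)
  qed
  have RN: "range T \<inter> ?N = T ` ?N"
  proof (intro subset_antisym subsetI)
    fix y assume "y \<in> range T \<inter> ?N"
    then obtain x where "y = T x" "x \<in> nullspace (T ^^ Suc p)" by (auto simp: nullspace_def funpow_swap1)
    then show "y \<in> T ` ?N" using p by blast
  qed (use TN in blast)
  obtain m where m: "codim m {0} ?N" using codim_nullspace_funpow [OF T n] by blast
  obtain d where d: "codim d (nullspace T) ?N"
    using codim_split [OF m cs(1) _ sub] csubspace_0 [OF cs(1)] by blast
  have "T ` nullspace T = {0}" using csubspace_0 [OF cs(1)] clin_0 [OF T] by (auto simp: nullspace_def image_iff)
  then have d': "codim d {0} (T ` ?N)"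
    using codim_image [OF T cs(1,2) sub, of d] d by (auto simp: nullspace_def)
  obtain k where k: "codim k (T ` ?N) ?N"
    using codim_split [OF m cs(4) _ TN] csubspace_0 [OF cs(4)] by blast
  have "m = n + d" "m = d + k"
    by (rule codim_unique_sum [OF n d m], rule codim_unique_sum [OF d' k m])
  then have "codim n (range T \<inter> ?N) ?N" using k RN by simp
  then show ?thesis by (simp add: codim_diamond cs)
qed

text \<open>Stability gives T V = V, so V + N(T) is the preimage of V, and its codimension in the
  whole space is that of V in \<open>range T\<close>. Counting the codimension of V through V + N(T)
  and through \<open>range T\<close> leaves n for the step from V to V + N(T).\<close>

lemma codim_descent:
  fixes T :: "'a::complex_normed_vector \<Rightarrow> 'a"
  assumes T: "clin T" and n: "codim n (range T) UNIV"
    and q: "range (T ^^ q) = range (T ^^ Suc q)"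
  shows "codim n (range (T ^^ q) \<inter> nullspace T) (nullspace T)"
proof -
  let ?V = "range (T ^^ q)"
  have cs: "csubspace (nullspace T)" "csubspace ?V" "csubspace (range T)" "csubspace (?V + nullspace T)"
    using T by (simp_all add: csubspace_nullspace csubspace_range csubspace_plus clin_funpow)
  have TV: "T ` ?V = ?V"
  proof -
    have "T ` ?V = range (T ^^ Suc q)" by (simp add: image_image)
    then show ?thesis using q by simp
  qed
  obtain m where m: "codim m ?V UNIV" using codim_range_funpow [OF T n] by blast
  obtain k e where k: "codim k ?V (?V + nullspace T)" and e: "codim e (?V + nullspace T) UNIV"
    using codim_split [OF m cs(4) subset_plus_left [OF cs(1)]] by blast
  have "codim e (T ` (?V + nullspace T)) (range T)"
    using e subset_plus_right [OF cs(2), of "nullspace T"]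
    by (subst codim_image [OF T cs(4)]) (auto simp: nullspace_def)
  moreover have "T ` (?V + nullspace T) = ?V"
  proof (intro subset_antisym subsetI)
    fix y assume "y \<in> T ` (?V + nullspace T)"
    then obtain v x where "y = T (v + x)" "v \<in> ?V" "x \<in> nullspace T" by (auto elim: set_plus_elim)
    then have "y = T v" by (simp add: clin_add [OF T] nullspace_def)
    then show "y \<in> ?V" using TV \<open>v \<in> ?V\<close> by blast
  next
    fix y assume "y \<in> ?V"
    then have "y \<in> T ` ?V" using TV by simp
    then show "y \<in> T ` (?V + nullspace T)" using subset_plus_left [OF cs(1), of ?V] by blast
  qed
  ultimately have e': "codim e ?V (range T)" by simp
  have "m = e + n" "m = k + e"
    by (rule codim_unique_sum [OF e' n m], rule codim_unique_sum [OF k e m])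
  then have "codim n ?V (?V + nullspace T)" using k by simp
  then show ?thesis by (simp add: codim_diamond cs)
qed

text \<open>Ascent and descent stop at the same \<open>p\<close>. The descent makes
  \<open>range T + nullspace (T ^^ p)\<close> the whole space, and there \<open>codim_ascent\<close>
  has already counted n.\<close>

lemma browder_index_zero:
  fixes T :: "'a::complex_normed_vector \<Rightarrow> 'a"
  assumes T: "clin T" and "browder T" and n: "codim n {0} (nullspace T)"
  shows "codim n (range T) UNIV"
proof -
  obtain p where p: "asc T = enat p" "nullspace (T ^^ p) = nullspace (T ^^ Suc p)"
    using asc_finite assms unfolding browder_def by metis
  obtain p' where p': "des T = enat p'" "range (T ^^ p') = range (T ^^ Suc p')"
    using des_finite assms unfolding browder_def by metis
  have q: "range (T ^^ p) = range (T ^^ Suc p)" using assms p p' by (simp add: browder_def)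
  have "range T + nullspace (T ^^ p) = UNIV"
  proof (rule sym, rule UNIV_eq_I)
    fix x
    have "(T ^^ p) x \<in> range (T ^^ Suc p)" using q by blast
    then obtain w where "(T ^^ p) x = (T ^^ p) (T w)" by (auto simp: funpow_swap1)
    then have "x - T w \<in> nullspace (T ^^ p)" by (simp add: nullspace_def clin_diff [OF clin_funpow [OF T]])
    moreover have "x = T w + (x - T w)" by simp
    ultimately show "x \<in> range T + nullspace (T ^^ p)" by (metis rangeI set_plus_intro)
  qed
  then show ?thesis using codim_ascent [OF T n p(2)] by simp
qed

lemma alpha_finite_iff: "clin T \<Longrightarrow> alpha T < \<infinity> \<longleftrightarrow> (\<exists>n. codim n {0} (nullspace T))"
  by (simp only: alpha_def sub_space_finite_iff csubspace_nullspace)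

lemma beta_finite_iff: "clin T \<Longrightarrow> beta T < \<infinity> \<longleftrightarrow> (\<exists>n. codim n (range T) UNIV)"
  by (simp only: beta_def quotient_space_finite_iff csubspace_range)

text \<open>After q steps every vector is in \<open>U2\<close>, where \<open>T\<close> is bijective
  modulo \<open>U1\<close>, and p further steps kill \<open>U1\<close>; hence kernels and ranges of
  the powers are stable at p + q. Kernel and cokernel of \<open>T\<close> are finite-dimensional
  because \<open>U1\<close> and the quotient by \<open>U2\<close> are.\<close>

lemma browder_criterion:
  fixes T :: "'a::complex_normed_vector \<Rightarrow> 'a"
  assumes T: "clin T"
    and U1: "codim n {0} U1" "T ` U1 \<subseteq> U1" "\<And>u. u \<in> U1 \<Longrightarrow> (T ^^ p) u = 0"
    and U2: "codim m U2 UNIV" "T ` U2 \<subseteq> U2" "\<And>z. (T ^^ q) z \<in> U2"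
    and inj: "\<And>u. u \<in> U2 \<Longrightarrow> T u \<in> U1 \<Longrightarrow> u \<in> U1"
    and onto: "\<And>u. u \<in> U2 \<Longrightarrow> \<exists>v\<in>U2. u - T v \<in> U1"
  shows "browder T"
proof -
  have cs: "csubspace U1" "csubspace U2" using U1(1) U2(1) codim_csubspace by auto
  have csNR: "csubspace (nullspace T)" "csubspace (range T)" "csubspace (range T + U1)"
    using T cs by (simp_all add: csubspace_nullspace csubspace_range csubspace_plus)
  have zero: "(T ^^ k) 0 = 0" for k by (rule clin_0 [OF clin_funpow [OF T]])
  have inv2: "(T ^^ k) u \<in> U2" if "u \<in> U2" for k u
    using that U2(2) by (induction k) auto
  have inv1: "(T ^^ k) u \<in> U1" if "u \<in> U1" for k u
    using that U1(2) by (induction k) auto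
  have inj_pow: "u \<in> U1" if "u \<in> U2" "(T ^^ k) u \<in> U1" for k u
    using that
  proof (induction k)
    case (Suc k)
    then show ?case using inj [OF inv2 [OF Suc.prems(1)]] by simp
  qed simp
  have onto_pow: "\<exists>v\<in>U2. u - (T ^^ k) v \<in> U1" if "u \<in> U2" for k u
  proof (induction k)
    case 0
    then show ?case using that csubspace_0 [OF cs(1)] by (intro bexI [of _ u]) auto
  next
    case (Suc k)
    then obtain v where v: "v \<in> U2" "u - (T ^^ k) v \<in> U1" by blast
    obtain w where w: "w \<in> U2" "v - T w \<in> U1" using onto [OF v(1)] by blast
    have "u - (T ^^ Suc k) w = (u - (T ^^ k) v) + (T ^^ k) (v - T w)"
      by (simp add: clin_diff [OF clin_funpow [OF T]] funpow_swap1)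
    then show ?case using w csubspace_add [OF cs(1) v(2) inv1 [OF w(2)]] by metis
  qed
  have "nullspace (T ^^ (p + q)) = nullspace (T ^^ Suc (p + q))"
  proof (intro subset_antisym subsetI)
    fix z assume "z \<in> nullspace (T ^^ Suc (p + q))"
    then have z: "(T ^^ Suc p) ((T ^^ q) z) = 0"
      using funpow_add_apply [of "Suc p" q T z] by (simp add: nullspace_def)
    have "(T ^^ q) z \<in> U1"
      by (rule inj_pow [OF U2(3), of "Suc p"]) (simp only: z csubspace_0 cs)
    then show "z \<in> nullspace (T ^^ (p + q))" using U1(3) by (simp add: nullspace_def funpow_add_apply)
  qed (simp add: nullspace_def clin_0 [OF T])
  then have asc: "asc T < \<infinity>" by (rule asc_finiteI)
  have "range (T ^^ (p + q)) = range (T ^^ Suc (p + q))"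
  proof (intro subset_antisym subsetI)
    fix y assume "y \<in> range (T ^^ (p + q))"
    then obtain z where z: "y = (T ^^ p) ((T ^^ q) z)" by (auto simp: funpow_add_apply)
    obtain v where v: "v \<in> U2" "(T ^^ q) z - (T ^^ Suc q) v \<in> U1" using onto_pow [OF U2(3)] by blast
    have "(T ^^ p) ((T ^^ q) z - (T ^^ Suc q) v) = 0" by (rule U1(3) [OF v(2)])
    then have "y = (T ^^ p) ((T ^^ Suc q) v)"
      unfolding z by (simp only: clin_diff [OF clin_funpow [OF T]] right_minus_eq)
    also have "\<dots> = (T ^^ Suc (p + q)) v"
      using funpow_add_apply [of p "Suc q" T v] by simp
    finally show "y \<in> range (T ^^ Suc (p + q))" by simp
  qed (auto simp: funpow_swap1)
  then have des: "des T < \<infinity>" by (rule des_finiteI)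
  then obtain k where "codim k U2 (U2 + nullspace T)"
    using codim_split [OF U2(1) csubspace_plus [OF cs(2) csNR(1)] subset_plus_left [OF csNR(1)]] by blast
  then have k: "codim k (U2 \<inter> nullspace T) (nullspace T)" by (simp add: codim_diamond cs csNR)
  have "U2 \<inter> nullspace T \<subseteq> U1" using inj csubspace_0 [OF cs(1)] by (auto simp: nullspace_def)
  then obtain j where "codim j {0} (U2 \<inter> nullspace T)"
    using codim_split [OF U1(1) csubspace_Int [OF cs(2) csNR(1)]] csubspace_0 [OF cs(2)] csubspace_0 [OF csNR(1)]
    by blast
  then have alpha: "alpha T < \<infinity>" using codim_trans k alpha_finite_iff [OF T] by blast
  have "U2 \<subseteq> range T + U1"
  proof
    fix u assume "u \<in> U2"
    then obtain v where "u - T v \<in> U1" using onto by blast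
    then have "T v + (u - T v) \<in> range T + U1" by (intro set_plus_intro) auto
    then show "u \<in> range T + U1" by simp
  qed
  then obtain i where i: "codim i (range T + U1) UNIV" using codim_split [OF U2(1) csNR(3)] by blast
  obtain l where "codim l (range T \<inter> U1) U1"
    using codim_split [OF U1(1) csubspace_Int [OF csNR(2) cs(1)]] csubspace_0 [OF cs(1)] csubspace_0 [OF csNR(2)]
    by blast
  then have "codim l (range T) (range T + U1)" by (simp add: codim_diamond cs csNR)
  then have "beta T < \<infinity>" using codim_trans i beta_finite_iff [OF T] by blast
  with alpha asc des asc_eq_des [OF T asc des] show ?thesis by (simp add: browder_def fredholm_def)
qed

section \<open>Codimension in products and restriction of an isomorphism\<close>

lemma codim_Times_left:
  assumes "codim n K G" "csubspace T" shows "codim n (K \<times> T) (G \<times> T)"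
proof -
  have cs: "csubspace K" "csubspace G" "K \<subseteq> G" using assms codim_csubspace by auto
  have eq: "{0} \<times> T + (\<lambda>x. (x, 0)) ` S = S \<times> T" for S :: "'a set"
    by (auto simp: set_plus_def image_iff)
  have "codim n ({0} \<times> T + (\<lambda>x. (x, 0)) ` K) ({0} \<times> T + (\<lambda>x. (x, 0)) ` G)"
    using assms cs csubspace_0 [OF cs(1)]
    by (subst codim_mod_image) (auto simp: csubspace_Times clin_def scaleC_prod_def)
  then show ?thesis by (simp add: eq)
qed

lemma codim_Times_right:
  assumes "codim n K G" "csubspace T" shows "codim n (T \<times> K) (T \<times> G)"
proof -
  have cs: "csubspace K" "csubspace G" "K \<subseteq> G" using assms codim_csubspace by auto
  have eq: "T \<times> {0} + (\<lambda>x. (0, x)) ` S = T \<times> S" for S :: "'a set"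
    by (auto simp: set_plus_def image_iff)
  have "codim n (T \<times> {0} + (\<lambda>x. (0, x)) ` K) (T \<times> {0} + (\<lambda>x. (0, x)) ` G)"
    using assms cs csubspace_0 [OF cs(1)]
    by (subst codim_mod_image) (auto simp: csubspace_Times clin_def scaleC_prod_def)
  then show ?thesis by (simp add: eq)
qed

text \<open>Shrinking the domain and the codomain of an isomorphism onto a quotient by the same finite
  amount leaves an operator of index zero.\<close>

lemma index_zero_restrict:
  assumes \<Psi>: "clin \<Psi>" "{e\<in>E. \<Psi> e \<in> R} = {0}" "R + \<Psi> ` E = UNIV"
    and E: "codim m K E" "csubspace E" and R: "codim m R S"
  shows "\<exists>n. codim n {0} {k\<in>K. \<Psi> k \<in> S} \<and> codim n (S + \<Psi> ` K) UNIV"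
proof -
  have cs: "csubspace K" "K \<subseteq> E" "csubspace R" "csubspace S" "R \<subseteq> S"
    using E R codim_csubspace by auto
  define L where "L = R + \<Psi> ` K"
  have L: "csubspace L" "R \<subseteq> L"
    by (simp_all add: L_def cs csubspace_plus csubspace_image \<Psi>(1) subset_plus_left)
  have "codim m L (R + \<Psi> ` E)"
    unfolding L_def using E(1) csubspace_0 [OF cs(1)]
    by (subst codim_mod_image [OF \<Psi>(1) cs(3,1) E(2) cs(2)]) (auto simp: \<Psi>(2))
  then have mL: "codim m L UNIV" by (simp add: \<Psi>(3))
  obtain b n where b: "codim b L (L + S)" and n: "codim n (L + S) UNIV" and bn: "b + n = m"
    using codim_split [OF mL csubspace_plus [OF L(1) cs(4)] subset_plus_left [OF cs(4)]] by blast
  have b': "codim b (L \<inter> S) S" using b by (simp add: codim_diamond L cs)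
  obtain a where a: "codim a R (L \<inter> S)"
    using codim_split [OF R csubspace_Int [OF L(1) cs(4)]] L cs by blast
  \<comment> \<open>The way from \<open>R\<close> to \<open>S\<close> has length m directly and
    length a + b through L \<inter> S. Comparison with b + n = m equates a, the future kernel
    dimension, with n, the codimension of the range.\<close>
  have "m = a + b" by (rule codim_unique_sum [OF a b' R])
  with bn have "a = n" by simp
  define Z where "Z = {k\<in>K. \<Psi> k \<in> S}"
  have csZ: "csubspace Z"
    using csubspace_Int [OF cs(1) csubspace_vimage [OF \<Psi>(1) cs(4)]] by (simp add: Z_def Int_def)
  have "L \<inter> S = R + \<Psi> ` Z"
  proof (intro subset_antisym subsetI)
    fix y assume y: "y \<in> L \<inter> S"
    then obtain r k where rk: "y = r + \<Psi> k" "r \<in> R" "k \<in> K" by (auto simp: L_def elim: set_plus_elim)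
    then have "\<Psi> k \<in> S" using y cs csubspace_add_cancel [OF cs(4), of r "\<Psi> k"] by auto
    then show "y \<in> R + \<Psi> ` Z" using rk by (auto simp: Z_def)
  next
    fix y assume "y \<in> R + \<Psi> ` Z"
    then obtain r k where "y = r + \<Psi> k" "r \<in> R" "k \<in> Z" by (auto elim: set_plus_elim)
    then show "y \<in> L \<inter> S" using cs by (auto simp: L_def Z_def intro: csubspace_add)
  qed
  moreover have "R + \<Psi> ` {0} = R" using cs clin_0 [OF \<Psi>(1)] by (simp add: add.commute [of R])
  ultimately have "codim a (R + \<Psi> ` {0}) (R + \<Psi> ` Z)" using a by simp
  then have "codim a {0} Z"
    by (subst (asm) codim_mod_image [OF \<Psi>(1) cs(3) csubspace_zero csZ])
       (use csubspace_0 [OF csZ] cs(2) \<Psi>(2) in \<open>auto simp: Z_def\<close>)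
  moreover have "L + S = S + \<Psi> ` K"
  proof -
    have "S + R = S" by (rule csubspace_plus_absorb [OF cs(4,3,5)])
    then show ?thesis unfolding L_def by (metis add.assoc add.commute)
  qed
  ultimately show ?thesis using n \<open>a = n\<close> unfolding Z_def by auto
qed

section \<open>Upper triangular operators\<close>

lemma upper_triangular_apply: "upper_triangular A C B z = (A (fst z) + C (snd z), B (snd z))"
  by (simp add: upper_triangular_def case_prod_beta)

lemma bounded_clinear_upper_triangular:
  assumes "bounded_clinear A" "bounded_clinear B" "bounded_clinear C"
  shows "bounded_clinear (upper_triangular A C B)"
proof -
  have "upper_triangular A C B = (\<lambda>z. (A (fst z) + C (snd z), B (snd z)))"
    by (rule ext) (rule upper_triangular_apply)
  then show ?thesis
    by (simp only:)
       (intro bounded_clinear_Pair bounded_clinear_add bounded_clinear_compose [OF assms(1) bounded_clinear_fst]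
         bounded_clinear_compose [OF assms(2) bounded_clinear_snd]
         bounded_clinear_compose [OF assms(3) bounded_clinear_snd])
qed

lemma upper_triangular_funpow_snd: "snd ((upper_triangular A C B ^^ k) z) = (B ^^ k) (snd z)"
  by (induction k) (simp_all add: upper_triangular_apply)

lemma upper_triangular_funpow_left:
  assumes "clin C" "clin B"
  shows "(upper_triangular A C B ^^ k) (x, 0) = ((A ^^ k) x, 0)"
  by (induction k) (simp_all add: upper_triangular_apply clin_0 assms)

text \<open>\<open>M\<close> and \<open>J\<close> are compared without computing either kernel or
  range. The kernel of \<open>M\<close> and that of \<open>J\<close> modulo \<open>R\<close> both
  contain \<open>N0\<close> as their part with second component 0, and they have the same projection
  to the second factor. The two ranges have the same intersection and the same sum with
  \<open>H\<close>.\<close>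

lemma triangular_index_zero:
  fixes A :: "'a::complex_normed_vector \<Rightarrow> 'a" and B :: "'b::complex_normed_vector \<Rightarrow> 'b"
  assumes lin: "clin A" "clin B" "clin C" and M: "M = upper_triangular A C B"
    and n: "codim n {0} (nullspace M)" "codim n (range M) UNIV"
  defines "E \<equiv> nullspace A \<times> nullspace B" and "R \<equiv> range A \<times> range B" and "J \<equiv> (\<lambda>z. (C (snd z), 0))"
  shows "codim n {0} {e\<in>E. J e \<in> R} \<and> codim n (R + J ` E) UNIV"
proof
  have MM: "M z = (A (fst z) + C (snd z), B (snd z))" for z by (simp add: M upper_triangular_apply)
  have linM: "clin M" using lin by (auto simp: clin_def MM scaleC_prod_def scaleC_add_right)
  have linJ: "clin J" using lin by (auto simp: J_def clin_def scaleC_prod_def)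
  have csA: "csubspace (nullspace A)" "csubspace (range A)" and csB: "csubspace (nullspace B)" "csubspace (range B)"
    and csM: "csubspace (nullspace M)" "csubspace (range M)"
    using lin linM by (simp_all add: csubspace_nullspace csubspace_range)
  have csE: "csubspace E" "csubspace R" by (simp_all add: E_def R_def csA csB csubspace_Times)
  define N0 where "N0 = nullspace A \<times> ({0} :: 'b set)"
  define S where "S = {e\<in>E. J e \<in> R}"
  have csN0: "csubspace N0" by (simp add: N0_def csA csubspace_Times)
  have csS: "csubspace S"
    using csubspace_Int [OF csE(1) csubspace_vimage [OF linJ csE(2)]] by (simp add: S_def Int_def)
  have N0M: "N0 \<subseteq> nullspace M" by (auto simp: N0_def nullspace_def MM clin_0 lin zero_prod_def)
  have N0S: "N0 \<subseteq> S"
    using csubspace_0 [OF csA(2)] csubspace_0 [OF csB(2)] csubspace_0 [OF csB(1)]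
    by (auto simp: N0_def S_def E_def J_def R_def clin_0 lin)
  obtain a b where ab: "codim a {0} N0" "codim b N0 (nullspace M)" "a + b = n"
    using codim_split [OF n(1) csN0 _ N0M] csubspace_0 [OF csN0] by blast
  have "snd ` nullspace M = snd ` S"
  proof (intro subset_antisym subsetI)
    fix y assume "y \<in> snd ` nullspace M"
    then obtain x where x: "A x + C y = 0" "B y = 0" by (auto simp: nullspace_def MM zero_prod_def)
    then have "C y = A (- x)" by (simp add: clin_minus lin add_eq_0_iff)
    then have "(0, y) \<in> S"
      using x csubspace_0 [OF csA(1)] csubspace_0 [OF csB(2)]
      by (auto simp: S_def E_def R_def J_def nullspace_def)
    then show "y \<in> snd ` S" by force
  next
    fix y assume "y \<in> snd ` S"
    then obtain x where x: "C y = A x" "B y = 0" by (auto simp: S_def E_def R_def J_def nullspace_def)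
    then have "(- x, y) \<in> nullspace M" by (simp add: nullspace_def MM clin_minus lin zero_prod_def)
    then show "y \<in> snd ` nullspace M" by force
  qed
  moreover have "codim b (snd ` N0) (snd ` nullspace M)"
    by (subst codim_image [OF clin_snd csN0 csM(1) N0M])
       (use ab in \<open>auto simp: N0_def nullspace_def MM clin_0 lin zero_prod_def\<close>)
  ultimately have "codim b (snd ` N0) (snd ` S)" by simp
  then have "codim b N0 S"
    by (subst (asm) codim_image [OF clin_snd csN0 csS N0S]) (auto simp: N0_def S_def E_def)
  then show "codim n {0} {e\<in>E. J e \<in> R}"
    using codim_trans [OF ab(1)] ab(3) by (auto simp: S_def)

  define H where "H = (UNIV :: 'a set) \<times> ({0} :: 'b set)"
  define R' where "R' = R + J ` E"
  have csH: "csubspace H" by (simp add: H_def csubspace_Times)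
  have csR': "csubspace R'" by (simp add: R'_def csE csubspace_plus csubspace_image linJ)
  have memR': "(x, y) \<in> R' \<longleftrightarrow> (\<exists>u v. B v = 0 \<and> x = A u + C v) \<and> y \<in> range B" for x y
  proof
    assume "(x, y) \<in> R'"
    then obtain r e where "(x, y) = r + J e" "r \<in> R" "e \<in> E" by (auto simp: R'_def elim: set_plus_elim)
    then show "(\<exists>u v. B v = 0 \<and> x = A u + C v) \<and> y \<in> range B"
      by (force simp: R_def E_def J_def nullspace_def)
  next
    assume "(\<exists>u v. B v = 0 \<and> x = A u + C v) \<and> y \<in> range B"
    then obtain u v w where uv: "B v = 0" "x = A u + C v" "y = B w" by blast
    have "(A u, B w) + J (0, v) \<in> R + J ` E"
      using uv by (intro set_plus_intro imageI) (auto simp: R_def E_def nullspace_def clin_0 lin)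
    then show "(x, y) \<in> R'" using uv by (simp add: R'_def J_def)
  qed
  have memM: "(x, y) \<in> range M \<longleftrightarrow> (\<exists>u v. x = A u + C v \<and> y = B v)" for x y
    by (auto simp: MM image_iff)
  have memH: "(x, y) \<in> T + H \<longleftrightarrow> y \<in> snd ` T" for x y T
  proof
    assume "(x, y) \<in> T + H"
    then show "y \<in> snd ` T" by (force simp: H_def elim!: set_plus_elim)
  next
    assume "y \<in> snd ` T"
    then obtain z where "(z, y) \<in> T" by auto
    moreover have "(x - z, 0) \<in> H" by (simp add: H_def)
    ultimately have "(z, y) + (x - z, 0) \<in> T + H" by (rule set_plus_intro)
    then show "(x, y) \<in> T + H" by simp
  qed
  have int: "range M \<inter> H = R' \<inter> H"
  proof -
    have "(x, y) \<in> range M \<inter> H \<longleftrightarrow> (x, y) \<in> R' \<inter> H" for x y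
      using csubspace_0 [OF csB(2)] unfolding Int_iff memM memR' H_def mem_Times_iff by force
    then show ?thesis by (simp only: set_eq_iff split_paired_All simp_thms)
  qed
  have plus: "range M + H = R' + H"
  proof -
    have "snd ` range M = range B" by (auto simp: MM image_iff)
    moreover have "snd ` R' = range B"
    proof (intro subset_antisym subsetI)
      fix y assume "y \<in> range B"
      then have "(0, y) \<in> R'" using clin_0 [OF lin(1)] clin_0 [OF lin(2)] clin_0 [OF lin(3)]
        unfolding memR' by (metis add.right_neutral)
      then show "y \<in> snd ` R'" by force
    qed (auto simp: memR')
    ultimately show ?thesis by (auto simp: memH set_eq_iff)
  qed
  obtain c d where c: "codim c (range M) (range M + H)" and d: "codim d (range M + H) UNIV" and cd: "c + d = n"
    using codim_split [OF n(2) csubspace_plus [OF csM(2) csH] subset_plus_left [OF csH]] by blast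
  have "codim c R' (R' + H)"
    using c by (simp add: codim_diamond csM csR' csH int)
  then have "codim n R' UNIV" using codim_trans d plus cd by metis
  then show "codim n (R + J ` E) UNIV" by (simp add: R'_def)
qed

lemma browder_imp_conditions:
  fixes A :: "'a::complex_banach \<Rightarrow> 'a" and B :: "'b::complex_banach \<Rightarrow> 'b"
  assumes A: "bounded_clinear A" and B: "bounded_clinear B" and C: "bounded_clinear C"
    and browder: "browder (upper_triangular A C B)"
  shows "left_semi_browder A \<and> right_semi_browder B \<and>
    sub_space (nullspace A) \<times>\<^sub>s sub_space (nullspace B)
      \<cong>\<^sub>s quotient_space (range A) \<times>\<^sub>s quotient_space (range B)"
proof -
  define M where "M = upper_triangular A C B"
  have MM: "M z = (A (fst z) + C (snd z), B (snd z))" for z by (simp add: M_def upper_triangular_apply)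
  have bM: "bounded_clinear M" unfolding M_def by (rule bounded_clinear_upper_triangular [OF A B C])
  have lin: "clin A" "clin B" "clin C" "clin M" using A B C bM bounded_clinear_clin by auto
  have brM: "browder M" using browder by (simp add: M_def)
  have "alpha M < \<infinity>" using brM by (simp only: browder_def fredholm_def)
  then obtain n where n: "codim n {0} (nullspace M)" using alpha_finite_iff [OF lin(4)] by blast
  have n': "codim n (range M) UNIV" by (rule browder_index_zero [OF lin(4) brM n])
  obtain P where P: "bounded_clinear P" "range P = nullspace M" "\<And>x. P (P x) = P x"
    using finite_projection [OF n] by metis
  obtain S Q where SQ: "bounded_clinear S" "bounded_clinear Q" "\<And>x. S (M x) = x - P x"
    "\<And>y. M (S y) = y - Q y" "codim n {0} (range Q)" "\<And>x. Q (M x) = 0"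
    by (rule parametrix [OF bM P n']) (rule that)
  have linPQ: "clin P" "clin Q" using P(1) SQ(2) bounded_clinear_clin by auto

  \<comment> \<open>The upper left corner of the parametrix: since M (x, 0) = (A x, 0), it inverts
    \<open>A\<close> from the left up to a term in \<open>P\<close>, which has finite-dimensional
    range.\<close>
  define SA where "SA x = fst (S (x, 0))" for x
  have SA: "bounded_clinear SA"
    unfolding SA_def
    by (intro bounded_clinear_compose [OF bounded_clinear_fst] bounded_clinear_compose [OF SQ(1)] bounded_clinear_Pair
        bounded_clinear_id bounded_clinear_zero)
  have "SA (A x) = x - fst (P (x, 0))" for x
    using SQ(3) [of "(x, 0)"] by (simp add: SA_def MM clin_0 lin)
  then have HA: "A x - A (SA (A x)) = A (fst (P (x, 0)))" for x by (simp add: clin_diff lin)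
  have "clin (\<lambda>x. A (fst (P (x, 0))))"
    by (intro clin_compose [OF lin(1)] clin_compose [OF clin_fst] clin_compose [OF linPQ(1)])
       (simp add: clin_def scaleC_prod_def)
  moreover have "range (\<lambda>x. A (fst (P (x, 0)))) \<subseteq> (\<lambda>z. A (fst z)) ` nullspace M"
    using P(2) by auto
  ultimately obtain k where "codim k {0} (range (\<lambda>x. A (fst (P (x, 0)))))"
    using codim_zero_subset [OF clin_compose [OF lin(1) clin_fst] n] csubspace_range by metis
  then obtain A' where A': "bounded_clinear A'" "\<And>x. A (A' (A x)) = A x"
    using generalized_inverse [OF A SA, of k] by (auto simp: HA)

  \<comment> \<open>The lower right corner: \<open>B (SB y)\<close> is the second component of
    \<open>M (S (0, y))\<close>, so \<open>SB\<close> inverts \<open>B\<close> from the right up to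
    a term in \<open>Q\<close>.\<close>
  define SB where "SB y = snd (S (0, y))" for y
  have SB: "bounded_clinear SB"
    unfolding SB_def
    by (intro bounded_clinear_compose [OF bounded_clinear_snd] bounded_clinear_compose [OF SQ(1)] bounded_clinear_Pair
        bounded_clinear_id bounded_clinear_zero)
  have "B (SB y) = y - snd (Q (0, y))" for y
  proof -
    have "B (SB y) = snd (M (S (0, y)))" by (simp add: MM SB_def)
    then show ?thesis by (simp add: SQ(4))
  qed
  then have HB: "B y - B (SB (B y)) = snd (Q (0, B y))" for y by simp
  have "clin (\<lambda>y. snd (Q (0, B y)))"
    by (intro clin_compose [OF clin_snd] clin_compose [OF linPQ(2)])
       (use lin in \<open>simp add: clin_def scaleC_prod_def\<close>)
  moreover have "range (\<lambda>y. snd (Q (0, B y))) \<subseteq> snd ` range Q" by auto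
  ultimately obtain l where "codim l {0} (range (\<lambda>y. snd (Q (0, B y))))"
    using codim_zero_subset [OF clin_snd SQ(5)] csubspace_range by metis
  then obtain B' where B': "bounded_clinear B'" "\<And>x. B (B' (B x)) = B x"
    using generalized_inverse [OF B SB, of l] by (auto simp: HB)

  have "nullspace A \<subseteq> fst ` nullspace M"
  proof
    fix x assume "x \<in> nullspace A"
    then have "(x, 0) \<in> nullspace M" by (simp add: nullspace_def MM clin_0 lin zero_prod_def)
    then show "x \<in> fst ` nullspace M" by force
  qed
  then obtain j where "codim j {0} (nullspace A)"
    using codim_zero_subset [OF clin_fst n csubspace_nullspace [OF lin(1)]] by blast
  then have alpha: "alpha A < \<infinity>" using alpha_finite_iff [OF lin(1)] by blast
  obtain i where "codim i (snd ` range M) (snd ` (UNIV :: ('a \<times> 'b) set))" 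
    by (rule codim_image_finite [OF clin_snd n'])
  moreover have "snd ` range M = range B" by (auto simp: MM image_iff)
  ultimately have beta: "beta B < \<infinity>" using beta_finite_iff [OF lin(2)] by auto

  have ad: "asc M < \<infinity>" "des M < \<infinity>" using brM unfolding browder_def by metis+
  obtain p where p: "nullspace (M ^^ p) = nullspace (M ^^ Suc p)" using asc_finite [OF ad(1)] by blast
  \<comment> \<open>The first factor is invariant under \<open>M\<close>, which acts there as
    \<open>A\<close>, so the kernels of powers of \<open>A\<close> are slices of those of
    \<open>M\<close>. Dually, the second projection carries ranges of powers of \<open>M\<close>
    onto those of \<open>B\<close>.\<close>
  have "x \<in> nullspace (A ^^ k) \<longleftrightarrow> (x, 0) \<in> nullspace (M ^^ k)" for x k
    unfolding M_def by (simp only: nullspace_def mem_Collect_eq upper_triangular_funpow_left lin) (simp add: zero_prod_def)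
  then have "nullspace (A ^^ p) = nullspace (A ^^ Suc p)" using p by (simp only: set_eq_iff simp_thms)
  then have asc: "asc A < \<infinity>" by (rule asc_finiteI)
  obtain q where q: "range (M ^^ q) = range (M ^^ Suc q)" using des_finite [OF ad(2)] by blast
  have "range (B ^^ k) = snd ` range (M ^^ k)" for k
  proof -
    have "snd ` range (M ^^ k) = (B ^^ k) ` range (snd :: 'a \<times> 'b \<Rightarrow> 'b)"
      unfolding M_def by (simp only: image_image upper_triangular_funpow_snd)
    then show ?thesis by simp
  qed
  then have "range (B ^^ q) = range (B ^^ Suc q)" using q by (simp only:)
  then have des: "des B < \<infinity>" by (rule des_finiteI)

  let ?E = "nullspace A \<times> nullspace B" and ?R = "range A \<times> range B"
  define J where "J = (\<lambda>z :: 'a \<times> 'b. (C (snd z), 0 :: 'b))"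
  have bJ: "bounded_clinear J"
    unfolding J_def
    by (intro bounded_clinear_Pair bounded_clinear_compose [OF C] bounded_clinear_snd bounded_clinear_zero)
  have index: "codim n {0} {e\<in>?E. J e \<in> ?R} \<and> codim n (?R + J ` ?E) UNIV"
    unfolding J_def by (rule triangular_index_zero [OF lin(1-3) M_def n n'])
  have "csubspace ?E" "csubspace ?R"
    using lin by (simp_all add: csubspace_Times csubspace_nullspace csubspace_range)
  from index_zero_perturbation [OF bJ this conjunct1 [OF index] conjunct2 [OF index]]
  obtain \<Psi> where \<Psi>: "bounded_clinear \<Psi>" "{e\<in>?E. \<Psi> e \<in> ?R} = {0}" "?R + \<Psi> ` ?E = UNIV"
    by (elim exE conjE) (rule that)
  \<comment> \<open>A A' projects onto the range of \<open>A\<close>; the complementary projection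
    kills that range and changes a vector only by an element of it.\<close>
  define PA where "PA x = x - A (A' x)" for x
  define PB where "PB x = x - B (B' x)" for x
  have "sub_space (nullspace A) \<times>\<^sub>s sub_space (nullspace B)
      \<cong>\<^sub>s quotient_space (range A) \<times>\<^sub>s quotient_space (range B)"
  proof (rule operator_isomorphic [OF A B _ _ _ _ _ _ \<Psi>])
    show "bounded_clinear PA" "bounded_clinear PB"
      unfolding PA_def PB_def
      by (intro bounded_clinear_diff bounded_clinear_id bounded_clinear_compose [OF A A'(1)]
          bounded_clinear_compose [OF B B'(1)])+
  qed (simp_all add: PA_def PB_def A' B')
  then show ?thesis
    using generalized_inverse_range [OF A A'] generalized_inverse_nullspace [OF B B'] alpha beta asc des
    by (simp add: left_semi_browder_def right_semi_browder_def left_semi_fredholm_def right_semi_fredholm_def)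
qed

lemma conditions_imp_browder:
  fixes A :: "'a::complex_banach \<Rightarrow> 'a" and B :: "'b::complex_banach \<Rightarrow> 'b"
  assumes A: "bounded_clinear A" and B: "bounded_clinear B"
    and left: "left_semi_browder A" and right: "right_semi_browder B"
    and iso: "sub_space (nullspace A) \<times>\<^sub>s sub_space (nullspace B)
      \<cong>\<^sub>s quotient_space (range A) \<times>\<^sub>s quotient_space (range B)"
  shows "\<exists>C. bounded_clinear C \<and> browder (upper_triangular A C B)"
proof -
  have lin: "clin A" "clin B" using A B bounded_clinear_clin by auto
  have cs: "csubspace (range A)" "csubspace (range B)" "csubspace (nullspace A)" "csubspace (nullspace B)"
    using lin by (simp_all add: csubspace_range csubspace_nullspace)
  have fin: "alpha A < \<infinity>" "beta B < \<infinity>" "asc A < \<infinity>" "des B < \<infinity>"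
    and clo: "closed (range A)" "complemented (range A)" "closed (nullspace B)" "complemented (nullspace B)"
    using left right
    by (simp_all only: left_semi_browder_def right_semi_browder_def left_semi_fredholm_def right_semi_fredholm_def)
  obtain a where a: "codim a {0} (nullspace A)" using alpha_finite_iff [OF lin(1)] fin by blast
  obtain b where b: "codim b (range B) UNIV" using beta_finite_iff [OF lin(2)] fin by blast
  obtain p where p: "nullspace (A ^^ p) = nullspace (A ^^ Suc p)" using asc_finite [OF fin(3)] by blast
  obtain q where q: "range (B ^^ q) = range (B ^^ Suc q)" using des_finite [OF fin(4)] by blast

  obtain PR where PR: "bounded_clinear PR" "range PR = range A" "\<And>x. PR (PR x) = PR x"
    using complemented_projection [OF cs(1) clo(1,2)] by blast
  obtain PA where PA: "bounded_clinear PA" "range PA = nullspace A" "\<And>x. PA (PA x) = PA x"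
    using finite_projection [OF a] by blast
  obtain PB where PB: "bounded_clinear PB" "range PB = nullspace B" "\<And>x. PB (PB x) = PB x"
    using complemented_projection [OF cs(4) clo(3,4)] by blast
  \<comment> \<open>What is needed from the parametrix is \<open>Q\<close>, a bounded operator that
    vanishes on the range of \<open>B\<close> and is the identity modulo this range.\<close>
  obtain S Q where Q: "bounded_clinear S" "bounded_clinear Q" "\<And>x. S (B x) = x - PB x"
    "\<And>y. B (S y) = y - Q y" "codim b {0} (range Q)" "\<And>x. Q (B x) = 0"
    by (rule parametrix [OF B PB b]) (rule that)
  define P where "P x = x - PR x" for x
  have P: "bounded_clinear P" unfolding P_def by (intro bounded_clinear_diff bounded_clinear_id PR)
  have PA0: "P (A x) = 0" for x
  proof -
    obtain z where "A x = PR z" using PR(2) by blast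
    then show ?thesis by (simp add: P_def PR(3))
  qed
  have P_range: "x - P x \<in> range A" for x using PR(2) by (auto simp: P_def)
  have Q_range: "y - Q y \<in> range B" for y by (metis Q(4) rangeI)
  let ?E = "nullspace A \<times> nullspace B" and ?R = "range A \<times> range B"
  define PE where "PE z = (PA (fst z), PB (snd z))" for z
  have PE: "bounded_clinear PE" "range PE = ?E" "\<And>z. PE (PE z) = PE z"
  proof -
    show "bounded_clinear PE"
      unfolding PE_def
      by (intro bounded_clinear_Pair bounded_clinear_compose [OF PA(1)] bounded_clinear_compose [OF PB(1)]
          bounded_clinear_fst bounded_clinear_snd)
    show "range PE = ?E" unfolding PA(2) [symmetric] PB(2) [symmetric] by (auto simp: PE_def image_iff)
    show "PE (PE z) = PE z" for z by (simp add: PE_def PA PB)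
  qed
  obtain \<Psi> where \<Psi>: "bounded_clinear \<Psi>" "{e\<in>?E. \<Psi> e \<in> ?R} = {0}" "?R + \<Psi> ` ?E = UNIV"
    using isomorphic_operator [OF A B P PA0 P_range Q(2,6) Q_range PE iso] by blast
  have lin\<Psi>: "clin \<Psi>" by (rule bounded_clinear_clin [OF \<Psi>(1)])

  define N where "N = nullspace (A ^^ p)"
  define V where "V = range (B ^^ q)"
  define K where "K = V \<inter> nullspace B"
  define R1 where "R1 = range A + N"
  have csN: "csubspace N" "csubspace V" "csubspace K" "csubspace R1"
    using lin cs by (simp_all add: N_def V_def K_def R1_def csubspace_nullspace csubspace_range clin_funpow
        csubspace_Int csubspace_plus)
  have aN: "codim a (range A) R1" unfolding R1_def N_def by (rule codim_ascent [OF lin(1) a p])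
  have bK: "codim b K (nullspace B)" unfolding K_def V_def by (rule codim_descent [OF lin(2) b q])
  \<comment> \<open>The domain loses a dimensions in N(A) and b in N(B); the codomain loses a in
    X/R(A) and b in Y/R(B). Afterwards nothing is left of N(A) and of Y/R(B).\<close>
  have "codim (a + b) ({0} \<times> K) ?E"
    using codim_trans [OF codim_Times_left [OF a csN(3)] codim_Times_right [OF bK cs(3)]] .
  moreover have "codim (a + b) ?R (R1 \<times> UNIV)"
    using codim_trans [OF codim_Times_left [OF aN cs(2)] codim_Times_right [OF b csN(4)]] .
  ultimately obtain n where n: "codim n {0} {k\<in>{0} \<times> K. \<Psi> k \<in> R1 \<times> UNIV}"
      "codim n (R1 \<times> UNIV + \<Psi> ` ({0} \<times> K)) UNIV"
    using index_zero_restrict [OF lin\<Psi> \<Psi>(2,3) _ csubspace_Times [OF cs(3,4)], of "a + b" "{0} \<times> K" "R1 \<times> UNIV"]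
    by (metis (no_types, lifting))
  \<comment> \<open>Modulo \<open>R1 \<times> UNIV\<close> only the first component of \<Psi>
    counts, and on \<open>{0} \<times> K\<close> only its second argument: the restricted operator
    has the shape of a corner entry.\<close>
  define J where "J y = fst (\<Psi> (0, y))" for y
  have J: "bounded_clinear J"
    unfolding J_def
    by (intro bounded_clinear_compose [OF bounded_clinear_fst] bounded_clinear_compose [OF \<Psi>(1)]
        bounded_clinear_Pair bounded_clinear_zero bounded_clinear_id)
  have "codim n {0} {y\<in>K. J y \<in> R1}"
  proof -
    let ?Z = "{k\<in>{0} \<times> K. \<Psi> k \<in> R1 \<times> UNIV}"
    have csZ: "csubspace ?Z" using n codim_csubspace by blast
    have "codim n (snd ` {0 :: 'a \<times> 'b}) (snd ` ?Z)"
      by (subst codim_image [OF clin_snd csubspace_zero csZ]) (use n csubspace_0 [OF csZ] in \<open>auto simp: zero_prod_def\<close>)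
    moreover have "snd ` ?Z = {y\<in>K. J y \<in> R1}" by (force simp: J_def mem_Times_iff image_iff)
    ultimately show ?thesis by simp
  qed
  moreover have "codim n (R1 + J ` K) UNIV"
  proof -
    let ?L = "R1 \<times> UNIV + \<Psi> ` ({0} \<times> K)"
    have csL: "csubspace ?L" using n codim_csubspace by blast
    have "R1 \<times> UNIV \<subseteq> ?L"
      using csN by (intro subset_plus_left csubspace_image lin\<Psi> csubspace_Times csubspace_zero)
    then have "{g\<in>UNIV. fst g = 0} \<subseteq> ?L" using csubspace_0 [OF csN(4)] by (auto simp: subset_iff)
    then have "codim n (fst ` ?L) (fst ` (UNIV :: ('a \<times> 'b) set))"
      by (subst codim_image [OF clin_fst csL csubspace_UNIV]) (use n in auto)
    moreover have "fst ` ?L = R1 + J ` K"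
    proof (intro subset_antisym subsetI)
      fix x assume "x \<in> fst ` ?L"
      then obtain r k where "x = fst (r + \<Psi> (0, k))" "fst r \<in> R1" "k \<in> K" by (auto elim!: set_plus_elim)
      then show "x \<in> R1 + J ` K" by (simp add: J_def set_plus_intro)
    next
      fix x assume "x \<in> R1 + J ` K"
      then obtain r k where rk: "x = r + J k" "r \<in> R1" "k \<in> K" by (auto elim!: set_plus_elim)
      then have "(r, 0) + \<Psi> (0, k) \<in> ?L" by (intro set_plus_intro imageI) auto
      then show "x \<in> fst ` ?L" using rk by (force simp: J_def)
    qed
    ultimately show ?thesis by simp
  qed
  ultimately obtain C where C: "bounded_clinear C" "{y\<in>K. C y \<in> R1} = {0}" "R1 + C ` K = UNIV"
    using index_zero_perturbation [OF J csN(3,4), of n] by metis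
  have linC: "clin C" by (rule bounded_clinear_clin [OF C(1)])
  define M where "M = upper_triangular A C B"
  have MM: "M z = (A (fst z) + C (snd z), B (snd z))" for z by (simp add: M_def upper_triangular_apply)
  have linM: "clin M"
    unfolding M_def by (rule bounded_clinear_clin [OF bounded_clinear_upper_triangular [OF A B C(1)]])
  have left_pow: "(M ^^ k) (x, 0) = ((A ^^ k) x, 0)" for k x
    unfolding M_def by (rule upper_triangular_funpow_left [OF linC lin(2)])
  \<comment> \<open>Stability at \<open>p\<close> makes \<open>N\<close> not merely invariant under
    \<open>A\<close> but equal to its own preimage.\<close>
  have AN: "A x \<in> N \<longleftrightarrow> x \<in> N" for x
  proof -
    have "x \<in> N \<longleftrightarrow> x \<in> nullspace (A ^^ Suc p)" using p by (simp add: N_def)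
    then show ?thesis by (simp add: N_def nullspace_def funpow_swap1)
  qed
  have BV: "B ` V = V"
  proof -
    have "B ` V = range (B ^^ Suc q)" by (simp add: V_def image_image)
    then show ?thesis using q by (simp add: V_def)
  qed
  obtain m where "codim m {0} N" using codim_nullspace_funpow [OF lin(1) a] unfolding N_def by blast
  then have m: "codim m {0} (N \<times> {0 :: 'b})"
    using codim_Times_left [of m "{0}" N "{0}"] by (simp add: zero_prod_def)
  obtain v where "codim v V UNIV" using codim_range_funpow [OF lin(2) b] unfolding V_def by blast
  then have v: "codim v (UNIV \<times> V) (UNIV :: ('a \<times> 'b) set)"
    using codim_Times_right [of v V UNIV "UNIV :: 'a set"] by simp
  have "browder M"
  proof (rule browder_criterion [OF linM m _ _ v])
    show "M ` (N \<times> {0}) \<subseteq> N \<times> {0}" by (auto simp: MM AN clin_0 lin linC)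
    show "(M ^^ p) u = 0" if "u \<in> N \<times> {0}" for u
      using that by (auto simp: left_pow N_def nullspace_def zero_prod_def)
    show "M ` (UNIV \<times> V) \<subseteq> UNIV \<times> V" using BV by (auto simp: MM)
    show "(M ^^ q) z \<in> UNIV \<times> V" for z
      by (simp add: mem_Times_iff M_def upper_triangular_funpow_snd V_def)
  next
    fix u assume "u \<in> UNIV \<times> V" "M u \<in> N \<times> {0}"
    then obtain x y where u: "u = (x, y)" "y \<in> V" "A x + C y \<in> N" "B y = 0" by (cases u) (auto simp: MM)
    have "y \<in> K" using u by (simp add: K_def nullspace_def)
    \<comment> \<open>\<open>C y\<close> is an element of \<open>range A\<close> plus one of
      \<open>N\<close>, and \<open>C\<close> is injective on \<open>K\<close> modulo
      \<open>R1\<close>.\<close>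
    have "A (- x) + (A x + C y) \<in> R1" unfolding R1_def using u by (intro set_plus_intro) auto
    then have "C y \<in> R1" by (simp add: clin_minus lin)
    with \<open>y \<in> K\<close> have "y \<in> {y\<in>K. C y \<in> R1}" by simp
    then have "y = 0" unfolding C(2) by simp
    then show "u \<in> N \<times> {0}" using u AN by (simp add: clin_0 linC)
  next
    fix u :: "'a \<times> 'b" assume "u \<in> UNIV \<times> V"
    then obtain x0 y0 where u: "u = (x0, y0)" "y0 \<in> V" by (cases u) auto
    then obtain y where y: "y \<in> V" "y0 = B y" using BV by blast
    \<comment> \<open>\<open>y\<close> settles the second component. Adding \<open>k\<close> from
      \<open>K\<close> preserves it, since B k = 0, and together with the choice of \<open>x\<close>
      adjusts the first component modulo \<open>N\<close>.\<close>
    have "x0 - C y \<in> R1 + C ` K" unfolding C(3) by simp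
    then obtain r k where rk: "x0 - C y = r + C k" "r \<in> R1" "k \<in> K" by (auto elim: set_plus_elim)
    then obtain x z where xz: "r = A x + z" "z \<in> N" by (auto simp: R1_def elim: set_plus_elim)
    have k: "k \<in> V" "B k = 0" using rk by (auto simp: K_def nullspace_def)
    have "u - M (x, y + k) = (z, 0)"
      using rk xz k by (simp add: u y MM clin_add lin linC algebra_simps)
    then show "\<exists>w\<in>UNIV \<times> V. u - M w \<in> N \<times> {0}"
      using xz csubspace_add [OF csN(2) y(1) k(1)] by (intro bexI [of _ "(x, y + k)"]) auto
  qed
  then show ?thesis using C(1) by (auto simp: M_def)
qed

theorem theorem2p9:
  fixes A :: "'a::complex_banach \<Rightarrow> 'a" and B :: "'b::complex_banach \<Rightarrow> 'b"
  assumes "vdim (sub_space (UNIV :: 'a set)) = \<infinity>"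
    and "vdim (sub_space (UNIV :: 'b set)) = \<infinity>"
    and "bounded_clinear A" and "bounded_clinear B"
  shows "(\<exists>C :: 'b \<Rightarrow> 'a. bounded_clinear C \<and> browder (upper_triangular A C B)) \<longleftrightarrow>
    left_semi_browder A \<and>
    right_semi_browder B \<and>
    sub_space (nullspace A) \<times>\<^sub>s sub_space (nullspace B)
      \<cong>\<^sub>s quotient_space (range A) \<times>\<^sub>s quotient_space (range B)"
  using browder_imp_conditions conditions_imp_browder assms(3,4) by blast

end
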